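(* Let $d,m\ge 1$ be integers, $n=d+m$, let $A\in\mathbb{R}^{(d+1)\times m}$ and let $\mathcal{L}=\{(\bm{x},\widetilde{\bm{x}}A)\mid \bm{x}\in\mathbb{R}^d\}\subset\mathbb{R}^n$, where $\widetilde{\bm{x}}=(1,\bm{x})$. Suppose that $\omega(A)=\omega<n$, and let $s$ be a real number with $$\frac{d+1-m\tau_0}{\tau_0+1}<s\le d,\qquad\text{where}\qquad \tau_0:=\frac{1}{\max\{m,\omega\}}.$$ Then for any decreasing function $\psi:\mathbb{N}\to\mathbb{R}_{>0}$ such that $$\sum_{q=1}^\infty\psi(q)^{m+s}q^{d-s}=\infty,$$ we have $$\mathcal{H}^s(\mathcal{S}_n(\psi)\cap\mathcal{L})=\infty.$$ For the case $s=d$, the conclusion holds in the stronger sense that $\mathcal{S}_n(\psi)\cap\mathcal{L}$ has full $d$-dimensional Hausdorff measure in $\mathcal{L}$ (i.e. $\mathcal{H}^d(\mathcal{L}\setminus\mathcal{S}_n(\psi))=0$).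
   Context: Vectors are row vectors; $|\cdot|$ is the supremum norm; $\|\bm{y}\|$ is the sup-norm distance of $\bm{y}$ to the nearest integer vector (also for column vectors). "Decreasing" means non-increasing. $\mathcal{H}^s$ is $s$-dimensional Hausdorff measure. The diophantine exponent $\omega(A)$ of a real matrix $A$ with $m$ columns is the supremum of all $\omega\in\mathbb{R}$ such that $\|A\bm{q}^{\mathrm T}\|<|\bm{q}|^{-\omega}$ holds for infinitely many $\bm{q}\in\mathbb{Z}^m$. $\mathcal{S}_n(\psi)=\{\bm{y}\in\mathbb{R}^n:\|q\bm{y}\|<\psi(q)\text{ for infinitely many }q\in\mathbb{N}\}$. *)

theory Defs
  imports "HOL-Analysis.Analysis"
begin

definition integer_vectors :: "(real ^ 'n) set" where
  "integer_vectors = {z. \<forall>i. z $ i \<in> \<int>}"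

definition dist_nearest_int :: "real ^ 'n \<Rightarrow> real" where
  "dist_nearest_int y = (INF z\<in>integer_vectors. infnorm (y - z))"

text \<open>
  The supremum is taken in the extended reals, since the exponent of a matrix may be infinite.
  The vector \<open>q = 0\<close> never satisfies the inequality, because \<open>0 powr x = 0\<close>; a single vector
  is immaterial for the infinitude of the set of solutions.
\<close>

definition diophantine_exponent :: "real ^ 'm ^ 'k \<Rightarrow> ereal" where
  "diophantine_exponent A =
     Sup {ereal \<omega> | \<omega>. infinite {q \<in> integer_vectors.
                              dist_nearest_int (A *v q) < infnorm q powr (- \<omega>)}}"

text \<open>The type variable \<open>'n\<close> indexes the coordinates; the natural numbers start at 1 here.\<close>

definition psi_approximable :: "(nat \<Rightarrow> real) \<Rightarrow> (real ^ 'n) set" where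
  "psi_approximable \<psi> =
     {y. infinite {q :: nat. q \<ge> 1 \<and> dist_nearest_int (real q *\<^sub>R y) < \<psi> q}}"

text \<open>
  The index type \<open>'d option\<close> has one element more than \<open>'d\<close>: \<open>None\<close> is the position of the
  leading 1 of \<open>(1, x)\<close> (and of the first row of \<open>A\<close>).  The index type \<open>'d + 'm\<close> is used for
  the concatenation of two vectors.
\<close>

definition tilde :: "real ^ 'd \<Rightarrow> real ^ 'd option" where
  "tilde x = (\<chi> i. case i of None \<Rightarrow> 1 | Some j \<Rightarrow> x $ j)"

definition vec_append :: "real ^ 'd \<Rightarrow> real ^ 'm \<Rightarrow> real ^ ('d + 'm)" where
  "vec_append x y = (\<chi> i. case i of Inl j \<Rightarrow> x $ j | Inr k \<Rightarrow> y $ k)"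

definition affine_graph :: "real ^ 'm ^ ('d::finite) option \<Rightarrow> (real ^ ('d + 'm)) set" where
  "affine_graph A = range (\<lambda>x. vec_append x (tilde x v* A))"

text \<open>
  Hausdorff measure for \<open>s \<ge> 0\<close>, as an outer measure on arbitrary sets and without a
  normalising factor.  The first two cases below implement the convention that the empty set
  contributes 0 and that \<open>0\<^sup>0 = 1\<close> for nonempty sets, whereas \<open>0 powr 0 = 0\<close>.  Covering
  sets are required to be bounded because \<^const>\<open>diameter\<close> is unspecified otherwise.
\<close>

definition diam_pow :: "real \<Rightarrow> 'a::metric_space set \<Rightarrow> real" where
  "diam_pow s U = (if U = {} then 0 else if s = 0 then 1 else diameter U powr s)"

definition hausdorff_delta :: "real \<Rightarrow> real \<Rightarrow> 'a::metric_space set \<Rightarrow> ennreal" where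
  "hausdorff_delta s \<delta> X =
     (INF U \<in> {U :: nat \<Rightarrow> 'a set. X \<subseteq> (\<Union>i. U i) \<and> (\<forall>i. bounded (U i) \<and> diameter (U i) \<le> \<delta>)}.
        \<Sum>i. ennreal (diam_pow s (U i)))"

definition hausdorff_measure :: "real \<Rightarrow> 'a::metric_space set \<Rightarrow> ennreal" where
  "hausdorff_measure s X = (SUP \<delta>\<in>{0<..}. hausdorff_delta s \<delta> X)"

end

theory Submission
  imports Defs "HOL-Analysis.Analysis" "HOL-Library.Real_Mod"
begin

text \<open>
  Write points of the subspace as \<open>(x, (1, x) A)\<close>.  Such a point is approximable as soon as
  \<open>x\<close> is within \<open>r = c \<psi>(Q) / Q\<close> of infinitely many rational points \<open>p / q\<close>, \<open>q \<le> Q = 2^k\<close>,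
  for which \<open>(q, p) A\<close> is within \<open>\<delta> = \<psi>(Q) / 2\<close> of an integer vector.  By Dirichlet's principle
  every \<open>x\<close> has such a rational point at distance about \<open>\<rho>' / q\<close>, where
  \<open>Q \<rho>'^d \<delta>^m\<close> is a constant.  The large sieve bounds the number of integer points \<open>(q, p)\<close> in a
  box with \<open>(q, p) A\<close> nearly integral, because \<open>\<omega>(A)\<close> controls the spacing modulo 1 of the points
  \<open>A j\<close> with \<open>j\<close> in a box; so only few \<open>x\<close> need a \<open>q\<close> much smaller than \<open>Q\<close>.  Hence the rational
  points of level \<open>k\<close> contain, in every cube and for all large \<open>k\<close>, a positive proportion of a
  \<open>\<rho>\<close>-separated net, \<open>\<rho> = \<rho>' / Q\<close>.  The divergence condition says that the sum of
  \<open>r^s / \<rho>^d\<close> over \<open>k\<close> diverges; levels with \<open>\<psi>(Q) < Q^(-\<tau>)\<close>, \<open>\<tau>\<close> slightly below \<open>\<tau>\<^sub>0\<close>,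
  contribute a convergent sum and are discarded.

  For \<open>s < d\<close> one spreads mass, again and again, over the cubes of many levels, level \<open>k\<close> receiving
  a share proportional to \<open>r^s / \<rho>^d\<close>; the measures obtained satisfy a uniform Frostman condition,
  and compactness bounds from below every cover of the limsup set.  For \<open>s = d\<close> the second moment of
  the number of cubes containing a point shows that the limsup set fills a positive proportion
  of every cube, hence almost everything.
\<close>

section \<open>Counting lattice points: the large sieve\<close>

text \<open>The large sieve determines \<open>\<tau>\<^sub>0\<close>. For
  \<open>\<sigma> > max m \<omega>\<close> its error term adds a volume of order
  \<open>Q powr (-m / \<sigma>) / \<delta> ^ m\<close> to the exceptional \<open>x\<close> in a
  fixed cube; this tends to 0 if \<open>\<delta> \<ge> Q powr (-\<tau>)\<close> with
  \<open>\<tau> < 1 / \<sigma>\<close>, and \<open>\<sigma>\<close> can be taken as close to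
  \<open>1 / \<tau>\<^sub>0\<close> as desired. Since \<open>r\<close> is a multiple of
  \<open>\<delta> / Q\<close> and \<open>\<rho> ^ d = 1 / (Q ^ (d + 1) * \<delta> ^ m)\<close>, the
  weight \<open>r powr s / \<rho> ^ d\<close> is a multiple of
  \<open>\<delta> powr (m + s) * Q powr (d + 1 - s)\<close>: the given series in condensed form. It
  has order 1 at \<open>\<delta> = Q powr (-\<theta>)\<close>,
  \<open>\<theta> = (d + 1 - s) / (m + s)\<close>, and the lower bound on \<open>s\<close> says
  exactly that \<open>\<theta> < \<tau>\<^sub>0\<close>. Larger \<open>\<delta>\<close> could
  violate \<open>r \<le> \<rho>\<close>, so \<open>\<delta>\<close> is in fact truncated to half of
  \<open>min (\<psi> Q) (Q powr (-\<theta>))\<close>. The proportion of the net must be the same for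
  all cubes, whatever their size; constants depending on the size are therefore allowed only in
  terms that vanish for large \<open>Q\<close>.\<close>

lemma sum_cis_mod:
  fixes N :: nat and b :: int
  assumes "N > 0"
  shows "(\<Sum>v<N. cis (2 * pi * (of_int b * real v / real N))) = (if int N dvd b then of_nat N else 0)"
proof -
  define z where "z = cis (2 * pi * (of_int b / real N))"
  have pow: "cis (2 * pi * (of_int b * real v / real N)) = z ^ v" for v

  proof -
    have "z ^ v = cis (real v * (2 * pi * (of_int b / real N)))"
      unfolding z_def by (rule Complex.DeMoivre)
    also have "real v * (2 * pi * (of_int b / real N)) = 2 * pi * (of_int b * real v / real N)"
      by simp
    finally show ?thesis by simp
  qed
  show ?thesis
  proof (cases "int N dvd b")
    case True
    then obtain c where c: "b = int N * c" by (auto simp: dvd_def)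
    have "2 * pi * (of_int b / real N) = 2 * pi * of_int c"
      using assms by (simp add: c)
    then have "z = 1" unfolding z_def by (simp only: cis_multiple_2pi Ints_of_int)
    then show ?thesis unfolding pow using True by simp
  next
    case False
    have "z \<noteq> 1"
    proof
      assume "z = 1"
      then obtain k :: int where "2 * pi * (of_int b / real N) = of_int k * (2 * pi)"
        by (auto simp: z_def cis_eq_1_iff)
      then have "of_int b = of_int k * real N" using assms by (simp add: field_simps)
      then have "b = k * int N" by (metis of_int_eq_iff of_int_mult of_int_of_nat_eq)
      then show False using False by auto
    qed
    moreover have "z ^ N = 1"
    proof -
      have "z ^ N = cis (2 * pi * of_int b)" using assms by (simp add: z_def Complex.DeMoivre)
      then show ?thesis by (simp only: cis_multiple_2pi Ints_of_int)
    qed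
    ultimately show ?thesis unfolding pow using False by (simp add: geometric_sum)
  qed
qed

lemma cis_sum: "finite A \<Longrightarrow> cis (\<Sum>i\<in>A. f i) = (\<Prod>i\<in>A. cis (f i))"
  by (induction A rule: finite_induct) (auto simp flip: cis_mult)

lemma sum_cis_vec_mod:
  fixes N :: nat and b :: "'k::finite \<Rightarrow> int"
  assumes "N > 0"
  shows "(\<Sum>v\<in>(UNIV \<rightarrow>\<^sub>E {..<N}). cis (2 * pi * (\<Sum>i\<in>UNIV. of_int (b i) * real (v i)) / real N))
           = (if \<forall>i. int N dvd b i then of_nat N ^ CARD('k) else 0)"
proof -
  have "(\<Sum>v\<in>(UNIV \<rightarrow>\<^sub>E {..<N}). cis (2 * pi * (\<Sum>i\<in>UNIV. of_int (b i) * real (v i)) / real N))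
     = (\<Sum>v\<in>(UNIV \<rightarrow>\<^sub>E {..<N}). \<Prod>i\<in>UNIV. cis (2 * pi * (of_int (b i) * real (v i) / real N)))"
    by (subst cis_sum[symmetric]) (simp_all add: sum_distrib_left sum_divide_distrib)
  also have "\<dots> = (\<Prod>i\<in>UNIV. \<Sum>v<N. cis (2 * pi * (of_int (b i) * real v / real N)))"
    by (rule prod_sum_PiE[symmetric]) auto
  also have "\<dots> = (\<Prod>i\<in>UNIV. if int N dvd b i then of_nat N else 0)"
    by (intro prod.cong refl sum_cis_mod assms)
  also have "\<dots> = (if \<forall>i. int N dvd b i then of_nat N ^ CARD('k) else 0)"
    by auto
  finally show ?thesis .
qed

text \<open>Expanding the square leaves, by orthogonality of the characters modulo \<open>N\<close>,
  only the pairs that are congruent modulo \<open>N\<close>; \<open>dist\<close> makes these the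
  diagonal pairs.\<close>

lemma parseval_vec_mod:
  fixes N :: nat and S :: "('k::finite \<Rightarrow> int) set"
  assumes "N > 0" and "finite S"
    and dist: "\<And>a b. a \<in> S \<Longrightarrow> b \<in> S \<Longrightarrow> (\<forall>i. int N dvd a i - b i) \<Longrightarrow> a = b"
  shows "(\<Sum>v\<in>(UNIV \<rightarrow>\<^sub>E {..<N}).
            (cmod (\<Sum>a\<in>S. cis (2 * pi * (\<Sum>i\<in>UNIV. of_int (a i) * real (v i)) / real N)))\<^sup>2)
           = real N ^ CARD('k) * real (card S)"
proof -
  let ?V = "UNIV \<rightarrow>\<^sub>E {..<N} :: ('k \<Rightarrow> nat) set"
  let ?e = "\<lambda>a v. cis (2 * pi * (\<Sum>i\<in>UNIV. of_int (a i) * real (v i)) / real N)"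
  have "complex_of_real (\<Sum>v\<in>?V. (cmod (\<Sum>a\<in>S. ?e a v))\<^sup>2)
     = (\<Sum>v\<in>?V. (\<Sum>a\<in>S. ?e a v) * cnj (\<Sum>a\<in>S. ?e a v))"
    by (simp only: of_real_sum complex_norm_square)
  also have "\<dots> = (\<Sum>v\<in>?V. \<Sum>a\<in>S. \<Sum>b\<in>S. ?e (\<lambda>i. a i - b i) v)"
    by (simp add: sum_product cis_cnj cis_mult left_diff_distrib sum_subtractf right_diff_distrib
        diff_divide_distrib)
  also have "\<dots> = (\<Sum>a\<in>S. \<Sum>b\<in>S. \<Sum>v\<in>?V. ?e (\<lambda>i. a i - b i) v)"
    by (subst sum.swap) (intro sum.cong refl sum.swap)
  also have "\<dots> = (\<Sum>a\<in>S. \<Sum>b\<in>S. if a = b then of_nat N ^ CARD('k) else 0)"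
    by (intro sum.cong refl, subst sum_cis_vec_mod[OF assms(1)]) (use dist in auto)
  also have "\<dots> = complex_of_real (real N ^ CARD('k) * real (card S))"
    using assms(2) by simp
  finally show ?thesis by (simp only: of_real_eq_iff)
qed

lemma cos_ge_half:
  assumes "\<bar>t - of_int z\<bar> \<le> 1 / 6"
  shows "cos (2 * pi * t) \<ge> 1 / 2"
proof -
  define u where "u = t - of_int z"
  have "cos (2 * pi * t) = cos (2 * pi * u + 2 * pi * of_int z)"
    by (simp add: u_def algebra_simps)
  also have "\<dots> = cos (2 * pi * u)"
    by (simp add: cos_add)
  also have "\<dots> = cos \<bar>2 * pi * u\<bar>" by simp
  also have "\<dots> \<ge> cos (pi / 3)"
  proof (rule cos_monotone_0_pi_le)
    have "pi * (6 * \<bar>u\<bar>) \<le> pi * 1"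
      using assms by (intro mult_left_mono) (auto simp: u_def)
    then show "\<bar>2 * pi * u\<bar> \<le> pi / 3" by (simp add: abs_mult)
  qed auto
  finally show ?thesis by (simp add: cos_60)
qed

text \<open>The large sieve in dual form: the trigonometric polynomial with frequencies in \<open>S\<close> is
  large at the (well-spaced) points \<open>\<alpha> j\<close>, rounded to the grid of mesh \<open>1 / N\<close>.\<close>

lemma large_sieve:
  fixes \<alpha> :: "'k::finite \<Rightarrow> 'm::finite \<Rightarrow> real" and S :: "('k \<Rightarrow> int) set"
    and N J :: nat and \<theta> :: real
  assumes "N > 0" and "finite S"
    and small: "\<And>a. a \<in> S \<Longrightarrow> 16 * (\<Sum>i\<in>UNIV. \<bar>a i\<bar>) \<le> int N"
    and near: "\<And>a l. a \<in> S \<Longrightarrow> \<exists>z::int. \<bar>(\<Sum>i\<in>UNIV. of_int (a i) * \<alpha> i l) - of_int z\<bar> \<le> \<theta>"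
    and theta: "real CARD('m) * real J * \<theta> \<le> 1 / 16"
    and sep: "\<And>j :: 'm \<Rightarrow> int. j \<noteq> (\<lambda>_. 0) \<Longrightarrow> (\<And>l. \<bar>j l\<bar> < int J) \<Longrightarrow>
       \<exists>i. \<forall>z::int. \<bar>(\<Sum>l\<in>UNIV. \<alpha> i l * of_int (j l)) - of_int z\<bar> \<ge> 1 / real N"
  shows "real (card S) * real J ^ CARD('m) \<le> 4 * real N ^ CARD('k)"
proof (cases "S = {}")
  case False
  let ?V = "UNIV \<rightarrow>\<^sub>E {..<N} :: ('k \<Rightarrow> nat) set"
  let ?J = "UNIV \<rightarrow>\<^sub>E {..<J} :: ('m \<Rightarrow> nat) set"
  let ?D = "\<lambda>v. (\<Sum>a\<in>S. cis (2 * pi * (\<Sum>i\<in>UNIV. of_int (a i) * real (v i)) / real N))"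
  have bnd: "16 * \<bar>a i\<bar> \<le> int N" if "a \<in> S" for a i
    using small[OF that] member_le_sum[of i UNIV "\<lambda>i. \<bar>a i\<bar>"] by auto
  have parseval: "(\<Sum>v\<in>?V. (cmod (?D v))\<^sup>2) = real N ^ CARD('k) * real (card S)"
  proof (rule parseval_vec_mod[OF assms(1,2)])
    fix a b assume ab: "a \<in> S" "b \<in> S" "\<forall>i. int N dvd a i - b i"
    have "a i - b i = 0" for i
    proof (rule ccontr)
      assume "a i - b i \<noteq> 0"
      then have "int N \<le> \<bar>a i - b i\<bar>"
        using ab(3) dvd_imp_le_int[of "a i - b i" "int N"] by simp
      then show False using bnd[OF ab(1), of i] bnd[OF ab(2), of i] \<open>N > 0\<close> by linarith
    qed
    then show "a = b" by (auto simp: fun_eq_iff)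
  qed
  \<comment> \<open>\<open>x j\<close> is the vector \<open>A j\<close>; \<open>w j\<close>, divided
    by \<open>N\<close>, is its rounding down to the grid, taken modulo 1.\<close>
  define x where "x = (\<lambda>(j :: 'm \<Rightarrow> nat) i. \<Sum>l\<in>UNIV. \<alpha> i l * real (j l))"
  define w where "w = (\<lambda>j i. nat (\<lfloor>real N * x j i\<rfloor> mod int N))"
  have w_in: "w j \<in> ?V" for j
    using \<open>N > 0\<close> by (auto simp: w_def nat_less_iff)
  have w_eq: "\<exists>z::int. real (w j i) = real N * x j i - frac (real N * x j i) - real N * of_int z" for j i
  proof -
    have "real (w j i) = of_int (\<lfloor>real N * x j i\<rfloor> mod int N)"
      using \<open>N > 0\<close> by (simp add: w_def)
    also have "\<dots> = of_int \<lfloor>real N * x j i\<rfloor> - real N * of_int (\<lfloor>real N * x j i\<rfloor> div int N)"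
      by (simp add: minus_mult_div_eq_mod[symmetric])
    finally show ?thesis by (auto simp: frac_def)
  qed
  \<comment> \<open>Equal grid points would put every coordinate of \<open>A (j - j')\<close> at
    distance less than \<open>1 / N\<close> from an integer, against \<open>sep\<close>.\<close>
  have inj: "inj_on w ?J"
  proof
    fix j j' assume j: "j \<in> ?J" "j' \<in> ?J" and eq: "w j = w j'"
    show "j = j'"
    proof (rule ccontr)
      assume "j \<noteq> j'"
      define h where "h = (\<lambda>l. int (j l) - int (j' l))"
      have "h \<noteq> (\<lambda>_. 0)" using \<open>j \<noteq> j'\<close> by (auto simp: h_def fun_eq_iff)
      moreover have "\<bar>h l\<bar> < int J" for l
      proof -
        have "j l < J" "j' l < J" using j by auto
        then show ?thesis by (auto simp: h_def)
      qed
      ultimately obtain i where i: "\<And>z::int. \<bar>(\<Sum>l\<in>UNIV. \<alpha> i l * of_int (h l)) - of_int z\<bar> \<ge> 1 / real N"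
        using sep by blast
      obtain z z' :: int where
        z: "real (w j i) = real N * x j i - frac (real N * x j i) - real N * of_int z"
           "real (w j' i) = real N * x j' i - frac (real N * x j' i) - real N * of_int z'"
        using w_eq by meson
      have *: "(\<Sum>l\<in>UNIV. \<alpha> i l * of_int (h l)) = x j i - x j' i"
        by (simp add: h_def x_def right_diff_distrib sum_subtractf)
      have "real N * (x j i - x j' i - of_int (z - z')) = frac (real N * x j i) - frac (real N * x j' i)"
        using z eq by (simp add: algebra_simps)
      also have "\<bar>\<dots>\<bar> < 1"
        using frac_lt_1[of "real N * x j i"] frac_lt_1[of "real N * x j' i"]
          frac_ge_0[of "real N * x j i"] frac_ge_0[of "real N * x j' i"] by linarith
      finally have "real N * \<bar>x j i - x j' i - of_int (z - z')\<bar> < 1"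
        by (simp only: abs_mult abs_of_nat)
      then have "\<bar>x j i - x j' i - of_int (z - z')\<bar> < 1 / real N"
        using \<open>N > 0\<close> by (simp only: mult.commute pos_less_divide_eq of_nat_0_less_iff)
      then show False using i[of "z - z'"] * by simp
    qed
  qed
  have large: "cmod (?D (w j)) \<ge> real (card S) / 2" if j: "j \<in> ?J" for j
  proof -
    have "1 / 2 \<le> Re (cis (2 * pi * (\<Sum>i\<in>UNIV. of_int (a i) * real (w j i)) / real N))" if a: "a \<in> S" for a
    proof -
      obtain z where z: "\<And>i. real (w j i) = real N * x j i - frac (real N * x j i) - real N * of_int (z i)"
        using w_eq[of j] by metis
      obtain y where y: "\<And>l. \<bar>(\<Sum>i\<in>UNIV. of_int (a i) * \<alpha> i l) - of_int (y l)\<bar> \<le> \<theta>"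
        using near[OF a] by metis
      \<comment> \<open>Up to an integer the phase \<open>?t\<close> equals \<open>e2 - e1\<close>.
        The error \<open>e1\<close> comes from rounding \<open>x j\<close> to the grid;
        \<open>e2\<close> comes from the distance of \<open>a A\<close> to the integers, after
        pairing \<open>a\<close> with \<open>A j\<close> is rewritten as pairing \<open>a A\<close>
        with \<open>j\<close>.\<close>
      let ?t = "(\<Sum>i\<in>UNIV. of_int (a i) * real (w j i)) / real N"
      define e1 where "e1 = (\<Sum>i\<in>UNIV. of_int (a i) * frac (real N * x j i)) / real N"
      define e2 where "e2 = (\<Sum>l\<in>UNIV. real (j l) * ((\<Sum>i\<in>UNIV. of_int (a i) * \<alpha> i l) - of_int (y l)))"
      have "?t = (\<Sum>i\<in>UNIV. of_int (a i) * x j i) - e1 - of_int (\<Sum>i\<in>UNIV. a i * z i)"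
      proof -
        have "of_int (a i) * real (w j i) / real N
            = of_int (a i) * x j i - of_int (a i) * frac (real N * x j i) / real N - of_int (a i * z i)" for i
          using \<open>N > 0\<close> by (simp add: z field_simps)
        then show ?thesis
          by (simp add: e1_def sum_divide_distrib sum_subtractf)
      qed
      moreover have "(\<Sum>i\<in>UNIV. of_int (a i) * x j i) = e2 + of_int (\<Sum>l\<in>UNIV. int (j l) * y l)"
      proof -
        have "(\<Sum>i\<in>UNIV. of_int (a i) * x j i) = (\<Sum>l\<in>UNIV. real (j l) * (\<Sum>i\<in>UNIV. of_int (a i) * \<alpha> i l))"
          unfolding x_def sum_distrib_left by (subst sum.swap) (simp add: mult_ac)
        then show ?thesis by (simp add: e2_def right_diff_distrib sum_subtractf)
      qed
      moreover have "\<bar>e1\<bar> \<le> 1 / 16"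
      proof -
        have "\<bar>\<Sum>i\<in>UNIV. of_int (a i) * frac (real N * x j i)\<bar> \<le> (\<Sum>i\<in>UNIV. \<bar>of_int (a i)\<bar>)"
          using frac_ge_0 less_imp_le[OF frac_lt_1]
          by (intro order.trans[OF sum_abs] sum_mono) (auto simp: abs_mult intro!: mult_left_le)
        also have "\<dots> = real_of_int (\<Sum>i\<in>UNIV. \<bar>a i\<bar>)" by simp
        also have "\<dots> \<le> real N / 16" using small[OF a] by linarith
        finally show ?thesis using \<open>N > 0\<close> by (simp add: e1_def field_simps)
      qed
      moreover have "\<bar>e2\<bar> \<le> 1 / 16"
      proof -
        have "\<bar>e2\<bar> \<le> (\<Sum>l\<in>(UNIV::'m set). real J * \<theta>)"
          unfolding e2_def
        proof (intro order.trans[OF sum_abs] sum_mono)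
          fix l show "\<bar>real (j l) * ((\<Sum>i\<in>UNIV. of_int (a i) * \<alpha> i l) - of_int (y l))\<bar> \<le> real J * \<theta>"
            unfolding abs_mult using j y[of l] by (intro mult_mono) (auto simp: PiE_iff less_imp_le)
        qed
        then show ?thesis using theta by (simp add: mult_ac)
      qed
      moreover have "\<bar>e2 - e1\<bar> \<le> \<bar>e2\<bar> + \<bar>e1\<bar>" by simp
      ultimately have "\<bar>?t - of_int ((\<Sum>l\<in>UNIV. int (j l) * y l) - (\<Sum>i\<in>UNIV. a i * z i))\<bar> \<le> 1 / 6"
        by simp
      from cos_ge_half[OF this] show ?thesis by simp
    qed
    then have "(\<Sum>a\<in>S. 1 / 2) \<le> Re (?D (w j))"
      unfolding Re_sum by (rule sum_mono)
    then show ?thesis using complex_Re_le_cmod[of "?D (w j)"] by simp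
  qed
  \<comment> \<open>Restricting the sum over the grid to the distinct points \<open>w j\<close> and
    comparing with Parseval's identity cancels one factor \<open>card S\<close>.\<close>
  have "real J ^ CARD('m) * (real (card S) / 2)\<^sup>2 = (\<Sum>j\<in>?J. (real (card S) / 2)\<^sup>2)"
    by (simp add: card_PiE)
  also have "\<dots> \<le> (\<Sum>j\<in>?J. (cmod (?D (w j)))\<^sup>2)"
    using large by (intro sum_mono power_mono) auto
  also have "\<dots> = (\<Sum>v\<in>w ` ?J. (cmod (?D v))\<^sup>2)"
    using inj by (simp add: sum.reindex)
  also have "\<dots> \<le> (\<Sum>v\<in>?V. (cmod (?D v))\<^sup>2)"
    using w_in by (intro sum_mono2) (auto simp: finite_PiE)
  also have "\<dots> = real N ^ CARD('k) * real (card S)" by (rule parseval)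
  finally have "real (card S) * (real (card S) * real J ^ CARD('m)) \<le> real (card S) * (4 * real N ^ CARD('k))"
    by (simp add: power2_eq_square field_simps)
  then show ?thesis using False \<open>finite S\<close> by (simp add: card_gt_0_iff)
qed auto

text \<open>The first term of the bound is the expected number of solutions in a box of side
  \<open>h\<close>, the second is the price of the spacing exponent \<open>\<sigma>\<close>.
  Translating \<open>S\<close> by one of its elements, which doubles \<open>\<delta>\<close>, allows
  boxes far from the origin; then the large sieve is applied with \<open>N\<close> of order
  \<open>h\<close> and with \<open>J\<close> as large as its hypotheses permit.\<close>

lemma count_near_integral:
  fixes \<alpha> :: "'k::finite \<Rightarrow> 'm::finite \<Rightarrow> real" and \<sigma> c0 :: real
  assumes "\<sigma> > 0" "c0 > 0"
    and sep: "\<And>(j :: 'm \<Rightarrow> int) M. j \<noteq> (\<lambda>_. 0) \<Longrightarrow> (\<And>l. \<bar>j l\<bar> \<le> int M) \<Longrightarrow>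
       \<exists>i. \<forall>z::int. \<bar>(\<Sum>l\<in>UNIV. \<alpha> i l * of_int (j l)) - of_int z\<bar> \<ge> c0 * real M powr (-\<sigma>)"
  shows "\<exists>C>0. \<forall>h\<ge>1. \<forall>\<delta>>0. \<forall>S. finite S \<longrightarrow>
     (\<forall>a\<in>S. \<forall>b\<in>S. \<forall>i. \<bar>real_of_int (a i - b i)\<bar> \<le> h) \<longrightarrow>
     (\<forall>a\<in>S. \<forall>l. \<exists>z::int. \<bar>(\<Sum>i\<in>UNIV. of_int (a i) * \<alpha> i l) - of_int z\<bar> < \<delta>) \<longrightarrow>
     real (card S) \<le> C * (h ^ CARD('k) * \<delta> ^ CARD('m) + h powr (real CARD('k) - real CARD('m) / \<sigma>))"
proof -
  define K m where "K = CARD('k)" and "m = CARD('m)"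
  have "K \<ge> 1" "m \<ge> 1" by (simp_all add: K_def m_def Suc_leI)
  define C1 where "C1 = 4 * (17 * real K) ^ K * 2 ^ m * ((32 * real m) ^ m + c0 powr (- real m / \<sigma>))"
  define C2 where "C2 = (3::real) ^ K * (32 * real m) ^ m"
  have C: "C1 > 0" "C2 > 0"
    using \<open>K \<ge> 1\<close> \<open>m \<ge> 1\<close> \<open>c0 > 0\<close> by (auto simp: C1_def C2_def intro!: mult_pos_pos add_pos_pos)
  have main: "real (card S) \<le> (C1 + C2) * (h ^ K * \<delta> ^ m + h powr (real K - real m / \<sigma>))"
    if h: "h \<ge> 1" and \<delta>: "\<delta> > 0" and "finite S"
      and diff: "\<And>a b i. a \<in> S \<Longrightarrow> b \<in> S \<Longrightarrow> \<bar>real_of_int (a i - b i)\<bar> \<le> h"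
      and near: "\<And>a l. a \<in> S \<Longrightarrow> \<exists>z::int. \<bar>(\<Sum>i\<in>UNIV. of_int (a i) * \<alpha> i l) - of_int z\<bar> < \<delta>"
    for h \<delta> and S :: "('k \<Rightarrow> int) set"
  proof (cases "S = {}")
    case True
    then show ?thesis using C h \<delta> by simp
  next
    case False
    then obtain a0 where a0: "a0 \<in> S" by auto
    define S' where "S' = (\<lambda>a i. a i - a0 i) ` S"
    have card': "card S' = card S"
      unfolding S'_def by (rule card_image) (auto simp: inj_on_def fun_eq_iff)
    have fin': "finite S'" using \<open>finite S\<close> by (simp add: S'_def)
    have diff': "\<bar>real_of_int (a i)\<bar> \<le> h" if "a \<in> S'" for a i
      using that diff[OF _ a0] by (auto simp: S'_def)
    have powr_eq: "h ^ K * h powr (- real m / \<sigma>) = h powr (real K - real m / \<sigma>)"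
      using h by (simp add: powr_realpow[symmetric] powr_add[symmetric])
    show ?thesis
    proof (cases "32 * real m * \<delta> \<ge> 1")
      case True
      \<comment> \<open>For such large \<open>\<delta>\<close> the trivial count of all integer
        points of the box is good enough.\<close>
      have "S' \<subseteq> (UNIV \<rightarrow>\<^sub>E {-\<lfloor>h\<rfloor>..\<lfloor>h\<rfloor>})"
      proof
        fix a assume a: "a \<in> S'"
        have "-\<lfloor>h\<rfloor> \<le> a i \<and> a i \<le> \<lfloor>h\<rfloor>" for i
          using diff'[OF a, of i] by linarith
        then show "a \<in> (UNIV \<rightarrow>\<^sub>E {-\<lfloor>h\<rfloor>..\<lfloor>h\<rfloor>})" by auto
      qed
      then have "card S' \<le> card (UNIV \<rightarrow>\<^sub>E {-\<lfloor>h\<rfloor>..\<lfloor>h\<rfloor>} :: ('k \<Rightarrow> int) set)"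
        by (intro card_mono finite_PiE) auto
      also have "\<dots> = nat (2 * \<lfloor>h\<rfloor> + 1) ^ K"
        by (simp add: card_PiE K_def)
      finally have "real (card S') \<le> real (nat (2 * \<lfloor>h\<rfloor> + 1)) ^ K"
        by (metis of_nat_le_iff of_nat_power)
      also have "\<dots> \<le> (3 * h) ^ K"
        using h by (intro power_mono) linarith+
      also have "\<dots> \<le> (3 * h) ^ K * (32 * real m * \<delta>) ^ m"
        using mult_left_mono[OF one_le_power[OF True, of m], of "(3 * h) ^ K"] h by simp
      also have "\<dots> = C2 * (h ^ K * \<delta> ^ m)"
        by (simp add: C2_def power_mult_distrib)
      also have "\<dots> \<le> (C1 + C2) * (h ^ K * \<delta> ^ m + h powr (real K - real m / \<sigma>))"
        using C h \<delta> by (intro mult_mono) auto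
      finally show ?thesis by (simp add: card')
    next
      case False
      \<comment> \<open>The factor \<open>16 * K\<close> is what the condition \<open>small\<close>
        of the large sieve asks for.\<close>
      define N where "N = nat \<lceil>16 * real K * h\<rceil>"
      have Kh: "real K * h \<ge> 1" using h \<open>K \<ge> 1\<close>
        by (metis mult_mono mult_1 of_nat_1 of_nat_le_iff of_nat_0_le_iff zero_le_one)
      have N: "16 * real K * h \<le> real N" "real N \<le> 17 * real K * h"
        using Kh unfolding N_def by linarith+
      have "real N \<ge> h"
      proof -
        have "1 * h \<le> real K * h" using h \<open>K \<ge> 1\<close> by (intro mult_right_mono) auto
        then show ?thesis using N(1) Kh by linarith
      qed
      then have "N > 0" using h by linarith
      \<comment> \<open>The two upper bounds for \<open>J\<close>: \<open>X\<close> comes from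
        \<open>theta\<close> with \<open>2 * \<delta>\<close> in place of \<open>\<theta>\<close>,
        and \<open>Y\<close> from the requirement
        \<open>c0 * J powr (-\<sigma>) \<ge> 1 / N\<close>. They produce the two terms of the final
        bound.\<close>
      define X Y where "X = 1 / (32 * real m * \<delta>)" and "Y = (c0 * real N) powr (1 / \<sigma>)"
      have "X > 1" using False \<delta> \<open>m \<ge> 1\<close> by (simp add: X_def field_simps)
      have "Y > 0" using \<open>N > 0\<close> \<open>c0 > 0\<close> by (simp add: Y_def)
      define J where "J = nat \<lfloor>max 1 (min X Y)\<rfloor>"
      have J: "J \<ge> 1" "real J \<le> X" "J > 1 \<Longrightarrow> real J \<le> Y" "real J \<ge> min X Y / 2"
      proof -
        define M where "M = max 1 (min X Y)"
        have M: "M \<ge> 1" "M \<ge> min X Y" "M \<le> X" "M > 1 \<Longrightarrow> M \<le> Y"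
          using \<open>X > 1\<close> by (auto simp: M_def)
        have J: "J \<ge> 1" "real J \<le> M" "real J > M - 1"
          using M(1) unfolding J_def M_def[symmetric] by linarith+
        have "real J \<ge> 1" using J(1) by simp
        then have "real J \<ge> M / 2" using J(3) by (cases "M \<le> 2") linarith+
        then show "J \<ge> 1" "real J \<le> X" "real J \<ge> min X Y / 2" using J M by linarith+
        show "real J \<le> Y" if "J > 1"
        proof -
          have "M > 1" using that J(2) by linarith
          then show ?thesis using M(4) J(2) by linarith
        qed
      qed
      have "real (card S') * real J ^ CARD('m) \<le> 4 * real N ^ CARD('k)"
      proof (rule large_sieve[where \<alpha> = \<alpha> and \<theta> = "2 * \<delta>"])
        show "N > 0" "finite S'" by fact+
        show "16 * (\<Sum>i\<in>UNIV. \<bar>a i\<bar>) \<le> int N" if "a \<in> S'" for a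
        proof -
          have "real_of_int (\<Sum>i\<in>UNIV. \<bar>a i\<bar>) \<le> (\<Sum>i\<in>(UNIV :: 'k set). h)"
            using diff'[OF that] unfolding of_int_sum by (intro sum_mono) auto
          then have "real_of_int (16 * (\<Sum>i\<in>UNIV. \<bar>a i\<bar>)) \<le> real N"
            using N by (simp add: K_def)
          then show ?thesis by linarith
        qed
        show "\<exists>z::int. \<bar>(\<Sum>i\<in>UNIV. of_int (a i) * \<alpha> i l) - of_int z\<bar> \<le> 2 * \<delta>" if a: "a \<in> S'" for a l
        proof -
          obtain b where b: "b \<in> S" "a = (\<lambda>i. b i - a0 i)" using a unfolding S'_def by blast
          obtain z z' :: int where "\<bar>(\<Sum>i\<in>UNIV. of_int (b i) * \<alpha> i l) - of_int z\<bar> < \<delta>"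
            "\<bar>(\<Sum>i\<in>UNIV. of_int (a0 i) * \<alpha> i l) - of_int z'\<bar> < \<delta>"
            using near[OF b(1)] near[OF a0] by meson
          then have "\<bar>(\<Sum>i\<in>UNIV. of_int (a i) * \<alpha> i l) - of_int (z - z')\<bar> \<le> 2 * \<delta>"
            by (simp add: b(2) left_diff_distrib sum_subtractf)
          then show ?thesis by blast
        qed
        have "real m * real J * (2 * \<delta>) \<le> real m * X * (2 * \<delta>)"
          using J(2) \<delta> by (intro mult_mono) auto
        also have "\<dots> \<le> 1 / 16" using \<delta> \<open>m \<ge> 1\<close> by (simp add: X_def field_simps)
        finally show "real CARD('m) * real J * (2 * \<delta>) \<le> 1 / 16" by (simp add: m_def)
        show "\<exists>i. \<forall>z::int. \<bar>(\<Sum>l\<in>UNIV. \<alpha> i l * of_int (j l)) - of_int z\<bar> \<ge> 1 / real N"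
          if j: "j \<noteq> (\<lambda>_. 0)" "\<And>l. \<bar>j l\<bar> < int J" for j
        proof -
          \<comment> \<open>For \<open>J = 1\<close> the spacing condition is void; this is why
            \<open>J \<le> Y\<close> was secured only for \<open>J > 1\<close>.\<close>
          have "J > 1"
          proof (rule ccontr)
            assume "\<not> J > 1"
            then have "\<bar>j l\<bar> < 1" for l using j(2)[of l] by linarith
            then show False using j(1) by (auto simp: fun_eq_iff)
          qed
          then have "real J powr \<sigma> \<le> Y powr \<sigma>" using J(3) \<open>\<sigma> > 0\<close> by (intro powr_mono2) auto
          also have "Y powr \<sigma> = c0 * real N"
            using \<open>\<sigma> > 0\<close> \<open>c0 > 0\<close> by (simp add: Y_def powr_powr)
          finally have "1 / real N \<le> c0 * real J powr (-\<sigma>)"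
            using \<open>J > 1\<close> \<open>N > 0\<close> by (simp add: powr_minus field_simps)
          moreover have "\<exists>i. \<forall>z::int. \<bar>(\<Sum>l\<in>UNIV. \<alpha> i l * of_int (j l)) - of_int z\<bar> \<ge> c0 * real J powr (-\<sigma>)"
            by (rule sep[OF j(1)]) (use j(2) less_imp_le in auto)
          ultimately show ?thesis by (meson order.trans)
        qed
      qed
      then have "real (card S) * real J ^ m \<le> 4 * real N ^ K"
        by (simp add: card' K_def m_def)
      then have "real (card S) \<le> 4 * real N ^ K * (1 / real J ^ m)"
        using J(1) by (simp add: field_simps)
      also have "\<dots> \<le> 4 * (17 * real K * h) ^ K * (2 ^ m * ((32 * real m * \<delta>) ^ m + (c0 powr (- real m / \<sigma>) * h powr (- real m / \<sigma>))))"
      proof (intro mult_mono power_mono N)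
        have "1 / real J ^ m \<le> 1 / (min X Y / 2) ^ m"
          using J(1,4) \<open>X > 1\<close> \<open>Y > 0\<close> by (intro divide_left_mono power_mono mult_pos_pos zero_less_power) auto
        also have "\<dots> = 2 ^ m * (1 / min X Y) ^ m"
          by (simp add: power_divide)
        also have "(1 / min X Y) ^ m \<le> (1 / X) ^ m + (1 / Y) ^ m"
          using \<open>X > 1\<close> \<open>Y > 0\<close> by (auto simp: min_def)
        also have "(1 / X) ^ m = (32 * real m * \<delta>) ^ m"
          by (simp add: X_def)
        also have "(1 / Y) ^ m = Y powr (- real m)"
          using \<open>Y > 0\<close> by (simp add: power_divide powr_minus powr_realpow inverse_eq_divide)
        also have "\<dots> = (c0 * real N) powr (- real m / \<sigma>)"
          unfolding Y_def powr_powr by simp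
        also have "\<dots> = c0 powr (- real m / \<sigma>) * real N powr (- real m / \<sigma>)"
          using \<open>c0 > 0\<close> by (simp add: powr_mult)
        also have "\<dots> \<le> c0 powr (- real m / \<sigma>) * h powr (- real m / \<sigma>)"
          using \<open>real N \<ge> h\<close> h \<open>\<sigma> > 0\<close> by (intro mult_left_mono powr_mono2') auto
        finally show "1 / real J ^ m \<le> 2 ^ m * ((32 * real m * \<delta>) ^ m + c0 powr (- real m / \<sigma>) * h powr (- real m / \<sigma>))"
          by simp
      qed (use h in auto)
      also have "\<dots> = 4 * (17 * real K) ^ K * 2 ^ m * ((32 * real m) ^ m * (h ^ K * \<delta> ^ m) + c0 powr (- real m / \<sigma>) * (h ^ K * h powr (- real m / \<sigma>)))"
        by (simp add: power_mult_distrib algebra_simps)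
      also have "\<dots> \<le> 4 * (17 * real K) ^ K * 2 ^ m * (((32 * real m) ^ m + c0 powr (- real m / \<sigma>)) * (h ^ K * \<delta> ^ m + h powr (real K - real m / \<sigma>)))"
        unfolding powr_eq using h \<delta> by (intro mult_left_mono) (auto simp: algebra_simps)
      also have "\<dots> = C1 * (h ^ K * \<delta> ^ m + h powr (real K - real m / \<sigma>))"
        by (simp add: C1_def mult_ac)
      also have "\<dots> \<le> (C1 + C2) * (h ^ K * \<delta> ^ m + h powr (real K - real m / \<sigma>))"
        using C h \<delta> by (intro mult_right_mono) auto
      finally show ?thesis .
    qed
  qed
  show ?thesis
    using C main unfolding K_def m_def by (intro exI[of _ "C1 + C2"]) auto
qed

text \<open>The pigeonhole principle in place of Minkowski's convex body theorem for the forms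
  \<open>q\<close>, \<open>q x - p\<close> and \<open>q \<beta> + p \<gamma> - z\<close>, whose
  determinant is 1 up to sign. Pairs \<open>(q, p)\<close> are distributed over boxes of sides
  \<open>\<rho>\<close> and \<open>\<delta>\<close>, and two pairs from one box are
  subtracted.\<close>

lemma dirichlet_linear_forms:
  fixes x :: "'d::finite \<Rightarrow> real" and \<beta> :: "'m::finite \<Rightarrow> real" and \<gamma> :: "'d \<Rightarrow> 'm \<Rightarrow> real"
    and Q :: nat and \<rho> \<delta> :: real
  assumes \<rho>: "0 < \<rho>" "\<rho> \<le> 1" and \<delta>: "0 < \<delta>" "\<delta> \<le> 1"
    and vol: "7 ^ CARD('d) * 2 ^ CARD('m) < real Q * \<rho> ^ CARD('d) * \<delta> ^ CARD('m)"
  shows "\<exists>(q::nat) (p :: 'd \<Rightarrow> int). 1 \<le> q \<and> q \<le> Q \<and> (\<forall>i. \<bar>real q * x i - of_int (p i)\<bar> < \<rho>) \<and>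
     (\<forall>l. \<exists>z::int. \<bar>real q * \<beta> l + (\<Sum>i\<in>UNIV. of_int (p i) * \<gamma> i l) - of_int z\<bar> < \<delta>)"
proof -
  \<comment> \<open>With numerators below \<open>H\<close> the values \<open>q x - p\<close> stay
    within \<open>2 * H\<close>, so they meet a number of boxes of order
    \<open>(H / \<rho>) ^ d\<close>, and \<open>H ^ d\<close> cancels against the number of choices
    of \<open>p\<close>.\<close>
  define H where "H = nat \<lceil>real Q * (\<Sum>i\<in>UNIV. \<bar>x i\<bar>)\<rceil> + 1"
  have H1: "H \<ge> 1" by (simp add: H_def)
  have H: "real q * \<bar>x i\<bar> \<le> real H" if "q \<le> Q" for q i
  proof -
    have "real q * \<bar>x i\<bar> \<le> real Q * (\<Sum>i\<in>UNIV. \<bar>x i\<bar>)"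
      using that by (intro mult_mono member_le_sum) auto
    also have "\<dots> \<le> real H" unfolding H_def by linarith
    finally show ?thesis .
  qed
  define D where "D = {..<Q} \<times> (UNIV \<rightarrow>\<^sub>E {..<H} :: ('d \<Rightarrow> nat) set)"
  define L where "L = (\<lambda>(q::nat) (p :: 'd \<Rightarrow> nat) l. real q * \<beta> l + (\<Sum>i\<in>UNIV. real (p i) * \<gamma> i l))"
  define \<Phi> where "\<Phi> = (\<lambda>(q, p). (\<lambda>i. \<lfloor>(real q * x i - real (p i)) / \<rho>\<rfloor>, \<lambda>l. \<lfloor>frac (L q p l) / \<delta>\<rfloor>))"
  define B where "B = \<lceil>2 * real H / \<rho>\<rceil>"
  define E where "E = (UNIV \<rightarrow>\<^sub>E {-B..B} :: ('d \<Rightarrow> int) set) \<times> (UNIV \<rightarrow>\<^sub>E {0..\<lfloor>1 / \<delta>\<rfloor>} :: ('m \<Rightarrow> int) set)"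
  have H\<rho>: "real H / \<rho> \<ge> 1" using H1 \<rho> by simp
  have B0: "B \<ge> 0" unfolding B_def using H\<rho> by linarith
  have cardE: "real (card E) \<le> (7 * (real H / \<rho>)) ^ CARD('d) * (2 / \<delta>) ^ CARD('m)"
  proof -
    have "real (card E) = real (nat (2 * B + 1)) ^ CARD('d) * real (nat (\<lfloor>1 / \<delta>\<rfloor> + 1)) ^ CARD('m)"
      by (simp add: E_def card_cartesian_product card_PiE)
    also have "\<dots> \<le> (7 * (real H / \<rho>)) ^ CARD('d) * (2 / \<delta>) ^ CARD('m)"
    proof (intro mult_mono power_mono)
      show "real (nat (2 * B + 1)) \<le> 7 * (real H / \<rho>)"
        unfolding B_def using H\<rho> by linarith
      have "1 / \<delta> \<ge> 1" using \<delta> by simp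
      then show "real (nat (\<lfloor>1 / \<delta>\<rfloor> + 1)) \<le> 2 / \<delta>" by linarith
    qed (use \<rho> \<delta> in auto)
    finally show ?thesis .
  qed
  have cardD: "real (card D) = real Q * real H ^ CARD('d)"
    by (simp add: D_def card_cartesian_product card_PiE)
  have "real (card E) < real (card D)"
  proof -
    have "(7 * (real H / \<rho>)) ^ CARD('d) * (2 / \<delta>) ^ CARD('m)
        = real H ^ CARD('d) * (7 ^ CARD('d) * 2 ^ CARD('m)) / (\<rho> ^ CARD('d) * \<delta> ^ CARD('m))"
      by (simp add: power_mult_distrib power_divide)
    also have "\<dots> < real H ^ CARD('d) * real Q"
    proof -
      have "real H ^ CARD('d) * (7 ^ CARD('d) * 2 ^ CARD('m)) < real H ^ CARD('d) * (real Q * \<rho> ^ CARD('d) * \<delta> ^ CARD('m))"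
        using vol H1 by (intro mult_strict_left_mono) auto
      then show ?thesis using \<rho> \<delta> by (simp add: pos_divide_less_eq mult_ac)
    qed
    finally show ?thesis using cardE cardD by (simp add: mult_ac)
  qed
  moreover have "\<Phi> ` D \<subseteq> E"
  proof
    fix e assume "e \<in> \<Phi> ` D"
    then obtain q p where "(q, p) \<in> D" and e: "e = \<Phi> (q, p)" by auto
    then have qp: "q < Q" "\<And>i. p i < H" "e = \<Phi> (q, p)" by (auto simp: D_def PiE_iff)
    have bound: "\<bar>(real q * x i - real (p i)) / \<rho>\<bar> \<le> 2 * real H / \<rho>" for i
    proof -
      have "\<bar>real q * x i - real (p i)\<bar> \<le> 2 * real H"
      proof -
        have "\<bar>real q * x i - real (p i)\<bar> \<le> real q * \<bar>x i\<bar> + real (p i)"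
          using abs_triangle_ineq4[of "real q * x i" "real (p i)"] by (simp add: abs_mult)
        then show ?thesis using H[of q i] qp(1) qp(2)[of i] by simp
      qed
      then show ?thesis using \<rho> by (simp add: divide_right_mono abs_divide)
    qed
    have "-B \<le> \<lfloor>(real q * x i - real (p i)) / \<rho>\<rfloor> \<and> \<lfloor>(real q * x i - real (p i)) / \<rho>\<rfloor> \<le> B" for i

    proof -
      have "\<lfloor>y\<rfloor> \<le> \<lceil>c\<rceil> \<and> - \<lceil>c\<rceil> \<le> \<lfloor>y\<rfloor>" if "\<bar>y\<bar> \<le> c" for y c :: real
        using that by linarith
      from this[OF bound[of i]] show ?thesis by (simp add: B_def)
    qed
    moreover have "0 \<le> \<lfloor>frac (L q p l) / \<delta>\<rfloor> \<and> \<lfloor>frac (L q p l) / \<delta>\<rfloor> \<le> \<lfloor>1 / \<delta>\<rfloor>" for l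
      using \<delta> frac_lt_1[of "L q p l"] by (auto intro!: floor_mono divide_right_mono)
    ultimately show "e \<in> E" by (auto simp: qp(3) \<Phi>_def E_def)
  qed
  then have "card (\<Phi> ` D) \<le> card E"
    by (intro card_mono) (auto simp: E_def intro!: finite_PiE)
  ultimately have "card (\<Phi> ` D) < card D" by linarith
  then have "\<not> inj_on \<Phi> D" by (rule pigeonhole)
  then obtain q1 p1 q2 p2 where in_D: "(q1, p1) \<in> D" "(q2, p2) \<in> D"
    and ne: "(q1, p1) \<noteq> (q2, p2)" and eq: "\<Phi> (q1, p1) = \<Phi> (q2, p2)"
    by (auto simp: inj_on_def)
  have floor_close: "\<bar>u - v\<bar> < e" if "\<lfloor>u / e\<rfloor> = \<lfloor>v / e\<rfloor>" "e > 0" for u v e :: real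
  proof -
    have "\<bar>u / e - v / e\<bar> < 1" using that(1) by linarith
    then show ?thesis using that(2) by (simp add: diff_divide_distrib[symmetric] abs_divide)
  qed
  have result: ?thesis if "(q1, p1) \<in> D" "(q2, p2) \<in> D" "q1 < q2" "\<Phi> (q1, p1) = \<Phi> (q2, p2)" for q1 q2 p1 p2
  proof -
    let ?p = "\<lambda>i. int (p2 i) - int (p1 i)"
    have 1: "1 \<le> q2 - q1" "q2 - q1 \<le> Q" using that by (auto simp: D_def)
    have 2: "\<bar>real (q2 - q1) * x i - of_int (?p i)\<bar> < \<rho>" for i
    proof -
      have "\<lfloor>(real q2 * x i - real (p2 i)) / \<rho>\<rfloor> = \<lfloor>(real q1 * x i - real (p1 i)) / \<rho>\<rfloor>"
        using that(4) by (simp add: \<Phi>_def fun_eq_iff)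
      from floor_close[OF this \<rho>(1)] show ?thesis
        using that(3) by (simp add: of_nat_diff algebra_simps)
    qed
    have 3: "\<exists>z::int. \<bar>real (q2 - q1) * \<beta> l + (\<Sum>i\<in>UNIV. of_int (?p i) * \<gamma> i l) - of_int z\<bar> < \<delta>" for l
    proof -
      have "\<lfloor>frac (L q2 p2 l) / \<delta>\<rfloor> = \<lfloor>frac (L q1 p1 l) / \<delta>\<rfloor>"
        using that(4) by (simp add: \<Phi>_def fun_eq_iff)
      from floor_close[OF this \<delta>(1)]
      have "\<bar>L q2 p2 l - L q1 p1 l - of_int (\<lfloor>L q2 p2 l\<rfloor> - \<lfloor>L q1 p1 l\<rfloor>)\<bar> < \<delta>"
        by (simp add: frac_def algebra_simps)
      moreover have "L q2 p2 l - L q1 p1 l = real (q2 - q1) * \<beta> l + (\<Sum>i\<in>UNIV. of_int (?p i) * \<gamma> i l)"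
        using that(3) by (simp add: L_def of_nat_diff left_diff_distrib sum_subtractf)
      ultimately show ?thesis by (intro exI[of _ "\<lfloor>L q2 p2 l\<rfloor> - \<lfloor>L q1 p1 l\<rfloor>"]) simp
    qed
    show ?thesis
      using 1 2 3 by (intro exI[of _ "q2 - q1"] exI[of _ ?p] conjI allI) auto
  qed
  \<comment> \<open>Here \<open>\<rho> \<le> 1\<close> enters: for \<open>q1 = q2\<close> the
    numerators would differ by integers of absolute value less than 1.\<close>
  have "q1 \<noteq> q2"
  proof
    assume q: "q1 = q2"
    have "p1 i = p2 i" for i
    proof -
      have "\<lfloor>(real q2 * x i - real (p2 i)) / \<rho>\<rfloor> = \<lfloor>(real q1 * x i - real (p1 i)) / \<rho>\<rfloor>"
        using eq by (simp add: \<Phi>_def fun_eq_iff)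
      from floor_close[OF this \<rho>(1)] q \<rho>(2) have "\<bar>real (p1 i) - real (p2 i)\<bar> < 1" by simp
      then show ?thesis by linarith
    qed
    then show False using ne q by auto
  qed
  then show ?thesis
    using result[OF in_D] result[OF in_D(2,1)] eq by (cases "q1 < q2") auto
qed

section \<open>Ubiquity of the rational points near the subspace\<close>

definition nearly_integral :: "('d::finite option \<Rightarrow> 'm \<Rightarrow> real) \<Rightarrow> real \<Rightarrow> nat \<Rightarrow> ('d \<Rightarrow> int) \<Rightarrow> bool" where
  "nearly_integral \<alpha> \<delta> q p \<longleftrightarrow>
     (\<forall>l. \<exists>z::int. \<bar>real q * \<alpha> None l + (\<Sum>i\<in>UNIV. of_int (p i) * \<alpha> (Some i) l) - of_int z\<bar> < \<delta>)"

lemma sum_option_UNIV: "(\<Sum>i\<in>UNIV. f i) = f None + (\<Sum>i\<in>UNIV. f (Some i))"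
  for f :: "'d::finite option \<Rightarrow> 'a::comm_monoid_add"
  by (simp add: UNIV_option_conv sum.reindex)

text \<open>Sums over short multiplicative blocks control the sum up to \<open>X\<close>: the bound
  \<open>c1 y / l + c2 y powr b / (g powr b - 1)\<close> grows by exactly one block when \<open>y\<close> is
  multiplied by \<open>g = 1 + l\<close>.\<close>

lemma sum_from_blocks:
  fixes t :: "nat \<Rightarrow> real" and l b c0 c1 c2 X :: real
  assumes l: "0 < l" "l \<le> 1" and b: "0 < b" and c: "c0 \<ge> 0" "c1 \<ge> 0" "c2 \<ge> 0" and t: "\<And>q. t q \<ge> 0"
    and init: "\<And>q. real q < 1 / l \<Longrightarrow> t q \<le> c0"
    and block: "\<And>y. y \<ge> 1 / l \<Longrightarrow> (\<Sum>q | y \<le> real q \<and> real q < (1 + l) * y. t q) \<le> c1 * y + c2 * y powr b"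
    and X: "X > 0"
  shows "(\<Sum>q | 1 \<le> q \<and> real q \<le> X. t q) \<le> c0 / l + 2 * c1 * X / l + c2 * (2 * X) powr b / ((1 + l) powr b - 1)"
proof -
  define g where "g = 1 + l"
  have g: "g > 1" "g \<le> 2" using l by (auto simp: g_def)
  define e where "e = g powr b - 1"
  have e: "e > 0" using g b by (simp add: e_def)
  define S where "S = (\<lambda>y. \<Sum>q | 1 \<le> q \<and> real q < y. t q)"
  have fin: "finite {q::nat. P q \<and> real q < y}" "finite {q::nat. P q \<and> real q \<le> y}" for y P
    by (rule finite_subset[of _ "{..nat \<lceil>y\<rceil>}"]; auto; linarith)+
  have S0: "S (1 / l) \<le> c0 / l"
  proof -
    have "S (1 / l) \<le> (\<Sum>q | 1 \<le> q \<and> real q < 1 / l. c0)"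
      unfolding S_def using init by (intro sum_mono) auto
    also have "\<dots> = real (card {q. 1 \<le> q \<and> real q < 1 / l}) * c0" by simp
    also have "\<dots> \<le> (1 / l) * c0"
    proof (intro mult_right_mono c)
      have "{q. 1 \<le> q \<and> real q < 1 / l} \<subseteq> {1..nat \<lfloor>1 / l\<rfloor>}"
        by (auto simp: le_nat_floor)
      then have "card {q. 1 \<le> q \<and> real q < 1 / l} \<le> nat \<lfloor>1 / l\<rfloor>"
        using card_mono[of "{1..nat \<lfloor>1 / l\<rfloor>}"] by fastforce
      then show "real (card {q. 1 \<le> q \<and> real q < 1 / l}) \<le> 1 / l"
        using l by (smt (verit) of_nat_floor of_nat_mono zero_le_divide_1_iff)
    qed
    finally show ?thesis by simp
  qed
  have step: "S (g * y) \<le> S y + (\<Sum>q | y \<le> real q \<and> real q < g * y. t q)" for y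
  proof -
    have "S (g * y) \<le> (\<Sum>q\<in>{q. 1 \<le> q \<and> real q < y} \<union> {q. y \<le> real q \<and> real q < g * y}. t q)"
      unfolding S_def using t by (intro sum_mono2) (auto simp: fin)
    also have "\<dots> = S y + (\<Sum>q | y \<le> real q \<and> real q < g * y. t q)"
      unfolding S_def by (intro sum.union_disjoint) (auto simp: fin)
    finally show ?thesis .
  qed
  have yi: "g ^ i / l \<ge> 1 / l" for i
    using g l by (intro divide_right_mono one_le_power) auto
  have bound: "S (g ^ i / l) \<le> c0 / l + c1 * (g ^ i / l) / l + c2 * (g ^ i / l) powr b / e" for i
  proof (induction i)
    case 0
    have "S (g ^ 0 / l) \<le> c0 / l" using S0 by simp
    also have "\<dots> \<le> c0 / l + c1 * (g ^ 0 / l) / l + c2 * (g ^ 0 / l) powr b / e"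
      using c l e by simp
    finally show ?case .
  next
    case (Suc i)
    define y where "y = g ^ i / l"
    have y0: "y > 0" using g l by (simp add: y_def)
    have "S (g * y) \<le> S y + (c1 * y + c2 * y powr b)"
      using step[of y] block[of y] yi[of i] by (simp add: y_def g_def)
    also have "\<dots> \<le> c0 / l + c1 * y / l + c2 * y powr b / e + (c1 * y + c2 * y powr b)"
      using Suc.IH by (simp add: y_def)
    also have "\<dots> = c0 / l + c1 * (g * y) / l + c2 * ((e + 1) * y powr b) / e"
      using l e by (simp add: g_def field_simps)
    also have "(e + 1) * y powr b = (g * y) powr b"
      using g y0 by (simp add: e_def powr_mult)
    finally show ?case by (simp add: y_def)
  qed
  obtain k where "X * l < g ^ k" using real_arch_pow[OF g(1)] by auto
  then have ex: "\<exists>k. X < g ^ k / l" using l by (auto simp: field_simps)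
  \<comment> \<open>Since \<open>g \<le> 2\<close>, minimality keeps \<open>g ^ i / l\<close> below
    \<open>2 * X\<close> unless \<open>i = 0\<close>.\<close>
  define i where "i = (LEAST k. X < g ^ k / l)"
  have i: "X < g ^ i / l" unfolding i_def by (rule LeastI_ex[OF ex])
  have le: "(\<Sum>q | 1 \<le> q \<and> real q \<le> X. t q) \<le> S (g ^ i / l)"
    unfolding S_def using t i by (intro sum_mono2) (auto simp: fin)
  show ?thesis
  proof (cases i)
    case 0
    then show ?thesis
      using le S0 c l X e unfolding e_def g_def
      by (smt (verit) div_0 divide_nonneg_pos mult_nonneg_nonneg power_0 powr_ge_zero)
  next
    case (Suc j)
    have "\<not> X < g ^ j / l" using not_less_Least[of j "\<lambda>k. X < g ^ k / l"] Suc by (simp add: i_def)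
    then have "g * (g ^ j / l) \<le> 2 * X" using g X l by (intro mult_mono) auto
    then have y: "g ^ i / l \<le> 2 * X" by (simp add: Suc)
    have "S (g ^ i / l) \<le> c0 / l + c1 * (g ^ i / l) / l + c2 * (g ^ i / l) powr b / e"
      by (rule bound)
    also have "\<dots> \<le> c0 / l + c1 * (2 * X) / l + c2 * (2 * X) powr b / e"
      using y c l e b g by (intro add_mono divide_right_mono mult_left_mono powr_mono2) auto
    finally show ?thesis using le by (simp add: e_def g_def mult_ac)
  qed
qed

text \<open>\<open>count\<close> is the conclusion of \<open>count_near_integral\<close> for
  \<open>d + 1\<close> rows. In the application \<open>\<sigma>\<close> exceeds the exponent of the
  matrix as well; \<open>\<sigma> > m\<close> makes \<open>1 - m / \<sigma>\<close> positive, so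
  that the error terms over the blocks form a growing geometric series.\<close>

locale lattice_count =
  fixes \<alpha> :: "'d::finite option \<Rightarrow> 'm::finite \<Rightarrow> real" and \<sigma> C :: real
  assumes \<sigma>: "real CARD('m) < \<sigma>" and C: "C > 0"
    and count: "\<And>h \<delta> S. 1 \<le> h \<Longrightarrow> 0 < \<delta> \<Longrightarrow> finite S \<Longrightarrow>
      (\<And>a b i. a \<in> S \<Longrightarrow> b \<in> S \<Longrightarrow> \<bar>real_of_int (a i - b i)\<bar> \<le> h) \<Longrightarrow>
      (\<And>a l. a \<in> S \<Longrightarrow> \<exists>z::int. \<bar>(\<Sum>i\<in>UNIV. of_int (a i) * \<alpha> i l) - of_int z\<bar> < \<delta>) \<Longrightarrow>
      real (card S) \<le> C * (h ^ CARD('d option) * \<delta> ^ CARD('m)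
                          + h powr (real CARD('d option) - real CARD('m) / \<sigma>))"
begin

definition near_pts :: "('d \<Rightarrow> real) \<Rightarrow> real \<Rightarrow> real \<Rightarrow> nat \<Rightarrow> ('d \<Rightarrow> int) set" where
  "near_pts a l \<delta> q = {p. (\<forall>i. \<bar>of_int (p i) - real q * a i\<bar> \<le> 2 * l * real q) \<and> nearly_integral \<alpha> \<delta> q p}"

lemma near_pts_card:
  assumes "l \<ge> 0"
  shows "finite (near_pts a l \<delta> q)" "real (card (near_pts a l \<delta> q)) \<le> (4 * l * real q + 1) ^ CARD('d)"
proof -
  let ?I = "\<lambda>i. {\<lceil>real q * a i - 2 * l * real q\<rceil>..\<lfloor>real q * a i + 2 * l * real q\<rfloor>}"
  have sub: "near_pts a l \<delta> q \<subseteq> (\<Pi>\<^sub>E i\<in>UNIV. ?I i)"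
  proof
    fix p assume "p \<in> near_pts a l \<delta> q"
    then have "\<bar>of_int (p i) - real q * a i\<bar> \<le> 2 * l * real q" for i by (simp add: near_pts_def)
    then have "p i \<in> ?I i" for i
      unfolding atLeastAtMost_iff ceiling_le_iff le_floor_iff by (smt (verit))
    then show "p \<in> (\<Pi>\<^sub>E i\<in>UNIV. ?I i)" by auto
  qed
  have fin: "finite (\<Pi>\<^sub>E i\<in>UNIV. ?I i)" by (intro finite_PiE) auto
  show "finite (near_pts a l \<delta> q)" by (rule finite_subset[OF sub fin])
  have "card (near_pts a l \<delta> q) \<le> card (\<Pi>\<^sub>E i\<in>UNIV. ?I i)" by (rule card_mono[OF fin sub])
  then have "real (card (near_pts a l \<delta> q)) \<le> (\<Prod>i\<in>UNIV. real (card (?I i)))"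
    by (simp add: card_PiE flip: of_nat_prod)
  also have "\<dots> \<le> (\<Prod>i\<in>(UNIV::'d set). 4 * l * real q + 1)"
  proof (intro prod_mono conjI)
    fix i :: 'd
    have "0 \<le> l * real q" using assms by simp
    then show "real (card (?I i)) \<le> 4 * l * real q + 1"
      by simp linarith
  qed simp
  finally show "real (card (near_pts a l \<delta> q)) \<le> (4 * l * real q + 1) ^ CARD('d)" by simp
qed

text \<open>Over a block of denominators of length \<open>l * y\<close> the centres
  \<open>q a\<close> move by at most \<open>R * l * y\<close>, so all pairs \<open>(q, p)\<close>
  together lie in a box of side \<open>(R + 8) * l * y\<close>. A single application of
  \<open>count\<close> then gains a factor \<open>l\<close> in every coordinate, which a longer
  block would lose.\<close>

lemma block_count:
  assumes l: "0 < l" "l \<le> 1" and y: "y \<ge> 1 / l" and R: "R \<ge> 1" "\<And>i. \<bar>a i\<bar> \<le> R" and \<delta>: "\<delta> > 0"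
  shows "(\<Sum>q | y \<le> real q \<and> real q < (1 + l) * y. real (card (near_pts a l \<delta> q)))
     \<le> C * (((R + 8) * l * y) ^ (CARD('d) + 1) * \<delta> ^ CARD('m)
          + ((R + 8) * l * y) powr (real CARD('d) + 1 - real CARD('m) / \<sigma>))"
proof -
  define h where "h = (R + 8) * l * y"
  define B where "B = {q. y \<le> real q \<and> real q < (1 + l) * y}"
  have ly: "l * y \<ge> 1" using y l by (simp add: field_simps)
  have "1 * 1 \<le> (R + 8) * (l * y)" using ly R by (intro mult_mono) auto
  then have h: "h \<ge> 1" by (simp add: h_def mult_ac)
  have finB: "finite B"
    unfolding B_def by (rule finite_subset[of _ "{..nat \<lceil>(1 + l) * y\<rceil>}"]; auto; linarith)
  define f :: "nat \<times> ('d \<Rightarrow> int) \<Rightarrow> 'd option \<Rightarrow> int"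
    where "f = (\<lambda>(q, p). case_option (int q) p)"
  define S where "S = f ` (SIGMA q:B. near_pts a l \<delta> q)"
  have inj: "inj_on f (SIGMA q:B. near_pts a l \<delta> q)"
  proof
    fix u v assume "f u = f v"
    then have "f u None = f v None" "\<And>i. f u (Some i) = f v (Some i)" by simp_all
    then show "u = v" by (cases u; cases v) (auto simp: f_def)
  qed
  have "(\<Sum>q\<in>B. real (card (near_pts a l \<delta> q))) = real (card S)"
    unfolding S_def card_image[OF inj]
    by (subst card_SigmaI) (use finB near_pts_card(1) l in auto)
  also have "\<dots> \<le> C * (h ^ CARD('d option) * \<delta> ^ CARD('m)
                          + h powr (real CARD('d option) - real CARD('m) / \<sigma>))"
  proof (rule count[OF h \<delta>])
    show "finite S" unfolding S_def
      by (intro finite_imageI finite_SigmaI finB near_pts_card(1)) (use l in auto)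
    fix u assume "u \<in> S"
    then obtain q p where q: "q \<in> B" "p \<in> near_pts a l \<delta> q" "u = f (q, p)" by (auto simp: S_def)
    show "\<exists>z::int. \<bar>(\<Sum>i\<in>UNIV. of_int (u i) * \<alpha> i j) - of_int z\<bar> < \<delta>" for j
      using q(2) by (simp add: q(3) f_def near_pts_def nearly_integral_def sum_option_UNIV)
    fix v i assume "v \<in> S"
    then obtain q' p' where q': "q' \<in> B" "p' \<in> near_pts a l \<delta> q'" "v = f (q', p')" by (auto simp: S_def)
    have qb: "y \<le> real q" "real q \<le> y + l * y" "y \<le> real q'" "real q' \<le> y + l * y"
      using q(1) q'(1) by (auto simp: B_def algebra_simps)
    then have qq: "\<bar>real q - real q'\<bar> \<le> l * y" by linarith
    show "\<bar>real_of_int (u i - v i)\<bar> \<le> h"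
    proof (cases i)
      case None
      have "1 * (l * y) \<le> (R + 8) * (l * y)" using R ly by (intro mult_right_mono) auto
      then show ?thesis using qq None by (simp add: q(3) q'(3) f_def h_def mult_ac)
    next
      case (Some j)
      have p: "\<bar>of_int (p j) - real q * a j\<bar> \<le> 2 * l * real q" "\<bar>of_int (p' j) - real q' * a j\<bar> \<le> 2 * l * real q'"
        using q(2) q'(2) by (auto simp: near_pts_def)
      have "real_of_int (p j - p' j) = (of_int (p j) - real q * a j) - (of_int (p' j) - real q' * a j)
        + (real q - real q') * a j" by (simp add: algebra_simps)
      also have "\<bar>\<dots>\<bar> \<le> 2 * l * real q + 2 * l * real q' + \<bar>(real q - real q') * a j\<bar>"
        using p by linarith
      also have "\<dots> \<le> 2 * l * (2 * y) + 2 * l * (2 * y) + l * y * R"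
        unfolding abs_mult
      proof (intro add_mono mult_left_mono mult_mono qq R)
        have "l * y \<le> 1 * y" using l ly by (intro mult_right_mono) (auto simp: zero_le_mult_iff intro: order.trans[OF _ y])
        then show "real q \<le> 2 * y" "real q' \<le> 2 * y" using qb by linarith+
      qed (use l ly in auto)
      also have "\<dots> = h" by (simp add: h_def algebra_simps)
      finally show ?thesis by (simp add: q(3) q'(3) f_def Some)
    qed
  qed
  finally show ?thesis by (simp add: h_def B_def card_UNIV_option add.commute)
qed

text \<open>The weight \<open>1 / q ^ d\<close> is, up to a factor, the volume of a cube of radius
  proportional to \<open>1 / q\<close> around \<open>p / q\<close>. The order of the quantifiers
  matters: \<open>C1\<close> serves all \<open>l\<close>, because it will fix the proportion
  \<open>\<kappa>\<close>, whereas \<open>C2\<close> may depend on \<open>l\<close>, being attached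
  to lower powers of \<open>X\<close>.\<close>

lemma weighted_count:
  assumes R: "R \<ge> 1"
  shows "\<exists>C1>0. \<forall>l. 0 < l \<longrightarrow> l \<le> 1 \<longrightarrow> (\<exists>C2>0. \<forall>a \<delta> X. (\<forall>i. \<bar>a i\<bar> \<le> R) \<longrightarrow> 0 < \<delta> \<longrightarrow> 0 < X \<longrightarrow>
     (\<Sum>q | 1 \<le> q \<and> real q \<le> X. real (card (near_pts a l \<delta> q)) / real q ^ CARD('d))
       \<le> C1 * l ^ CARD('d) * \<delta> ^ CARD('m) * X + C2 * (1 + X powr (1 - real CARD('m) / \<sigma>)))"
proof (intro exI conjI allI impI)
  define d m where "d = CARD('d)" and "m = CARD('m)"
  define b where "b = 1 - real m / \<sigma>"
  have b: "b > 0" using \<sigma> by (simp add: b_def m_def field_simps)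
  define C1 where "C1 = 2 * C * (R + 8) ^ (d + 1)"
  show "C1 > 0" using C R by (simp add: C1_def)
  fix l :: real assume l: "0 < l" "l \<le> 1"
  define c2 where "c2 = C * ((R + 8) * l) powr (real d + b)"
  define C2 where "C2 = 5 ^ d / l + c2 * 2 powr b / ((1 + l) powr b - 1)"
  have pos: "(1 + l) powr b - 1 > 0" using l b by simp
  have "c2 > 0" using C R l by (simp add: c2_def)
  then show "C2 > 0" using l pos unfolding C2_def by (intro add_pos_pos divide_pos_pos mult_pos_pos) auto
  fix a :: "'d \<Rightarrow> real" and \<delta> X :: real
  assume a: "\<forall>i. \<bar>a i\<bar> \<le> R" and \<delta>: "0 < \<delta>" and X: "0 < X"
  define c1 where "c1 = C * ((R + 8) * l) ^ (d + 1) * \<delta> ^ m"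
  have "(\<Sum>q | 1 \<le> q \<and> real q \<le> X. real (card (near_pts a l \<delta> q)) / real q ^ d)
     \<le> 5 ^ d / l + 2 * c1 * X / l + c2 * (2 * X) powr b / ((1 + l) powr b - 1)"
  proof (rule sum_from_blocks[OF l b])
    show "0 \<le> (5::real) ^ d" "0 \<le> c1" "0 \<le> c2" using \<open>c2 > 0\<close> C R l \<delta> by (auto simp: c1_def)
    show "0 < X" by fact
    show "0 \<le> real (card (near_pts a l \<delta> q)) / real q ^ d" for q by simp
    show "real (card (near_pts a l \<delta> q)) / real q ^ d \<le> 5 ^ d" if q: "real q < 1 / l" for q
    proof (cases "q = 0")
      case True
      \<comment> \<open>At \<open>q = 0\<close> the quotient is 0, because division by 0 yields
        0.\<close>
      have "(0::real) ^ d = 0" by (simp add: d_def)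
      then show ?thesis by (simp only: True of_nat_0 div_by_0) simp
    next
      case False
      have "real (card (near_pts a l \<delta> q)) \<le> (4 * l * real q + 1) ^ d"
        using near_pts_card(2)[of l a \<delta> q] l by (simp add: d_def)
      also have "\<dots> \<le> 5 ^ d"
        using q l by (intro power_mono) (auto simp: field_simps)
      also have "\<dots> \<le> 5 ^ d * real q ^ d" using False by simp
      finally show ?thesis using False by (simp add: divide_le_eq)
    qed
    fix y assume y: "y \<ge> 1 / l"
    then have y0: "y > 0" using l by (smt (verit) zero_less_divide_1_iff)
    have "(\<Sum>q | y \<le> real q \<and> real q < (1 + l) * y. real (card (near_pts a l \<delta> q)) / real q ^ d)
       \<le> (\<Sum>q | y \<le> real q \<and> real q < (1 + l) * y. real (card (near_pts a l \<delta> q)) / y ^ d)"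
      using y0 by (intro sum_mono divide_left_mono power_mono mult_pos_pos zero_less_power) auto
    also have "\<dots> = (\<Sum>q | y \<le> real q \<and> real q < (1 + l) * y. real (card (near_pts a l \<delta> q))) / y ^ d"
      by (simp add: sum_divide_distrib)
    also have "\<dots> \<le> C * (((R + 8) * l * y) ^ (d + 1) * \<delta> ^ m + ((R + 8) * l * y) powr (real d + 1 - real m / \<sigma>)) / y ^ d"
      using block_count[OF l y R _ \<delta>, of a] a y0 by (intro divide_right_mono) (auto simp: d_def m_def)
    also have "\<dots> = c1 * y + c2 * y powr b"
    proof -
      have "((R + 8) * l * y) ^ (d + 1) / y ^ d = ((R + 8) * l) ^ (d + 1) * y"
        using y0 by (simp add: power_mult_distrib)
      moreover have "((R + 8) * l * y) powr (real d + 1 - real m / \<sigma>) / y ^ d = ((R + 8) * l) powr (real d + b) * y powr b"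
      proof -
        have "((R + 8) * l * y) powr (real d + 1 - real m / \<sigma>) = ((R + 8) * l) powr (real d + b) * (y powr (real d) * y powr b)"
          using y0 R l by (simp add: powr_mult b_def add_diff_eq flip: powr_add)
        then show ?thesis using y0 by (simp add: powr_realpow)
      qed
      moreover have "C * (((R + 8) * l * y) ^ (d + 1) * \<delta> ^ m + ((R + 8) * l * y) powr (real d + 1 - real m / \<sigma>)) / y ^ d
        = C * (((R + 8) * l * y) ^ (d + 1) / y ^ d) * \<delta> ^ m + C * (((R + 8) * l * y) powr (real d + 1 - real m / \<sigma>) / y ^ d)"
        by (simp add: add_divide_distrib algebra_simps)
      ultimately show ?thesis by (simp add: c1_def c2_def mult_ac)
    qed
    finally show "(\<Sum>q | y \<le> real q \<and> real q < (1 + l) * y. real (card (near_pts a l \<delta> q)) / real q ^ d) \<le> c1 * y + c2 * y powr b" .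
  qed
  \<comment> \<open>Dividing by the relative block length \<open>l\<close> turns the power
    \<open>l ^ (d + 1)\<close> in \<open>c1\<close> into the \<open>l ^ d\<close> of a
    volume.\<close>
  also have "2 * c1 * X / l = C1 * l ^ d * \<delta> ^ m * X"
    using l by (simp add: c1_def C1_def power_mult_distrib mult_ac)
  also have "5 ^ d / l + C1 * l ^ d * \<delta> ^ m * X + c2 * (2 * X) powr b / ((1 + l) powr b - 1)
     \<le> C1 * l ^ d * \<delta> ^ m * X + C2 * (1 + X powr b)"
  proof -
    define E where "E = c2 * 2 powr b / ((1 + l) powr b - 1)"
    have "E \<ge> 0" using \<open>c2 > 0\<close> pos by (simp add: E_def)
    moreover have "c2 * (2 * X) powr b / ((1 + l) powr b - 1) = E * X powr b"
      using X by (simp add: E_def powr_mult)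
    moreover have "(5 ^ d / l) * X powr b \<ge> 0" using l by simp
    moreover have "C2 * (1 + X powr b) = 5 ^ d / l + (5 ^ d / l) * X powr b + E + E * X powr b"
      by (simp only: C2_def E_def[symmetric] distrib_left distrib_right mult_1_right add_ac)
    ultimately show ?thesis by linarith
  qed
  finally show "(\<Sum>q | 1 \<le> q \<and> real q \<le> X. real (card (near_pts a l \<delta> q)) / real q ^ CARD('d))
       \<le> C1 * l ^ CARD('d) * \<delta> ^ CARD('m) * X + C2 * (1 + X powr (1 - real CARD('m) / \<sigma>))"
    by (simp add: d_def m_def b_def)
qed


end

section \<open>Cubes, rational points and separated sets\<close>

definition cube :: "real ^ 'd \<Rightarrow> real \<Rightarrow> (real ^ 'd) set" where
  "cube a r = {x. \<forall>i. \<bar>x $ i - a $ i\<bar> \<le> r}"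

lemma cube_eq_cbox: "cube a r = cbox (a - (\<chi> i. r)) (a + (\<chi> i. r))"
  by (force simp: cube_def mem_box_cart abs_le_iff algebra_simps)

lemma cube_lmeasurable [simp, intro]: "cube a r \<in> sets lborel" "cube a r \<in> sets borel" "cube a r \<in> fmeasurable lborel"
  by (simp_all add: cube_eq_cbox)

lemma measure_cube: "r \<ge> 0 \<Longrightarrow> measure lborel (cube a r) = (2 * r) ^ CARD('d)" for a :: "real ^ 'd::finite"
  unfolding cube_eq_cbox
  by (subst content_cbox_cart) (auto simp: interval_ne_empty_cart)

text \<open>The lower bound \<open>\<kappa> * Q\<close> on denominators serves twice: it makes the
  Dirichlet radius at these points comparable to \<open>\<rho>\<close>, and it sends
  \<open>q\<close> to infinity with the level, so that points of the limsup set have infinitely many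
  approximations.\<close>

definition rational_points :: "('d::finite option \<Rightarrow> 'm \<Rightarrow> real) \<Rightarrow> real \<Rightarrow> real \<Rightarrow> nat \<Rightarrow> (real ^ 'd) set" where
  "rational_points \<alpha> \<kappa> \<delta> Q =
     {y. \<exists>q p. 1 \<le> q \<and> \<kappa> * real Q \<le> real q \<and> q \<le> Q \<and> y = (\<chi> i. of_int (p i) / real q) \<and> nearly_integral \<alpha> \<delta> q p}"

lemma finite_rational_points_cube: "finite (cube a l \<inter> rational_points \<alpha> \<kappa> \<delta> Q)"
proof -
  let ?I = "\<lambda>q i. {\<lceil>real q * (a $ i - l)\<rceil>..\<lfloor>real q * (a $ i + l)\<rfloor>}"
  let ?F = "\<lambda>q. (\<lambda>p. \<chi> i. of_int (p i) / real q) ` (\<Pi>\<^sub>E i\<in>UNIV. ?I q i)"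
  have "cube a l \<inter> rational_points \<alpha> \<kappa> \<delta> Q \<subseteq> (\<Union>q\<in>{1..Q}. ?F q)"
  proof
    fix y assume y: "y \<in> cube a l \<inter> rational_points \<alpha> \<kappa> \<delta> Q"
    then obtain q p where q: "1 \<le> q" "q \<le> Q" "y = (\<chi> i. of_int (p i) / real q)"
      by (auto simp: rational_points_def)
    have "p i \<in> ?I q i" for i
    proof -
      have "a $ i - l \<le> of_int (p i) / real q \<and> of_int (p i) / real q \<le> a $ i + l"
        using y by (auto simp: cube_def q(3) abs_le_iff algebra_simps dest: spec[of _ i])
      then show ?thesis using q(1) by (simp add: ceiling_le_iff le_floor_iff field_simps)
    qed
    then have "y \<in> ?F q" unfolding q(3) by (intro imageI) auto
    then show "y \<in> (\<Union>q\<in>{1..Q}. ?F q)" using q by auto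
  qed
  then show ?thesis by (rule finite_subset) (auto intro!: finite_PiE)
qed

lemma maximal_separated_subset:
  assumes "finite (A :: (real ^ 'd) set)" "\<rho> > 0"
  obtains P where "P \<subseteq> A" "\<forall>x\<in>P. \<forall>y\<in>P. x \<noteq> y \<longrightarrow> (\<exists>i. \<rho> \<le> \<bar>x $ i - y $ i\<bar>)"
    "\<And>x. x \<in> A \<Longrightarrow> \<exists>y\<in>P. x \<in> cube y \<rho>"
proof -
  define F where "F = {P. P \<subseteq> A \<and> (\<forall>x\<in>P. \<forall>y\<in>P. x \<noteq> y \<longrightarrow> (\<exists>i. \<rho> \<le> \<bar>x $ i - y $ i\<bar>))}"
  have "finite F" using assms by (auto simp: F_def)
  moreover have "{} \<in> F" by (simp add: F_def)
  ultimately obtain P where P: "P \<in> F" "\<And>P'. P' \<in> F \<Longrightarrow> P \<subseteq> P' \<Longrightarrow> P = P'"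
    using finite_has_maximal[of F] by blast
  have "\<exists>y\<in>P. x \<in> cube y \<rho>" if x: "x \<in> A" for x
  proof (rule ccontr)
    assume no: "\<not> (\<exists>y\<in>P. x \<in> cube y \<rho>)"
    have far: "\<exists>i. \<rho> \<le> \<bar>x $ i - y $ i\<bar>" if "y \<in> P" for y
    proof (rule ccontr)
      assume "\<not> (\<exists>i. \<rho> \<le> \<bar>x $ i - y $ i\<bar>)"
      then have "x \<in> cube y \<rho>" by (auto simp: cube_def not_le intro: less_imp_le)
      then show False using no that by blast
    qed
    have "x \<notin> P" using no assms(2) by (auto simp: cube_def)
    then have "insert x P \<in> F" using P(1) x far by (auto simp: F_def abs_minus_commute)
    then show False using P(2)[of "insert x P"] \<open>x \<notin> P\<close> by auto
  qed
  then show ?thesis using P(1) that unfolding F_def by blast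
qed

lemma cube_trans:
  assumes "x \<in> cube y r" "y \<in> cube z r'" "r + r' \<le> R"
  shows "x \<in> cube z R"
  unfolding cube_def
proof safe
  fix i
  have "\<bar>x $ i - y $ i\<bar> \<le> r" "\<bar>y $ i - z $ i\<bar> \<le> r'" using assms by (auto simp: cube_def)
  then show "\<bar>x $ i - z $ i\<bar> \<le> R" using assms(3) by linarith
qed

context lattice_count
begin

text \<open>The points of \<open>cube a (l / 2)\<close> whose Dirichlet denominator is at most
  \<open>\<kappa> * Q\<close> fill at most half of it. Cubes of radius \<open>D2 * \<rho>\<close>
  around a maximal separated set \<open>P\<close> cover the others, and comparing volumes bounds
  \<open>card P\<close> from below. Both constants are independent of the cube; only
  \<open>Q0\<close> depends on it.\<close>

lemma ubiquity:
  assumes R: "R \<ge> 1" and \<tau>: "0 < \<tau>" "\<tau> < 1 / \<sigma>"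
  shows "\<exists>\<kappa>>0. \<exists>\<kappa>'>0. \<forall>(a :: real ^ 'd) l. 0 < l \<longrightarrow> l \<le> 1 \<longrightarrow> (\<forall>i. \<bar>a $ i\<bar> \<le> R) \<longrightarrow>
    (\<exists>Q0. \<forall>Q\<ge>Q0. \<forall>\<delta> \<rho>. real Q powr (-\<tau>) \<le> \<delta> \<longrightarrow> \<delta> \<le> 1 \<longrightarrow> 0 < \<rho> \<longrightarrow>
       \<rho> ^ CARD('d) * (real Q ^ (CARD('d) + 1) * \<delta> ^ CARD('m)) = 1 \<longrightarrow>
       (\<exists>P. finite P \<and> P \<subseteq> cube a l \<inter> rational_points \<alpha> \<kappa> \<delta> Q \<and>
          (\<forall>x\<in>P. \<forall>y\<in>P. x \<noteq> y \<longrightarrow> (\<exists>i. \<rho> \<le> \<bar>x $ i - y $ i\<bar>)) \<and>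
          \<kappa>' * l ^ CARD('d) \<le> real (card P) * \<rho> ^ CARD('d)))"
proof -
  define d m where "d = CARD('d)" and "m = CARD('m)"
  have dm: "d \<ge> 1" "m \<ge> 1" by (simp_all add: d_def m_def Suc_leI)
  define b where "b = 1 - real m / \<sigma>"
  have "\<sigma> > 0" using \<sigma> by (smt (verit) of_nat_0_le_iff)
  have b: "b > 0" using \<sigma> by (simp add: b_def m_def field_simps)
  \<comment> \<open>The margin between \<open>\<tau>\<close> and \<open>1 / \<sigma>\<close>, times
    \<open>m\<close>: the error term of the count contributes a volume of order
    \<open>Q powr (-e)\<close>.\<close>
  define e where "e = real m / \<sigma> - \<tau> * real m"
  have e: "e > 0" using mult_strict_right_mono[OF \<tau>(2), of "real m"] dm by (simp add: e_def)
  obtain C1 where C1: "C1 > 0" and W: "\<And>l. 0 < l \<Longrightarrow> l \<le> 1 \<Longrightarrow> \<exists>C2>0. \<forall>a \<delta> X. (\<forall>i. \<bar>a i\<bar> \<le> R) \<longrightarrow> 0 < \<delta> \<longrightarrow> 0 < X \<longrightarrow>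
     (\<Sum>q | 1 \<le> q \<and> real q \<le> X. real (card (near_pts a l \<delta> q)) / real q ^ d)
       \<le> C1 * l ^ d * \<delta> ^ m * X + C2 * (1 + X powr b)"
    using weighted_count[OF R] unfolding d_def[symmetric] m_def[symmetric] b_def[symmetric] by blast
  \<comment> \<open>Just above the constant in Dirichlet's principle, which will be applied with
    \<open>Q * \<rho>' ^ d * \<delta> ^ m = D ^ d\<close>.\<close>
  define D where "D = (7::real) ^ d * 2 ^ m + 1"
  have D: "D > 1" by (simp add: D_def)
  \<comment> \<open>Makes the main term \<open>\<kappa> * D ^ d * C1 * l ^ d\<close> of the volume
    of \<open>Bad\<close> at most a quarter of the volume \<open>l ^ d\<close> of
    \<open>cube a (l / 2)\<close>.\<close>
  define \<kappa> where "\<kappa> = min 1 (1 / (4 * D ^ d * C1))"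
  have \<kappa>: "0 < \<kappa>" "\<kappa> \<le> 1" "\<kappa> \<le> 1 / (4 * D ^ d * C1)" using D C1 by (auto simp: \<kappa>_def)
  \<comment> \<open>A point within \<open>\<rho>' / q\<close> of a rational point with
    \<open>q > \<kappa> * Q\<close>, which is itself within \<open>\<rho>\<close> of
    \<open>P\<close>, is within \<open>D2 * \<rho>\<close> of \<open>P\<close>.\<close>
  define D2 where "D2 = 1 + D / \<kappa>"
  have D2: "D2 > 0" using D \<kappa> by (simp add: D2_def add_pos_pos)
  define \<kappa>' where "\<kappa>' = 1 / (2 * (2 * D2) ^ d)"
  have \<kappa>': "\<kappa>' > 0" using D2 by (simp add: \<kappa>'_def)
  have "\<exists>Q0. \<forall>Q\<ge>Q0. \<forall>\<delta> \<rho>. real Q powr (-\<tau>) \<le> \<delta> \<longrightarrow> \<delta> \<le> 1 \<longrightarrow> 0 < \<rho> \<longrightarrow>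
       \<rho> ^ d * (real Q ^ (d + 1) * \<delta> ^ m) = 1 \<longrightarrow>
       (\<exists>P. finite P \<and> P \<subseteq> cube a l \<inter> rational_points \<alpha> \<kappa> \<delta> Q \<and>
          (\<forall>x\<in>P. \<forall>y\<in>P. x \<noteq> y \<longrightarrow> (\<exists>i. \<rho> \<le> \<bar>x $ i - y $ i\<bar>)) \<and>
          \<kappa>' * l ^ d \<le> real (card P) * \<rho> ^ d)"
    if l: "0 < l" "l \<le> 1" and a: "\<And>i. \<bar>a $ i\<bar> \<le> R" for l and a :: "real ^ 'd"
  proof -
    obtain C2 where C2: "C2 > 0" and W2: "\<And>\<delta> X. 0 < \<delta> \<Longrightarrow> 0 < X \<Longrightarrow>
     (\<Sum>q | 1 \<le> q \<and> real q \<le> X. real (card (near_pts (\<lambda>i. a $ i) (l / 2) \<delta> q)) / real q ^ d)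
       \<le> C1 * (l / 2) ^ d * \<delta> ^ m * X + C2 * (1 + X powr b)"
    proof -
      obtain C2 where C2: "C2 > 0" "\<forall>a \<delta> X. (\<forall>i. \<bar>a i\<bar> \<le> R) \<longrightarrow> 0 < \<delta> \<longrightarrow> 0 < X \<longrightarrow>
     (\<Sum>q | 1 \<le> q \<and> real q \<le> X. real (card (near_pts a (l / 2) \<delta> q)) / real q ^ d)
       \<le> C1 * (l / 2) ^ d * \<delta> ^ m * X + C2 * (1 + X powr b)"
        using W[of "l / 2"] l by auto
      show ?thesis by (rule that[OF C2(1)]) (use C2(2) a in blast)
    qed
    define C3 where "C3 = 2 ^ d * D ^ d * (C2 * 2)"
    have C3: "C3 > 0" using D C2 by (simp add: C3_def)
    \<comment> \<open>The first bound makes the error term in the volume of \<open>Bad\<close> at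
      most \<open>l ^ d / 4\<close>; the second gives \<open>\<rho>' \<le> l / 2\<close>, so that
      the rational points found near \<open>cube a (l / 2)\<close> lie in
      \<open>cube a l\<close>.\<close>
    define \<epsilon> where "\<epsilon> = min (l ^ d / (4 * C3)) ((l / 2) ^ d / D ^ d)"
    have \<epsilon>: "\<epsilon> > 0" using l C3 D by (auto simp: \<epsilon>_def)
    define Q0 where "Q0 = nat \<lceil>\<epsilon> powr (- 1 / e)\<rceil> + 1"
    show ?thesis
    proof (intro exI[of _ Q0] allI impI)
      fix Q \<delta> \<rho>
      assume Q: "Q \<ge> Q0" and \<delta>: "real Q powr (-\<tau>) \<le> \<delta>" "\<delta> \<le> 1" and \<rho>: "0 < \<rho>" "\<rho> ^ d * (real Q ^ (d + 1) * \<delta> ^ m) = 1"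
      have Q1: "Q \<ge> 1" using Q by (simp add: Q0_def)
      then have \<delta>0: "\<delta> > 0" using \<delta>(1) by (smt (verit) powr_gt_zero of_nat_0_less_iff less_le_trans zero_less_one)
      have Qe: "real Q powr (-e) \<le> \<epsilon>"
      proof -
        have "\<epsilon> powr (- 1 / e) \<le> real Q" using Q unfolding Q0_def by linarith
        then have "real Q powr (-e) \<le> (\<epsilon> powr (- 1 / e)) powr (-e)"
          using \<epsilon> e by (intro powr_mono2') auto
        also have "\<dots> = \<epsilon>" using \<epsilon> e by (simp add: powr_powr)
        finally show ?thesis .
      qed
      have Q\<rho>: "(real Q * \<rho>) ^ d = 1 / (real Q * \<delta> ^ m)"
        using \<rho>(2) Q1 \<delta>0 by (simp add: power_mult_distrib field_simps)
      have \<delta>m: "1 / \<delta> ^ m \<le> real Q powr (\<tau> * real m)"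
      proof -
        have "(real Q powr (-\<tau>)) ^ m \<le> \<delta> ^ m" using \<delta> by (intro power_mono) auto
        also have "(real Q powr (-\<tau>)) ^ m = real Q powr (- \<tau> * real m)"
          using Q1 by (simp add: powr_power mult.commute)
        finally have "1 / \<delta> ^ m \<le> 1 / real Q powr (- \<tau> * real m)"
          using \<delta>0 Q1 by (intro divide_left_mono) auto
        then show ?thesis by (simp add: powr_minus field_simps)
      qed
      have Qb: "(1 + (\<kappa> * real Q) powr b) / (real Q * \<delta> ^ m) \<le> 2 * real Q powr (-e)"
      proof -
        have "1 + (\<kappa> * real Q) powr b \<le> real Q powr b + real Q powr b"
        proof (intro add_mono powr_mono2)
          show "1 \<le> real Q powr b" using Q1 b by (simp add: ge_one_powr_ge_zero)
          show "\<kappa> * real Q \<le> real Q" using \<kappa> by (simp add: mult_left_le_one_le)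
        qed (use b \<kappa> in auto)
        then have "(1 + (\<kappa> * real Q) powr b) / real Q * (1 / \<delta> ^ m) \<le> (2 * real Q powr b) / real Q * real Q powr (\<tau> * real m)"
          using \<delta>m \<delta>0 Q1 by (intro mult_mono divide_right_mono) auto
        also have "\<dots> = 2 * real Q powr (b - 1 + \<tau> * real m)"
          using Q1 by (simp add: powr_diff powr_add)
        also have "b - 1 + \<tau> * real m = - e" by (simp add: b_def e_def)
        finally show ?thesis by simp
      qed
      define \<rho>' where "\<rho>' = D * (real Q * \<rho>)"
      have \<rho>'0: "\<rho>' > 0" using D Q1 \<rho> by (simp add: \<rho>'_def)
      have \<rho>'d: "\<rho>' ^ d = D ^ d / (real Q * \<delta> ^ m)"
        by (simp add: \<rho>'_def power_mult_distrib[of D] Q\<rho>)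
      have \<rho>'l: "\<rho>' \<le> l / 2"
      proof -
        have "1 / (real Q * \<delta> ^ m) \<le> real Q powr (- 1) * real Q powr (\<tau> * real m)"
          using mult_left_mono[OF \<delta>m, of "1 / real Q"] Q1 by (simp add: powr_minus inverse_eq_divide)
        also have "\<dots> = real Q powr (\<tau> * real m - 1)" using Q1 by (simp add: powr_minus powr_diff inverse_eq_divide)
        also have "\<dots> \<le> real Q powr (-e)"
        proof (rule powr_mono)
          have "real m / \<sigma> \<le> 1" using \<sigma> \<open>\<sigma> > 0\<close> by (simp add: m_def)
          then show "\<tau> * real m - 1 \<le> -e" by (simp add: e_def)
        qed (use Q1 in auto)
        also have "\<dots> \<le> (l / 2) ^ d / D ^ d" using Qe by (simp add: \<epsilon>_def)
        finally have "\<rho>' ^ d \<le> (l / 2) ^ d"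
          using D by (simp add: \<rho>'d field_simps)
        then show ?thesis using l \<rho>'0 dm by (simp add: power_mono_iff)
      qed
      define X where "X = \<kappa> * real Q"
      have X: "X > 0" using \<kappa> Q1 by (simp add: X_def)
      define T where "T = near_pts (\<lambda>i. a $ i) (l / 2) \<delta>"
      define pt where "pt = (\<lambda>(q::nat) (p :: 'd \<Rightarrow> int). (\<chi> i. of_int (p i) / real q) :: real ^ 'd)"
      define A where "A = {q. 1 \<le> q \<and> real q \<le> X}"
      have finA: "finite A"
        unfolding A_def by (rule finite_subset[of _ "{..nat \<lceil>X\<rceil>}"]; auto; linarith)
      have finT: "finite (T q)" for q unfolding T_def by (rule near_pts_card) (use l in auto)
      define Bad where "Bad = (\<Union>q\<in>A. \<Union>p\<in>T q. cube (pt q p) (\<rho>' / real q))"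
      have Bad_sets: "Bad \<in> sets lborel"
        unfolding Bad_def using finA finT by (intro sets.finite_UN) auto
      have "measure lborel Bad \<le> (\<Sum>q\<in>A. \<Sum>p\<in>T q. measure lborel (cube (pt q p) (\<rho>' / real q)))"
        unfolding Bad_def using finA finT
        by (intro order.trans[OF measure_UNION_le] sum_mono measure_UNION_le) (auto intro!: sets.finite_UN)
      also have "\<dots> = (2 * \<rho>') ^ d * (\<Sum>q\<in>A. real (card (T q)) / real q ^ d)"
        unfolding sum_distrib_left using \<rho>'0
        by (intro sum.cong refl) (simp add: measure_cube d_def power_mult_distrib power_divide)
      also have "\<dots> \<le> (2 * \<rho>') ^ d * (C1 * (l / 2) ^ d * \<delta> ^ m * X + C2 * (1 + X powr b))"
        unfolding A_def T_def using \<rho>'0 W2[OF \<delta>0 X] by (intro mult_left_mono) auto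
      also have "\<dots> = l ^ d * (\<kappa> * (D ^ d * C1)) + C3 / 2 * ((1 + (\<kappa> * real Q) powr b) / (real Q * \<delta> ^ m))"
        using Q1 \<delta>0
        by (simp add: power_mult_distrib \<rho>'d X_def C3_def power_divide field_simps)
      also have "\<dots> \<le> l ^ d * (1 / 4) + C3 / 2 * (2 * real Q powr (-e))"
      proof (intro add_mono mult_left_mono Qb)
        show "\<kappa> * (D ^ d * C1) \<le> 1 / 4" using \<kappa>(3) D C1 by (simp add: field_simps)
      qed (use l C3 in auto)
      also have "\<dots> \<le> l ^ d * (1 / 4) + C3 * (l ^ d / (4 * C3))"

        using Qe C3 mult_left_mono[of "real Q powr (-e)" "l ^ d / (4 * C3)" C3] by (simp add: \<epsilon>_def)
      also have "\<dots> = l ^ d / 2" using C3 by simp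
      finally have Bad: "measure lborel Bad \<le> l ^ d / 2" .
      obtain P where P: "P \<subseteq> cube a l \<inter> rational_points \<alpha> \<kappa> \<delta> Q"
        "\<forall>x\<in>P. \<forall>y\<in>P. x \<noteq> y \<longrightarrow> (\<exists>i. \<rho> \<le> \<bar>x $ i - y $ i\<bar>)"
        "\<And>x. x \<in> cube a l \<inter> rational_points \<alpha> \<kappa> \<delta> Q \<Longrightarrow> \<exists>y\<in>P. x \<in> cube y \<rho>"
      proof (rule maximal_separated_subset[OF finite_rational_points_cube[of a l \<alpha> \<kappa> \<delta> Q] \<rho>(1)])
        fix P
        assume P: "P \<subseteq> cube a l \<inter> rational_points \<alpha> \<kappa> \<delta> Q"
          "\<forall>x\<in>P. \<forall>y\<in>P. x \<noteq> y \<longrightarrow> (\<exists>i. \<rho> \<le> \<bar>x $ i - y $ i\<bar>)"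
          "\<And>x. x \<in> cube a l \<inter> rational_points \<alpha> \<kappa> \<delta> Q \<Longrightarrow> \<exists>y\<in>P. x \<in> cube y \<rho>"
        show thesis by (rule that[OF P])
      qed
      have finP: "finite P" using P(1) finite_rational_points_cube finite_subset by blast
      have cover: "cube a (l / 2) \<subseteq> Bad \<union> (\<Union>z\<in>P. cube z (D2 * \<rho>))"
      proof
        fix x assume x: "x \<in> cube a (l / 2)"
        have "7 ^ CARD('d) * 2 ^ CARD('m) < real Q * \<rho>' ^ CARD('d) * \<delta> ^ CARD('m)"
        proof -
          have "real Q * \<rho>' ^ d * \<delta> ^ m = D ^ d" using Q1 \<delta>0 by (simp add: \<rho>'d)
          moreover have "D ^ 1 \<le> D ^ d" using D dm by (intro power_increasing) auto
          ultimately show ?thesis by (simp add: D_def d_def m_def)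
        qed
        from dirichlet_linear_forms[OF \<rho>'0 _ \<delta>0 \<delta>(2) this, of "\<lambda>i. x $ i" "\<alpha> None" "\<lambda>i. \<alpha> (Some i)"] \<rho>'l l
        obtain q p where q: "1 \<le> q" "q \<le> Q" and xp: "\<And>i. \<bar>real q * x $ i - of_int (p i)\<bar> < \<rho>'"
          and near: "nearly_integral \<alpha> \<delta> q p"
          by (auto simp: nearly_integral_def)
        have xpt: "x \<in> cube (pt q p) (\<rho>' / real q)"
          unfolding cube_def
        proof safe
          fix i
          have "x $ i - pt q p $ i = (real q * x $ i - of_int (p i)) / real q"
            using q(1) by (simp add: pt_def field_simps)
          then have "\<bar>x $ i - pt q p $ i\<bar> = \<bar>real q * x $ i - of_int (p i)\<bar> / real q"
            by (simp only: abs_divide abs_of_nat)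
          also have "\<dots> \<le> \<rho>' / real q" using xp[of i] by (intro divide_right_mono) auto
          finally show "\<bar>x $ i - pt q p $ i\<bar> \<le> \<rho>' / real q" .
        qed
        have pl: "\<bar>of_int (p i) - real q * a $ i\<bar> \<le> l * real q" for i
        proof -
          have "\<bar>real q * (x $ i - a $ i)\<bar> \<le> real q * (l / 2)"
            using x unfolding abs_mult by (intro mult_mono) (auto simp: cube_def)
          moreover have "l / 2 * 1 \<le> l / 2 * real q" using q l by (intro mult_left_mono) auto
          moreover have "of_int (p i) - real q * a $ i = real q * (x $ i - a $ i) - (real q * x $ i - of_int (p i))"
            by (simp add: algebra_simps)
          ultimately show ?thesis using xp[of i] \<rho>'l by (simp add: mult.commute)
        qed
        show "x \<in> Bad \<union> (\<Union>z\<in>P. cube z (D2 * \<rho>))"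
        proof (cases "real q \<le> X")
          case True
          then have "q \<in> A" using q by (simp add: A_def)
          moreover have "p \<in> T q" using pl near by (simp add: T_def near_pts_def)
          ultimately show ?thesis using xpt unfolding Bad_def by blast
        next
          case False
          have "pt q p \<in> cube a l"
            unfolding cube_def
          proof safe
            fix i
            have "pt q p $ i - a $ i = (of_int (p i) - real q * a $ i) / real q"
              using q(1) by (simp add: pt_def field_simps)
            then have "\<bar>pt q p $ i - a $ i\<bar> = \<bar>of_int (p i) - real q * a $ i\<bar> / real q"
              by (simp only: abs_divide abs_of_nat)
            also have "\<dots> \<le> l * real q / real q" using pl[of i] by (intro divide_right_mono) auto
            also have "\<dots> = l" using q(1) by simp
            finally show "\<bar>pt q p $ i - a $ i\<bar> \<le> l" .
          qed
          moreover have "pt q p \<in> rational_points \<alpha> \<kappa> \<delta> Q"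
            unfolding rational_points_def using q near False by (auto simp: pt_def X_def)
          ultimately obtain z where z: "z \<in> P" "pt q p \<in> cube z \<rho>" using P(3) by blast
          have "\<rho>' / real q \<le> \<rho>' / X"
            using False X \<rho>'0 by (intro divide_left_mono) auto
          also have "\<dots> = D / \<kappa> * \<rho>" using Q1 by (simp add: \<rho>'_def X_def)
          finally have "\<rho>' / real q + \<rho> \<le> D2 * \<rho>" by (simp add: D2_def algebra_simps)
          then have "x \<in> cube z (D2 * \<rho>)"
            by (rule cube_trans[OF xpt z(2)])
          then show ?thesis using z by auto
        qed
      qed
      have "l ^ d = measure lborel (cube a (l / 2))"
        using l by (simp add: measure_cube d_def)
      also have "\<dots> \<le> measure lborel (Bad \<union> (\<Union>z\<in>P. cube z (D2 * \<rho>)))"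
      proof (rule measure_mono_fmeasurable[OF cover])
        have "Bad \<in> fmeasurable lborel" unfolding Bad_def
          using finA finT by (intro fmeasurable.finite_UN) auto
        then show "Bad \<union> (\<Union>z\<in>P. cube z (D2 * \<rho>)) \<in> fmeasurable lborel"
          using finP by (intro fmeasurable.Un fmeasurable.finite_UN) auto
      qed auto
      also have "\<dots> \<le> measure lborel Bad + measure lborel (\<Union>z\<in>P. cube z (D2 * \<rho>))"
        using Bad_sets finP by (intro measure_Un_le sets.finite_UN) auto
      also have "\<dots> \<le> l ^ d / 2 + (\<Sum>z\<in>P. measure lborel (cube z (D2 * \<rho>)))"
        using finP by (intro add_mono Bad measure_UNION_le) auto
      also have "(\<Sum>z\<in>P. measure lborel (cube z (D2 * \<rho>))) = real (card P) * ((2 * D2) ^ d * \<rho> ^ d)"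
        using D2 \<rho> by (simp add: measure_cube d_def power_mult_distrib)
      finally have "\<kappa>' * l ^ d \<le> real (card P) * \<rho> ^ d"
        using D2 by (simp add: \<kappa>'_def field_simps)
      then show "\<exists>P. finite P \<and> P \<subseteq> cube a l \<inter> rational_points \<alpha> \<kappa> \<delta> Q \<and>
          (\<forall>x\<in>P. \<forall>y\<in>P. x \<noteq> y \<longrightarrow> (\<exists>i. \<rho> \<le> \<bar>x $ i - y $ i\<bar>)) \<and>
          \<kappa>' * l ^ d \<le> real (card P) * \<rho> ^ d"
        using P finP by blast
    qed
  qed
  then show ?thesis
    using \<kappa>(1) \<kappa>' unfolding d_def m_def
    by (intro exI[of _ \<kappa>] conjI exI[of _ \<kappa>'] allI impI) auto
qed

end

section \<open>Ubiquitous systems: Hausdorff measure\<close>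

lemma sum_power_le:
  fixes q :: real
  assumes "finite J" "0 \<le> q" "q < 1"
  shows "(\<Sum>j\<in>J. q ^ j) \<le> 1 / (1 - q)"
proof -
  have "(\<Sum>j\<in>J. q ^ j) \<le> (\<Sum>j. q ^ j)"
    using assms by (intro sum_le_suminf summable_geometric) auto
  then show ?thesis using assms by (simp add: suminf_geometric)
qed

lemma cube_mono: "r \<le> r' \<Longrightarrow> cube x r \<subseteq> cube x r'"
  unfolding cube_def by safe (meson order.trans)

lemma dist_le_cube:
  fixes x y :: "real ^ 'd::finite"
  assumes "x \<in> cube y r"
  shows "dist x y \<le> real CARD('d) * r"
proof -
  have "dist x y \<le> (\<Sum>i\<in>UNIV. \<bar>(x - y) $ i\<bar>)"
    unfolding dist_norm by (rule norm_le_l1_cart)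
  also have "\<dots> \<le> (\<Sum>i\<in>(UNIV :: 'd set). r)"
    using assms by (intro sum_mono) (simp add: cube_def)
  finally show ?thesis by simp
qed

lemma subset_cube_diameter:
  assumes "bounded U" "x \<in> U"
  shows "U \<subseteq> cube x (diameter U)"
proof
  fix y assume "y \<in> U"
  then have "norm (y - x) \<le> diameter U"
    using diameter_bounded_bound[OF assms(1) _ assms(2)] by (simp add: dist_norm)
  then have "\<bar>(y - x) $ i\<bar> \<le> diameter U" for i
    using component_le_norm_cart[of "y - x" i] by (rule order.trans[rotated])
  then show "y \<in> cube x (diameter U)"
    by (simp add: cube_def)
qed

text \<open>Grid cells of side \<open>\<rho>\<close> hold at most one point each, since two points
  of one cell differ by less than \<open>\<rho>\<close> in every coordinate.\<close>

lemma card_separated_le: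
  fixes x :: "real ^ 'd::finite"
  assumes "P \<subseteq> cube x t" "\<rho> > 0" "t \<ge> 0"
    and sep: "\<And>y z. y \<in> P \<Longrightarrow> z \<in> P \<Longrightarrow> y \<noteq> z \<Longrightarrow> \<exists>i. \<rho> \<le> \<bar>y $ i - z $ i\<bar>"
  shows "real (card P) \<le> (2 * t / \<rho> + 2) ^ CARD('d)"
proof -
  define f where "f = (\<lambda>(y :: real ^ 'd) i. \<lfloor>(y $ i - x $ i) / \<rho>\<rfloor>)"
  have inj: "inj_on f P"
  proof
    fix y z assume yz: "y \<in> P" "z \<in> P" "f y = f z"
    show "y = z"
    proof (rule ccontr)
      assume "y \<noteq> z"
      then obtain i where i: "\<rho> \<le> \<bar>y $ i - z $ i\<bar>" using sep yz by blast
      have "\<lfloor>(y $ i - x $ i) / \<rho>\<rfloor> = \<lfloor>(z $ i - x $ i) / \<rho>\<rfloor>"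
        using yz(3) by (simp add: f_def fun_eq_iff)
      then have "\<bar>(y $ i - x $ i) / \<rho> - (z $ i - x $ i) / \<rho>\<bar> < 1" by linarith
      then show False using i \<open>\<rho> > 0\<close>
        by (simp add: diff_divide_distrib[symmetric] abs_divide)
    qed
  qed
  have sub: "f ` P \<subseteq> (UNIV \<rightarrow>\<^sub>E {\<lfloor>- t / \<rho>\<rfloor>..\<lfloor>t / \<rho>\<rfloor>})"
  proof safe
    fix y and i :: 'd assume "y \<in> P"
    then have "\<bar>y $ i - x $ i\<bar> \<le> t" using assms(1) by (auto simp: cube_def)
    then show "f y i \<in> {\<lfloor>- t / \<rho>\<rfloor>..\<lfloor>t / \<rho>\<rfloor>}"
      using \<open>\<rho> > 0\<close> unfolding f_def atLeastAtMost_iff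
      by (intro conjI floor_mono divide_right_mono) auto
  qed auto
  have "card P = card (f ` P)" using inj by (simp add: card_image)
  also have "\<dots> \<le> card (UNIV \<rightarrow>\<^sub>E {\<lfloor>- t / \<rho>\<rfloor>..\<lfloor>t / \<rho>\<rfloor>} :: ('d \<Rightarrow> int) set)"
    by (rule card_mono[OF _ sub]) (auto intro: finite_PiE)
  also have "\<dots> = nat (\<lfloor>t / \<rho>\<rfloor> - \<lfloor>- t / \<rho>\<rfloor> + 1) ^ CARD('d)"
    by (simp add: card_PiE)
  finally have "real (card P) \<le> real (nat (\<lfloor>t / \<rho>\<rfloor> - \<lfloor>- t / \<rho>\<rfloor> + 1)) ^ CARD('d)"
    by (metis of_nat_le_iff of_nat_power)
  also have "\<dots> \<le> (2 * t / \<rho> + 2) ^ CARD('d)"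
  proof (rule power_mono)
    have "0 \<le> t / \<rho>" using assms by simp
    then show "real (nat (\<lfloor>t / \<rho>\<rfloor> - \<lfloor>- t / \<rho>\<rfloor> + 1)) \<le> 2 * t / \<rho> + 2"
      by (simp add: minus_divide_left[symmetric]) linarith
  qed auto
  finally show ?thesis .
qed

text \<open>Local ubiquity in a discretised form; up to the constant \<open>\<kappa>\<close> no \<open>\<rho> k\<close>-separated
  family in a cube can be larger.\<close>

locale ubiquitous_system =
  fixes pts :: "nat \<Rightarrow> (real ^ 'd::finite) set" and r \<rho> :: "nat \<Rightarrow> real" and K :: "nat set"
    and \<kappa> R s :: real
  assumes s: "0 < s" "s \<le> real CARD('d)" and \<kappa>: "\<kappa> > 0"
    and r_pos: "\<And>k. r k > 0" and r_half: "\<And>k. r (Suc k) \<le> r k / 2"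
    and r_le_\<rho>: "\<And>k. k \<in> K \<Longrightarrow> r k \<le> \<rho> k"
    and \<rho>_lim: "\<And>e. e > 0 \<Longrightarrow> \<exists>k0. \<forall>k\<ge>k0. k \<in> K \<longrightarrow> \<rho> k < e"
    and ubiq: "\<And>a l. 0 < l \<Longrightarrow> l \<le> 1 \<Longrightarrow> (\<And>i. \<bar>a $ i\<bar> \<le> R) \<Longrightarrow> \<exists>k0. \<forall>k\<ge>k0. k \<in> K \<longrightarrow>
       (\<exists>P. finite P \<and> P \<subseteq> cube a l \<inter> pts k \<and>
          (\<forall>x\<in>P. \<forall>y\<in>P. x \<noteq> y \<longrightarrow> (\<exists>i. \<rho> k \<le> \<bar>x $ i - y $ i\<bar>)) \<and>
          \<kappa> * l ^ CARD('d) \<le> real (card P) * \<rho> k ^ CARD('d))"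
    and diverge: "\<And>T k0. \<exists>I. finite I \<and> I \<subseteq> K \<inter> {k0..} \<and> T \<le> (\<Sum>k\<in>I. r k powr s / \<rho> k ^ CARD('d))"
begin

text \<open>Open cubes of radius \<open>2 * r k\<close> make this set open, as the nested
  neighbourhoods below require, and still contain the closed cubes of radius \<open>r k\<close> that
  will carry the mass.\<close>

definition E :: "nat \<Rightarrow> (real ^ 'd) set" where
  "E k0 = (\<Union>k\<in>K \<inter> {k0..}. \<Union>y\<in>pts k. {x. \<forall>i. \<bar>x $ i - y $ i\<bar> < 2 * r k})"

definition W :: "(real ^ 'd) set" where
  "W = (\<Inter>k. E k)"

lemma open_E: "open (E k0)"
proof -
  have "open {x. \<forall>i. \<bar>x $ i - y $ i\<bar> < 2 * r k}" for y :: "real ^ 'd" and k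
    unfolding Collect_all_eq
    by (intro open_INT finite ballI open_Collect_less continuous_intros)
  then show ?thesis unfolding E_def by auto
qed

lemma \<rho>_pos: "k \<in> K \<Longrightarrow> \<rho> k > 0"
  using r_pos r_le_\<rho> less_le_trans by blast

lemma r_geometric: "r (k + j) \<le> r k / 2 ^ j"
proof (induction j)
  case (Suc j)
  have "r (k + Suc j) \<le> r (k + j) / 2" using r_half[of "k + j"] by simp
  also have "\<dots> \<le> r k / 2 ^ j / 2" using Suc by (intro divide_right_mono) auto
  finally show ?case by simp
qed simp

text \<open>The sum is split at \<open>r k = u\<close>: small radii contribute
  \<open>r k powr s\<close>, large ones \<open>u ^ d * r k powr (s - d)\<close>. As the radii at
  least halve, either part is dominated by a geometric series starting at the radius nearest to
  \<open>u\<close>; for the second part this needs \<open>s < d\<close>.\<close>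

lemma geometric_radii_sum:
  assumes s': "s < real CARD('d)" and I: "finite I" and u: "u > 0"
  shows "(\<Sum>k\<in>I. r k powr s / r k ^ CARD('d) * min (r k) u ^ CARD('d))
     \<le> (1 / (1 - 1 / 2 powr s) + 1 / (1 - 1 / 2 powr (real CARD('d) - s))) * u powr s"
proof -
  define d where "d = CARD('d)"
  define c where "c = real d - s"
  have c: "c > 0" using s' by (simp add: c_def d_def)
  define I1 I2 where "I1 = {k\<in>I. r k \<le> u}" and "I2 = {k\<in>I. u < r k}"
  have fin: "finite I1" "finite I2" using I by (auto simp: I1_def I2_def)
  let ?t = "\<lambda>k. r k powr s / r k ^ d * min (r k) u ^ d"
  have q: "0 \<le> 1 / 2 powr e" "1 / 2 powr e < 1" if "e > 0" for e :: real
    using that by simp_all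
  have "(\<Sum>k\<in>I1. ?t k) \<le> 1 / (1 - 1 / 2 powr s) * u powr s"
  proof (cases "I1 = {}")
    case True
    then show ?thesis using q[OF s(1)] by simp
  next
    case False
    define k0 where "k0 = Min I1"
    have k0: "r k0 \<le> u" "\<And>k. k \<in> I1 \<Longrightarrow> k0 \<le> k"
      using Min_in[OF fin(1) False] fin by (auto simp: k0_def I1_def)
    have "(\<Sum>k\<in>I1. ?t k) \<le> (\<Sum>k\<in>I1. u powr s * (1 / 2 powr s) ^ (k - k0))"
    proof (rule sum_mono)
      fix k assume k: "k \<in> I1"
      have "?t k = r k powr s" using k r_pos[of k] by (simp add: I1_def min_def)
      also have "\<dots> \<le> (u / 2 ^ (k - k0)) powr s"
      proof (rule powr_mono2)
        have "r k \<le> r k0 / 2 ^ (k - k0)" using r_geometric[of k0 "k - k0"] k0(2)[OF k] by simp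
        also have "\<dots> \<le> u / 2 ^ (k - k0)" using k0 by (intro divide_right_mono) auto
        finally show "r k \<le> u / 2 ^ (k - k0)" .
      qed (use s r_pos[of k] in auto)
      also have "\<dots> = u powr s * (1 / 2 powr s) ^ (k - k0)"
        using u by (simp add: powr_divide power_one_over powr_power flip: powr_realpow) (simp add: powr_powr mult.commute)
      finally show "?t k \<le> u powr s * (1 / 2 powr s) ^ (k - k0)" .
    qed
    also have "\<dots> = u powr s * (\<Sum>j\<in>(\<lambda>k. k - k0) ` I1. (1 / 2 powr s) ^ j)"
    proof -
      have "inj_on (\<lambda>k. k - k0) I1" by (rule inj_onI) (metis k0(2) eq_diff_iff)
      then show ?thesis by (simp add: sum.reindex sum_distrib_left)
    qed
    also have "\<dots> \<le> u powr s * (1 / (1 - 1 / 2 powr s))"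
      using fin q[OF s(1)] by (intro mult_left_mono sum_power_le) auto
    finally show ?thesis by (simp add: mult.commute)
  qed
  moreover have "(\<Sum>k\<in>I2. ?t k) \<le> 1 / (1 - 1 / 2 powr c) * u powr s"
  proof (cases "I2 = {}")
    case True
    then show ?thesis using q[OF c] by simp
  next
    case False
    define k0 where "k0 = Max I2"
    have k0: "u < r k0" "\<And>k. k \<in> I2 \<Longrightarrow> k \<le> k0"
      using Max_in[OF fin(2) False] fin by (auto simp: k0_def I2_def)
    have "(\<Sum>k\<in>I2. ?t k) \<le> (\<Sum>k\<in>I2. u powr s * (1 / 2 powr c) ^ (k0 - k))"
    proof (rule sum_mono)
      fix k assume k: "k \<in> I2"
      have "?t k = r k powr (-c) * u ^ d"
        using k r_pos[of k] by (simp add: I2_def min_def c_def powr_diff powr_realpow)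
      also have "\<dots> \<le> (u * 2 ^ (k0 - k)) powr (-c) * u ^ d"
      proof (intro mult_right_mono powr_mono2')
        have "u * 2 ^ (k0 - k) \<le> r k0 * 2 ^ (k0 - k)" using k0 by (intro mult_right_mono) auto
        also have "\<dots> \<le> r k" using r_geometric[of k "k0 - k"] k0(2)[OF k] by (simp add: field_simps)
        finally show "u * 2 ^ (k0 - k) \<le> r k" .
      qed (use u c in auto)
      also have "(u * 2 ^ (k0 - k)) powr (-c) = u powr (-c) * (1 / 2 powr c) ^ (k0 - k)"
        using u by (simp add: powr_mult powr_minus power_one_over powr_power inverse_eq_divide flip: powr_realpow) (simp add: powr_powr mult.commute)
      also have "u powr (-c) * (1 / 2 powr c) ^ (k0 - k) * u ^ d = u powr s * (1 / 2 powr c) ^ (k0 - k)"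
      proof -
        have "u powr (-c) * u ^ d = u powr s" using u by (simp add: c_def flip: powr_realpow powr_add)
        then show ?thesis by (simp add: mult_ac)
      qed
      finally show "?t k \<le> u powr s * (1 / 2 powr c) ^ (k0 - k)" .
    qed
    also have "\<dots> = u powr s * (\<Sum>j\<in>(\<lambda>k. k0 - k) ` I2. (1 / 2 powr c) ^ j)"
    proof -
      have "inj_on (\<lambda>k. k0 - k) I2" by (rule inj_onI) (metis k0(2) diff_diff_cancel)
      then show ?thesis by (simp add: sum.reindex sum_distrib_left)
    qed
    also have "\<dots> \<le> u powr s * (1 / (1 - 1 / 2 powr c))"
      using fin q[OF c] by (intro mult_left_mono sum_power_le) auto
    finally show ?thesis by (simp add: mult.commute)
  qed
  moreover have "(\<Sum>k\<in>I. ?t k) = (\<Sum>k\<in>I1. ?t k) + (\<Sum>k\<in>I2. ?t k)"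
  proof -
    have "I = I1 \<union> I2" "I1 \<inter> I2 = {}" by (auto simp: I1_def I2_def)
    then show ?thesis using fin by (simp add: sum.union_disjoint)
  qed
  ultimately show ?thesis by (simp add: d_def c_def distrib_right)
qed

end

section \<open>Integrals of simple densities and the grid of cells\<close>

lemma nn_integral_weighted_indicators:
  fixes a :: "'j \<Rightarrow> real"
  assumes "finite J" and a: "\<And>j. j \<in> J \<Longrightarrow> a j \<ge> 0" and Q: "\<And>j. j \<in> J \<Longrightarrow> Q j \<in> fmeasurable M"
    and U: "U \<in> sets M"
  shows "(\<integral>\<^sup>+x\<in>U. (\<Sum>j\<in>J. ennreal (a j) * indicator (Q j) x) \<partial>M) = ennreal (\<Sum>j\<in>J. a j * measure M (Q j \<inter> U))"
proof -
  have "(\<integral>\<^sup>+x\<in>U. (\<Sum>j\<in>J. ennreal (a j) * indicator (Q j) x) \<partial>M)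
      = (\<integral>\<^sup>+x. (\<Sum>j\<in>J. ennreal (a j) * indicator (Q j \<inter> U) x) \<partial>M)"
    by (intro nn_integral_cong) (auto simp: indicator_def sum_distrib_right)
  also have "\<dots> = (\<Sum>j\<in>J. \<integral>\<^sup>+x. ennreal (a j) * indicator (Q j \<inter> U) x \<partial>M)"
    using Q U by (intro nn_integral_sum) (auto dest: fmeasurableD)
  also have "\<dots> = (\<Sum>j\<in>J. ennreal (a j * measure M (Q j \<inter> U)))"
  proof (rule sum.cong[OF refl])
    fix j assume j: "j \<in> J"
    then have m: "Q j \<inter> U \<in> fmeasurable M" using Q U by (intro fmeasurable_Int_fmeasurable) auto
    then have "(\<integral>\<^sup>+x. ennreal (a j) * indicator (Q j \<inter> U) x \<partial>M) = ennreal (a j) * emeasure M (Q j \<inter> U)"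
      by (intro nn_integral_cmult_indicator) (auto dest: fmeasurableD)
    also have "\<dots> = ennreal (a j * measure M (Q j \<inter> U))"
      using m a[OF j] by (simp add: emeasure_eq_measure2 ennreal_mult)
    finally show "(\<integral>\<^sup>+x. ennreal (a j) * indicator (Q j \<inter> U) x \<partial>M) = ennreal (a j * measure M (Q j \<inter> U))" .
  qed
  also have "\<dots> = ennreal (\<Sum>j\<in>J. a j * measure M (Q j \<inter> U))"
    using a by (intro sum_ennreal) auto
  finally show ?thesis .
qed

lemma sum_Sigma3:
  assumes "finite Z" "finite I" "\<And>z k. z \<in> Z \<Longrightarrow> k \<in> I \<Longrightarrow> finite (P z k)"
  shows "(\<Sum>j\<in>(SIGMA z:Z. SIGMA k:I. P z k). g (fst j) (fst (snd j)) (snd (snd j)))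
       = (\<Sum>z\<in>Z. \<Sum>k\<in>I. \<Sum>y\<in>P z k. g z k y)"
proof -
  have "(\<Sum>k\<in>I. \<Sum>y\<in>P z k. g z k y) = (\<Sum>q\<in>(SIGMA k:I. P z k). g z (fst q) (snd q))" if "z \<in> Z" for z
    using assms that by (subst sum.Sigma) (auto simp: case_prod_beta)
  then have "(\<Sum>z\<in>Z. \<Sum>k\<in>I. \<Sum>y\<in>P z k. g z k y)
      = (\<Sum>z\<in>Z. \<Sum>q\<in>(SIGMA k:I. P z k). g z (fst q) (snd q))"
    by (intro sum.cong refl)
  also have "\<dots> = (\<Sum>j\<in>(SIGMA z:Z. SIGMA k:I. P z k). g (fst j) (fst (snd j)) (snd (snd j)))"
    using assms by (subst sum.Sigma) (auto simp: case_prod_beta)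
  finally show ?thesis by simp
qed

text \<open>Half-open, so that the cells form a partition and their masses add up exactly.\<close>

definition cell :: "real \<Rightarrow> ('d \<Rightarrow> int) \<Rightarrow> (real ^ 'd) set" where
  "cell \<epsilon> z = {x. \<forall>i. \<epsilon> * of_int (z i) \<le> x $ i \<and> x $ i < \<epsilon> * (of_int (z i) + 1)}"

definition cell_center :: "real \<Rightarrow> ('d \<Rightarrow> int) \<Rightarrow> real ^ 'd" where
  "cell_center \<epsilon> z = (\<chi> i. \<epsilon> * (of_int (z i) + 1 / 2))"

lemma cell_iff_floor: "\<epsilon> > 0 \<Longrightarrow> x \<in> cell \<epsilon> z \<longleftrightarrow> z = (\<lambda>i. \<lfloor>x $ i / \<epsilon>\<rfloor>)"
  unfolding cell_def fun_eq_iff mem_Collect_eq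
  by (intro all_cong1) (simp add: eq_commute[of "z _"] floor_eq_iff field_simps)

lemma cell_borel: "cell \<epsilon> z \<in> sets borel" for z :: "'d::finite \<Rightarrow> int"
proof -
  have "cell \<epsilon> z = (\<Inter>i. {x. \<epsilon> * of_int (z i) \<le> x $ i} \<inter> {x. x $ i < \<epsilon> * (of_int (z i) + 1)})"
    by (auto simp: cell_def)
  also have "\<dots> \<in> sets borel"
    by (intro sets.countable_INT'' sets.Int borel_closed borel_open closed_Collect_le open_Collect_less
        continuous_intros) auto
  finally show ?thesis .
qed

lemma cell_subset_cube: "cell \<epsilon> z \<subseteq> cube (cell_center \<epsilon> z) (\<epsilon> / 2)"
proof
  fix x assume "x \<in> cell \<epsilon> z"
  then have "\<epsilon> * of_int (z i) \<le> x $ i" "x $ i < \<epsilon> * of_int (z i) + \<epsilon>" for i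
    by (simp_all add: cell_def distrib_left)
  then have "\<bar>x $ i - (\<epsilon> * of_int (z i) + \<epsilon> / 2)\<bar> \<le> \<epsilon> / 2" for i
    by (smt (verit) field_sum_of_halves)
  then show "x \<in> cube (cell_center \<epsilon> z) (\<epsilon> / 2)"
    by (simp add: cube_def cell_center_def distrib_left)
qed

lemma cell_disjoint: "\<epsilon> > 0 \<Longrightarrow> disjoint_family (cell \<epsilon>)"
  by (auto simp: disjoint_family_on_def cell_iff_floor)

lemma finite_cells:
  fixes C :: "(real ^ 'd::finite) set"
  assumes "bounded C" "\<epsilon> > 0"
  shows "finite {z. cell \<epsilon> z \<inter> C \<noteq> {}}"
proof -
  obtain B where B: "\<And>x. x \<in> C \<Longrightarrow> norm x \<le> B" using assms(1) by (auto simp: bounded_iff)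
  have "{z. cell \<epsilon> z \<inter> C \<noteq> {}} \<subseteq> (UNIV \<rightarrow>\<^sub>E {\<lfloor>- B / \<epsilon>\<rfloor>..\<lfloor>B / \<epsilon>\<rfloor>})"
  proof
    fix z assume "z \<in> {z. cell \<epsilon> z \<inter> C \<noteq> {}}"
    then obtain x where "x \<in> C" "x \<in> cell \<epsilon> z" by auto
    then have x: "x \<in> C" "z = (\<lambda>i. \<lfloor>x $ i / \<epsilon>\<rfloor>)" using assms(2) by (simp_all add: cell_iff_floor)
    have "\<bar>x $ i\<bar> \<le> B" for i using B[OF x(1)] component_le_norm_cart[of x i] by (rule order.trans[rotated])
    then have "- B \<le> x $ i \<and> x $ i \<le> B" for i by (simp add: abs_le_iff) (metis minus_le_iff)
    then have "z i \<in> {\<lfloor>- B / \<epsilon>\<rfloor>..\<lfloor>B / \<epsilon>\<rfloor>}" for i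
      unfolding x(2) atLeastAtMost_iff using assms(2) by (intro conjI floor_mono divide_right_mono) auto
    then show "z \<in> (UNIV \<rightarrow>\<^sub>E {\<lfloor>- B / \<epsilon>\<rfloor>..\<lfloor>B / \<epsilon>\<rfloor>})" by auto
  qed
  then show ?thesis by (rule finite_subset) (auto intro: finite_PiE)
qed

text \<open>Allows points chosen in different cells to be counted together: keeping them within a
  quarter of the side from the centre preserves separation across cells.\<close>

lemma cube_separated_centers:
  assumes \<epsilon>: "\<epsilon> > 0" and z: "z \<noteq> z'" and y: "y \<in> cube (cell_center \<epsilon> z) (\<epsilon> / 4)" "y' \<in> cube (cell_center \<epsilon> z') (\<epsilon> / 4)"
  shows "\<exists>i. \<epsilon> / 2 \<le> \<bar>y $ i - y' $ i\<bar>"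
proof -
  obtain i where i: "z i \<noteq> z' i" using z by (auto simp: fun_eq_iff)
  have "\<epsilon> * 1 \<le> \<epsilon> * \<bar>of_int (z i) - of_int (z' i)\<bar>"
    using i \<epsilon> by (intro mult_left_mono) linarith+
  also have "\<dots> = \<bar>\<epsilon> * (of_int (z i) - of_int (z' i))\<bar>" using \<epsilon> by (simp add: abs_mult)
  also have "\<epsilon> * (of_int (z i) - of_int (z' i)) = cell_center \<epsilon> z $ i - cell_center \<epsilon> z' $ i"
    by (simp add: cell_center_def algebra_simps)
  finally have "\<epsilon> \<le> \<bar>cell_center \<epsilon> z $ i - cell_center \<epsilon> z' $ i\<bar>" by simp
  moreover have "\<bar>y $ i - cell_center \<epsilon> z $ i\<bar> \<le> \<epsilon> / 4" "\<bar>y' $ i - cell_center \<epsilon> z' $ i\<bar> \<le> \<epsilon> / 4"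
    using y by (auto simp: cube_def)
  ultimately have "\<epsilon> / 2 \<le> \<bar>y $ i - y' $ i\<bar>" by linarith
  then show ?thesis ..
qed

section \<open>Measures with a uniform Frostman condition\<close>

context ubiquitous_system
begin

text \<open>The term in \<open>u ^ d\<close> accommodates the initial Lebesgue measure;
  \<open>\<beta>\<close> plays the role of the Frostman constant. It may be any positive number and
  is in the end chosen so that the second term dominates up to the covering scale.\<close>

definition gauge_fun :: "real \<Rightarrow> real \<Rightarrow> real \<Rightarrow> real" where
  "gauge_fun F0 \<beta> u = F0 * u ^ CARD('d) + \<beta> * u powr s"

lemma gauge_fun_nonneg: "F0 \<ge> 0 \<Longrightarrow> \<beta> \<ge> 0 \<Longrightarrow> u \<ge> 0 \<Longrightarrow> gauge_fun F0 \<beta> u \<ge> 0"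
  by (simp add: gauge_fun_def)

lemma gauge_fun_mono: "F0 \<ge> 0 \<Longrightarrow> \<beta> \<ge> 0 \<Longrightarrow> 0 \<le> u \<Longrightarrow> u \<le> v \<Longrightarrow> gauge_fun F0 \<beta> u \<le> gauge_fun F0 \<beta> v"
  using s unfolding gauge_fun_def by (intro add_mono mult_left_mono power_mono powr_mono2) auto

lemma gauge_fun_scale:
  assumes "F0 \<ge> 0" "\<beta> \<ge> 0" "u \<ge> 0" "\<theta> \<ge> 1"
  shows "gauge_fun F0 \<beta> (\<theta> * u) \<le> \<theta> ^ CARD('d) * gauge_fun F0 \<beta> u"
proof -
  have "\<theta> powr s \<le> \<theta> powr real CARD('d)" using s assms by (intro powr_mono) auto
  then have "\<theta> powr s \<le> \<theta> ^ CARD('d)" using assms by (simp add: powr_realpow)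
  then have "\<beta> * (\<theta> powr s * u powr s) \<le> \<beta> * (\<theta> ^ CARD('d) * u powr s)"
    using assms by (intro mult_left_mono mult_right_mono) auto
  then show ?thesis using assms by (simp add: gauge_fun_def powr_mult power_mult_distrib algebra_simps)
qed

text \<open>\<open>f\<close> is a probability density vanishing outside the compact set
  \<open>C\<close>. Its bound \<open>F\<close> is not tracked, because it may deteriorate at every
  step of the construction; only \<open>A\<close> has to stay bounded.\<close>

definition frostman :: "real \<Rightarrow> real \<Rightarrow> real \<Rightarrow> (real ^ 'd \<Rightarrow> ennreal) \<Rightarrow> (real ^ 'd) set \<Rightarrow> bool" where
  "frostman F0 \<beta> A f C \<longleftrightarrow> f \<in> borel_measurable borel \<and> (\<exists>F. \<forall>x. f x \<le> ennreal F) \<and>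
     compact C \<and> (\<forall>x. x \<notin> C \<longrightarrow> f x = 0) \<and> (\<integral>\<^sup>+x. f x \<partial>lborel) = 1 \<and>
     (\<forall>U. U \<in> sets borel \<longrightarrow> bounded U \<longrightarrow> (\<integral>\<^sup>+x\<in>U. f x \<partial>lborel) \<le> ennreal (A * gauge_fun F0 \<beta> (diameter U)))"

text \<open>One step of the construction: inside every cell of a fine grid, the mass of the cell is
  spread over small cubes around points of many levels \<open>k\<close>, level \<open>k\<close> receiving a share
  proportional to \<open>r k powr s / \<rho> k ^ d\<close>.  Since these weights have a large sum, sets that are
  small compared with the grid get a small mass.\<close>

lemma frostman_step:
  assumes s': "s < real CARD('d)" and f: "frostman F0 \<beta> A f C" and "F0 \<ge> 0" "\<beta> > 0" "A \<ge> 1" "\<eta> > 0"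
    and V: "open V" "C \<subseteq> V" "V \<subseteq> cube 0 R"
  shows "\<exists>f' C'. frostman F0 \<beta> (A * (1 + \<eta>)) f' C' \<and> C' \<subseteq> V \<inter> E k0"
proof -
  define d where "d = CARD('d)"
  have d: "d \<ge> 1" by (simp add: d_def Suc_leI)
  obtain F' where F': "\<And>x. f x \<le> ennreal F'" using f by (auto simp: frostman_def)
  define F where "F = max 1 F'"
  have F: "F \<ge> 1" "\<And>x. f x \<le> ennreal F"
    using order.trans[OF F' ennreal_leI[of F' F]] by (auto simp: F_def)
  have f_meas [measurable]: "f \<in> borel_measurable lborel" using f by (simp add: frostman_def)
  have C: "compact C" and f0: "\<And>x. x \<notin> C \<Longrightarrow> f x = 0" and f1: "(\<integral>\<^sup>+x. f x \<partial>lborel) = 1"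
    using f by (auto simp: frostman_def)
  define \<mu> where "\<mu> = density lborel f"
  have \<mu>: "emeasure \<mu> U = (\<integral>\<^sup>+x\<in>U. f x \<partial>lborel)" if "U \<in> sets borel" for U
    using that by (simp add: \<mu>_def emeasure_density)
  have \<mu>_sets: "sets \<mu> = sets borel" by (simp add: \<mu>_def)
  have \<mu>_gauge: "emeasure \<mu> U \<le> ennreal (A * gauge_fun F0 \<beta> (diameter U))" if "U \<in> sets borel" "bounded U" for U
    using f that by (simp add: frostman_def \<mu>)
  have \<mu>_F: "emeasure \<mu> U \<le> ennreal F * emeasure lborel U" if "U \<in> sets borel" for U
  proof -
    have "emeasure \<mu> U \<le> (\<integral>\<^sup>+x. ennreal F * indicator U x \<partial>lborel)"
      unfolding \<mu>[OF that] using F(2) by (intro nn_integral_mono mult_right_mono) auto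
    then show ?thesis using that by (simp add: nn_integral_cmult_indicator)
  qed
  obtain e where e: "e > 0" "(\<Union>x\<in>C. ball x e) \<subseteq> V"
    using compact_subset_open_imp_ball_epsilon_subset[OF C V(1,2)] by blast
  \<comment> \<open>The factor \<open>32 ^ d\<close> collects \<open>4 ^ d\<close> from using only
    cubes of radius \<open>\<epsilon> / 4\<close> and \<open>8 ^ d\<close> from counting the
    separated centres.\<close>
  define C1 where "C1 = 32 ^ d / \<kappa>"
  have C1: "C1 > 0" using \<kappa> by (simp add: C1_def)
  define Cg where "Cg = 1 / (1 - 1 / 2 powr s) + 1 / (1 - 1 / 2 powr (real d - s))"
  have Cg: "Cg > 0" using s s' by (auto simp: Cg_def d_def intro!: add_pos_pos)
  \<comment> \<open>The critical diameter. Below \<open>u0\<close> the new mass is estimated by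
    counting cubes, and \<open>F * C1 * u ^ d\<close> is at most half of
    \<open>\<beta> * u powr s\<close>; from \<open>u0\<close> on the bound for the old measure is
    inherited.\<close>
  define u0 where "u0 = (\<beta> / (2 * F * C1)) powr (1 / (real d - s))"
  have u0: "u0 > 0" "F * C1 * u0 powr (real d - s) = \<beta> / 2"
    using \<open>\<beta> > 0\<close> F C1 s' by (auto simp: u0_def powr_powr d_def)
  \<comment> \<open>Stretching diameters by \<open>\<theta>\<close> costs at most
    \<open>\<theta> ^ d = 1 + \<eta>\<close> in the gauge, exactly the loss that this step may
    cause.\<close>
  define \<theta> where "\<theta> = root d (1 + \<eta>)"
  have \<theta>: "\<theta> > 1" "\<theta> ^ d = 1 + \<eta>" using d \<open>\<eta> > 0\<close> by (auto simp: \<theta>_def)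
  \<comment> \<open>The grid is so fine that adding nearby cells to a set of diameter at least
    \<open>u0\<close> stretches its diameter by at most \<open>\<theta>\<close>, and that all new
    cubes stay inside \<open>V\<close>.\<close>
  define \<epsilon> where "\<epsilon> = min 1 (min ((\<theta> - 1) * u0 / (2 * d)) (e / (3 * d)))"
  have \<epsilon>: "\<epsilon> > 0" using \<theta> u0 e d by (auto simp: \<epsilon>_def)
  have \<epsilon>1: "\<epsilon> \<le> 1" and \<epsilon>u: "2 * real d * \<epsilon> \<le> (\<theta> - 1) * u0" and \<epsilon>e: "real d * \<epsilon> < e"
  proof -
    show "\<epsilon> \<le> 1" by (simp add: \<epsilon>_def)
    have "\<epsilon> \<le> (\<theta> - 1) * u0 / (2 * d)" "\<epsilon> \<le> e / (3 * d)" by (simp_all add: \<epsilon>_def)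
    then show "2 * real d * \<epsilon> \<le> (\<theta> - 1) * u0" "real d * \<epsilon> < e" using d e(1) by (auto simp: field_simps)
  qed
  have near_C: "p \<in> V" if "x \<in> C" "p \<in> cube x \<epsilon>" for x p
  proof -
    have "dist p x \<le> real d * \<epsilon>" using dist_le_cube[OF that(2)] by (simp add: d_def)
    then have "p \<in> ball x e" using \<epsilon>e by (simp add: dist_commute)
    then show ?thesis using e(2) that(1) by blast
  qed
  let ?c = "cell_center \<epsilon>"
  define Z where "Z = {z. cell \<epsilon> z \<inter> C \<noteq> {}}"
  have finZ: "finite Z" unfolding Z_def by (rule finite_cells[OF compact_imp_bounded[OF C] \<epsilon>])
  have Z_center: "\<exists>x\<in>C. ?c z \<in> cube x (\<epsilon> / 2)" if z: "z \<in> Z" for z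
  proof -
    obtain x where x: "x \<in> C" "x \<in> cell \<epsilon> z" using z by (auto simp: Z_def)
    then have "?c z \<in> cube x (\<epsilon> / 2)"
      using cell_subset_cube[of \<epsilon> z] by (auto simp: cube_def abs_minus_commute)
    then show ?thesis using x by blast
  qed
  define m where "m = (\<lambda>z. enn2real (emeasure \<mu> (cell \<epsilon> z)))"
  have m: "emeasure \<mu> (cell \<epsilon> z) = ennreal (m z)" and m_le: "m z \<le> F * \<epsilon> ^ d" and m_nonneg: "m z \<ge> 0" for z
  proof -
    have "emeasure \<mu> (cell \<epsilon> z) \<le> ennreal F * emeasure lborel (cell \<epsilon> z)" by (rule \<mu>_F[OF cell_borel])
    also have "\<dots> \<le> ennreal F * emeasure lborel (cube (?c z) (\<epsilon> / 2))"
      by (intro mult_left_mono emeasure_mono cell_subset_cube) auto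
    also have "emeasure lborel (cube (?c z) (\<epsilon> / 2)) = ennreal (\<epsilon> ^ d)"
      using measure_cube[of "\<epsilon> / 2" "?c z"] \<epsilon> by (simp add: emeasure_eq_measure2 d_def)
    also have "ennreal F * ennreal (\<epsilon> ^ d) = ennreal (F * \<epsilon> ^ d)"
      using F by (simp add: ennreal_mult' )
    finally have le: "emeasure \<mu> (cell \<epsilon> z) \<le> ennreal (F * \<epsilon> ^ d)" .
    then have "emeasure \<mu> (cell \<epsilon> z) < \<infinity>" by (simp add: le_less_trans)
    then show m: "emeasure \<mu> (cell \<epsilon> z) = ennreal (m z)" by (simp add: m_def)
    show "m z \<ge> 0" by (simp add: m_def)
    show "m z \<le> F * \<epsilon> ^ d" using le F \<epsilon> unfolding m by (subst (asm) ennreal_le_iff) auto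
  qed
  have sum_m: "ennreal (\<Sum>z\<in>Z'. m z) = emeasure \<mu> (\<Union>z\<in>Z'. cell \<epsilon> z)" if "Z' \<subseteq> Z" for Z'
  proof -
    have "(\<Sum>z\<in>Z'. emeasure \<mu> (cell \<epsilon> z)) = emeasure \<mu> (\<Union>z\<in>Z'. cell \<epsilon> z)"
    proof (rule sum_emeasure)
      show "finite Z'" using that finZ by (rule finite_subset)
      show "disjoint_family_on (cell \<epsilon>) Z'"
        by (rule disjoint_family_on_mono[OF subset_UNIV cell_disjoint[OF \<epsilon>]])
    qed (auto simp: \<mu>_sets cell_borel)
    then show ?thesis using m_nonneg by (simp add: m sum_ennreal)
  qed
  have m1: "(\<Sum>z\<in>Z. m z) = 1"
  proof -
    have sub: "C \<subseteq> (\<Union>z\<in>Z. cell \<epsilon> z)"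
    proof
      fix x assume "x \<in> C"
      then show "x \<in> (\<Union>z\<in>Z. cell \<epsilon> z)"
        using cell_iff_floor[OF \<epsilon>, of x "\<lambda>i. \<lfloor>x $ i / \<epsilon>\<rfloor>"] by (auto simp: Z_def)
    qed
    have "ennreal (\<Sum>z\<in>Z. m z) = (\<integral>\<^sup>+x\<in>(\<Union>z\<in>Z. cell \<epsilon> z). f x \<partial>lborel)"
    proof -
      have "(\<Union>z\<in>Z. cell \<epsilon> z) \<in> sets borel" using finZ cell_borel by (intro sets.finite_UN) auto
      from sum_m[of Z] \<mu>[OF this] show ?thesis by simp
    qed
    also have "\<dots> = (\<integral>\<^sup>+x. f x \<partial>lborel)"
      using f0 sub by (intro nn_integral_cong) (auto simp: indicator_def)
    finally have "ennreal (\<Sum>z\<in>Z. m z) = ennreal 1" using f1 by simp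
    then show ?thesis using m_nonneg by (subst (asm) ennreal_inj) (auto intro: sum_nonneg)
  qed
  have "\<exists>k0. \<forall>k\<ge>k0. k \<in> K \<longrightarrow> (\<exists>P. finite P \<and> P \<subseteq> cube (?c z) (\<epsilon> / 4) \<inter> pts k \<and>
          (\<forall>x\<in>P. \<forall>y\<in>P. x \<noteq> y \<longrightarrow> (\<exists>i. \<rho> k \<le> \<bar>x $ i - y $ i\<bar>)) \<and>
          \<kappa> * (\<epsilon> / 4) ^ d \<le> real (card P) * \<rho> k ^ d)" if "z \<in> Z" for z
    unfolding d_def
  proof (rule ubiq)
    show "\<bar>?c z $ i\<bar> \<le> R" for i
    proof -
      obtain x where x: "x \<in> C" "?c z \<in> cube x (\<epsilon> / 2)" using Z_center[OF \<open>z \<in> Z\<close>] by blast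
      then have "?c z \<in> V" using near_C cube_mono[of "\<epsilon> / 2" \<epsilon> x] \<epsilon> by auto
      then have "?c z \<in> cube 0 R" using V(3) by blast
      then show ?thesis by (simp add: cube_def)
    qed
  qed (use \<epsilon> \<epsilon>1 in auto)
  then obtain kz where kz: "\<And>z k. z \<in> Z \<Longrightarrow> k \<ge> kz z \<Longrightarrow> k \<in> K \<Longrightarrow> (\<exists>P. finite P \<and> P \<subseteq> cube (?c z) (\<epsilon> / 4) \<inter> pts k \<and>
          (\<forall>x\<in>P. \<forall>y\<in>P. x \<noteq> y \<longrightarrow> (\<exists>i. \<rho> k \<le> \<bar>x $ i - y $ i\<bar>)) \<and>
          \<kappa> * (\<epsilon> / 4) ^ d \<le> real (card P) * \<rho> k ^ d)"
    by metis
  obtain k\<rho> where k\<rho>: "\<And>k. k \<ge> k\<rho> \<Longrightarrow> k \<in> K \<Longrightarrow> \<rho> k < \<epsilon> / 4" using \<rho>_lim[of "\<epsilon> / 4"] \<epsilon> by auto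
  define k1 where "k1 = Max (insert k0 (insert k\<rho> (kz ` Z)))"
  have k1: "k0 \<le> k1" "k\<rho> \<le> k1" "\<And>z. z \<in> Z \<Longrightarrow> kz z \<le> k1"
    unfolding k1_def by (rule Max_ge; use finZ in simp)+
  define \<Psi> where "\<Psi> = (\<lambda>k. r k powr s / \<rho> k ^ d)"
  \<comment> \<open>The large sum of weights makes the \<open>Cg\<close>-term, which comes from the
    bounded number of cubes that even a tiny set may meet at each level, at most half of
    \<open>\<beta> * u powr s\<close>.\<close>
  obtain I where I: "finite I" "I \<subseteq> K \<inter> {k1..}" and TI: "max 1 (2 * F * C1 * Cg / \<beta>) \<le> (\<Sum>k\<in>I. \<Psi> k)"
    using diverge[of k1 "max 1 (2 * F * C1 * Cg / \<beta>)"] unfolding \<Psi>_def d_def by blast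
  define T where "T = (\<Sum>k\<in>I. \<Psi> k)"
  have T: "T \<ge> 1" "2 * F * C1 * Cg / \<beta> \<le> T" using TI by (auto simp: T_def)
  have Ik: "k \<in> K" "k0 \<le> k" "\<rho> k > 0" "r k \<le> \<rho> k" "\<rho> k < \<epsilon> / 4" if "k \<in> I" for k
  proof -
    have k: "k \<in> K" "k1 \<le> k" using I(2) that by auto
    then show "k \<in> K" "k0 \<le> k" "\<rho> k > 0" "r k \<le> \<rho> k" "\<rho> k < \<epsilon> / 4"
      using k1(1,2) k\<rho>[of k] \<rho>_pos r_le_\<rho> by simp_all
  qed
  define GP where "GP = (\<lambda>z k P. finite P \<and> P \<subseteq> cube (?c z) (\<epsilon> / 4) \<inter> pts k \<and>
          (\<forall>x\<in>P. \<forall>y\<in>P. x \<noteq> y \<longrightarrow> (\<exists>i. \<rho> k \<le> \<bar>x $ i - y $ i\<bar>)) \<and>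
          \<kappa> * (\<epsilon> / 4) ^ d \<le> real (card P) * \<rho> k ^ d)"
  have "\<exists>P. GP z k P" if "z \<in> Z" "k \<in> I" for z k
  proof -
    have "k \<in> K" "kz z \<le> k" using I(2) that(2) k1(3)[OF that(1)] by auto
    then show ?thesis unfolding GP_def by (rule kz[OF that(1), rotated])
  qed
  then obtain P where GP: "\<And>z k. z \<in> Z \<Longrightarrow> k \<in> I \<Longrightarrow> GP z k (P z k)" by metis
  have P: "finite (P z k)" "P z k \<subseteq> cube (?c z) (\<epsilon> / 4)" "P z k \<subseteq> pts k"
      "\<And>x y. x \<in> P z k \<Longrightarrow> y \<in> P z k \<Longrightarrow> x \<noteq> y \<Longrightarrow> \<exists>i. \<rho> k \<le> \<bar>x $ i - y $ i\<bar>"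
      "\<kappa> * (\<epsilon> / 4) ^ d \<le> real (card (P z k)) * \<rho> k ^ d" if "z \<in> Z" "k \<in> I" for z k
    using GP[OF that] unfolding GP_def by auto
  have cardP: "real (card (P z k)) > 0" if "z \<in> Z" "k \<in> I" for z k
  proof -
    have "0 < \<kappa> * (\<epsilon> / 4) ^ d" using \<kappa> \<epsilon> by simp
    also have "\<dots> \<le> real (card (P z k)) * \<rho> k ^ d" by (rule P(5)[OF that])
    finally show ?thesis using Ik(3)[OF that(2)] by (simp add: zero_less_mult_iff)
  qed
  \<comment> \<open>The mass of the cell times the share of level \<open>k\<close>, divided by the
    number of the cubes and by the volume \<open>(2 * r k) ^ d\<close> of each.\<close>
  define a where "a = (\<lambda>z k. m z * (\<Psi> k / T) / (real (card (P z k)) * (2 * r k) ^ d))"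
  have \<Psi>0: "\<Psi> k \<ge> 0" if "k \<in> I" for k using Ik(3)[OF that] by (simp add: \<Psi>_def)
  have a0: "a z k \<ge> 0" if "k \<in> I" for z k
    using m_nonneg \<Psi>0[OF that] T r_pos[of k] by (simp add: a_def)
  define J where "J = (SIGMA z:Z. SIGMA k:I. P z k)"
  have finJ: "finite J" unfolding J_def using finZ I P(1) by (intro finite_SigmaI) auto
  define f' where "f' = (\<lambda>x. \<Sum>j\<in>J. ennreal (a (fst j) (fst (snd j))) * indicator (cube (snd (snd j)) (r (fst (snd j)))) x)"
  define C' where "C' = (\<Union>j\<in>J. cube (snd (snd j)) (r (fst (snd j))))"
  have int_f': "(\<integral>\<^sup>+x\<in>U. f' x \<partial>lborel) = ennreal (\<Sum>z\<in>Z. \<Sum>k\<in>I. \<Sum>y\<in>P z k. a z k * measure lborel (cube y (r k) \<inter> U))"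
    if "U \<in> sets borel" for U
  proof -
    have "(\<integral>\<^sup>+x\<in>U. f' x \<partial>lborel) = ennreal (\<Sum>j\<in>J. a (fst j) (fst (snd j)) * measure lborel (cube (snd (snd j)) (r (fst (snd j))) \<inter> U))"
      unfolding f'_def
    proof (rule nn_integral_weighted_indicators[OF finJ])
      show "0 \<le> a (fst j) (fst (snd j))" if "j \<in> J" for j using that a0 by (auto simp: J_def)
    qed (use that in auto)
    also have "(\<Sum>j\<in>J. a (fst j) (fst (snd j)) * measure lborel (cube (snd (snd j)) (r (fst (snd j))) \<inter> U))
      = (\<Sum>z\<in>Z. \<Sum>k\<in>I. \<Sum>y\<in>P z k. a z k * measure lborel (cube y (r k) \<inter> U))"
      unfolding J_def using finZ I P(1)
      by (intro sum_Sigma3[where g = "\<lambda>z k y. a z k * measure lborel (cube y (r k) \<inter> U)"]) auto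
    finally show ?thesis .
  qed
  have level_sum: "(\<Sum>k\<in>I. m z * (\<Psi> k / T)) = m z" for z
  proof -
    have "(\<Sum>k\<in>I. m z * (\<Psi> k / T)) = m z * (T / T)"
      by (simp only: T_def sum_distrib_left sum_divide_distrib)
    then show ?thesis using T(1) by simp
  qed
  have full: "(\<Sum>z\<in>Z. \<Sum>k\<in>I. \<Sum>y\<in>P z k. a z k * (2 * r k) ^ d) = 1"
  proof -
    have "(\<Sum>y\<in>P z k. a z k * (2 * r k) ^ d) = m z * (\<Psi> k / T)" if "z \<in> Z" "k \<in> I" for z k
      using cardP[OF that] r_pos[of k] by (simp add: a_def)
    then have "(\<Sum>z\<in>Z. \<Sum>k\<in>I. \<Sum>y\<in>P z k. a z k * (2 * r k) ^ d) = (\<Sum>z\<in>Z. \<Sum>k\<in>I. m z * (\<Psi> k / T))"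
      by (intro sum.cong refl) auto
    also have "\<dots> = 1" unfolding level_sum by (rule m1)
    finally show ?thesis .
  qed
  have P_near: "\<exists>x\<in>C. p \<in> cube x \<epsilon>" "p \<in> cube (?c z) (\<epsilon> / 2)"
    if "z \<in> Z" "k \<in> I" "y \<in> P z k" "p \<in> cube y (r k)" for z k y p
  proof -
    have "y \<in> cube (?c z) (\<epsilon> / 4)" using P(2) that by blast
    then show 1: "p \<in> cube (?c z) (\<epsilon> / 2)"
      by (rule cube_trans[OF that(4)]) (use Ik[OF that(2)] in linarith)
    show "\<exists>x\<in>C. p \<in> cube x \<epsilon>"
      using Z_center[OF that(1)] cube_trans[OF 1, of _ "\<epsilon> / 2" \<epsilon>] by auto
  qed
  have small: "(\<Sum>z\<in>Z. \<Sum>k\<in>I. \<Sum>y\<in>P z k. a z k * measure lborel (cube y (r k) \<inter> U)) \<le> \<beta> * u powr s"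
    if U: "U \<in> sets borel" "bounded U" and u: "u = diameter U" "u < u0" for U u
  proof (cases "U = {} \<or> u = 0")
    case True
    \<comment> \<open>A set of diameter 0 is contained in a point, a cube of radius 0.\<close>
    have "measure lborel (cube y t \<inter> U) = 0" for y t
    proof (cases "U = {}")
      case False
      then obtain x0 where x0: "x0 \<in> U" by blast
      have "cube y t \<inter> U \<subseteq> cube x0 0" using subset_cube_diameter[OF U(2) x0] True u False by auto
      then have "measure lborel (cube y t \<inter> U) \<le> measure lborel (cube x0 0)"
        using U by (intro measure_mono_fmeasurable) auto
      also have "\<dots> = 0" by (subst measure_cube) auto
      finally show ?thesis by (simp add: measure_le_0_iff)
    qed simp
    then show ?thesis using \<open>\<beta> > 0\<close> by simp
  next
    case False
    then obtain x0 where x0: "x0 \<in> U" by blast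
    have U_sub: "U \<subseteq> cube x0 u" using subset_cube_diameter[OF U(2) x0] u by simp
    have u_pos: "u > 0" using False u diameter_ge_0[OF U(2)] by linarith
    \<comment> \<open>At level \<open>k\<close> the set \<open>U\<close> meets at most
      \<open>8 ^ d * ((u / \<rho> k) ^ d + 1)\<close> cubes, by separation of their centres across
      all cells, and each of them in volume at most \<open>(2 * min (r k) u) ^ d\<close>.\<close>
    have level: "(\<Sum>z\<in>Z. \<Sum>y\<in>P z k. a z k * measure lborel (cube y (r k) \<inter> U))
       \<le> F * C1 * (\<Psi> k / T * u ^ d + (r k powr s / r k ^ d * min (r k) u ^ d) / T)" if k: "k \<in> I" for k
    proof -
      define \<alpha> where "\<alpha> = F * 4 ^ d / \<kappa> * (\<Psi> k / T) * \<rho> k ^ d / (2 * r k) ^ d"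
      have \<alpha>0: "\<alpha> \<ge> 0" using F \<kappa> \<Psi>0[OF k] T Ik(3)[OF k] r_pos[of k] by (simp add: \<alpha>_def)
      have a_le: "a z k \<le> \<alpha>" if z: "z \<in> Z" for z
      proof -
        have "m z / real (card (P z k)) \<le> F * \<epsilon> ^ d / real (card (P z k))"
          using m_le cardP[OF z k] by (intro divide_right_mono) auto
        also have "\<dots> \<le> F * 4 ^ d / \<kappa> * \<rho> k ^ d"
        proof -
          have "F * (\<kappa> * \<epsilon> ^ d) \<le> F * (4 ^ d * (real (card (P z k)) * \<rho> k ^ d))"
            using P(5)[OF z k] F(1) by (intro mult_left_mono) (auto simp: power_divide field_simps)
          then show ?thesis using cardP[OF z k] \<kappa> by (simp add: field_simps)
        qed
        finally have "m z / real (card (P z k)) * (\<Psi> k / T / (2 * r k) ^ d) \<le> F * 4 ^ d / \<kappa> * \<rho> k ^ d * (\<Psi> k / T / (2 * r k) ^ d)"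
          using \<Psi>0[OF k] T r_pos[of k] by (intro mult_right_mono) auto
        then show ?thesis by (simp add: a_def \<alpha>_def mult_ac)
      qed
      define M where "M = 2 ^ d * min (r k) u ^ d"
      have meas_le: "measure lborel (cube y (r k) \<inter> U) \<le> M" for y
      proof -
        have "measure lborel (cube y (r k) \<inter> U) \<le> measure lborel (cube y (r k))"
          "measure lborel (cube y (r k) \<inter> U) \<le> measure lborel (cube x0 u)"
          using U U_sub by (intro measure_mono_fmeasurable; auto)+
        then show ?thesis using u_pos r_pos[of k]
          by (simp add: measure_cube M_def min_def d_def power_mult_distrib)
      qed
      define Y where "Y = (\<lambda>z. {y\<in>P z k. cube y (r k) \<inter> U \<noteq> {}})"
      have finY: "finite (Y z)" if "z \<in> Z" for z using P(1)[OF that k] by (simp add: Y_def)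
      have Y_sep: "\<exists>i. \<rho> k \<le> \<bar>y $ i - y' $ i\<bar>" if z: "z \<in> Z" "z' \<in> Z" and y: "y \<in> Y z" "y' \<in> Y z'" "y \<noteq> y' \<or> z \<noteq> z'" for y y' z z'
      proof (cases "z = z'")
        case True
        then show ?thesis using P(4)[OF z(1) k] y by (auto simp: Y_def)
      next
        case False
        have "y \<in> cube (?c z) (\<epsilon> / 4)" "y' \<in> cube (?c z') (\<epsilon> / 4)" using P(2) z k y by (auto simp: Y_def)
        from cube_separated_centers[OF \<epsilon> False this] obtain i where "\<epsilon> / 2 \<le> \<bar>y $ i - y' $ i\<bar>" ..
        moreover have "\<rho> k \<le> \<epsilon> / 2" using Ik(5)[OF k] \<epsilon> by linarith
        ultimately have "\<rho> k \<le> \<bar>y $ i - y' $ i\<bar>" by linarith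
        then show ?thesis ..
      qed
      have disj: "Y z \<inter> Y z' = {}" if "z \<in> Z" "z' \<in> Z" "z \<noteq> z'" for z z'
        using Y_sep[OF that(1,2)] that(3) Ik(3)[OF k] by (fastforce simp: not_le)
      have cardY: "real (card (\<Union>z\<in>Z. Y z)) \<le> 8 ^ d * ((u / \<rho> k) ^ d + 1)"
      proof -
        have "real (card (\<Union>z\<in>Z. Y z)) \<le> (2 * (u + r k) / \<rho> k + 2) ^ d"
          unfolding d_def
        proof (rule card_separated_le)
          show "(\<Union>z\<in>Z. Y z) \<subseteq> cube x0 (u + r k)"
          proof safe
            fix z y assume "z \<in> Z" "y \<in> Y z"
            then obtain p where p: "p \<in> cube y (r k)" "p \<in> U" by (auto simp: Y_def)
            then have "y \<in> cube p (r k)" by (auto simp: cube_def abs_minus_commute)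
            then show "y \<in> cube x0 (u + r k)" by (rule cube_trans) (use p U_sub in auto)
          qed
          show "0 < \<rho> k" "0 \<le> u + r k" using Ik(3)[OF k] u_pos r_pos[of k] by auto
        qed (use Y_sep in blast)
        also have "\<dots> \<le> (8 * max (u / \<rho> k) 1) ^ d"
        proof (rule power_mono)
          have "r k / \<rho> k \<le> 1" using Ik[OF k] by simp
          moreover have "2 * (u + r k) / \<rho> k = 2 * (u / \<rho> k) + 2 * (r k / \<rho> k)" by (simp add: add_divide_distrib)
          ultimately show "2 * (u + r k) / \<rho> k + 2 \<le> 8 * max (u / \<rho> k) 1" by linarith
          show "0 \<le> 2 * (u + r k) / \<rho> k + 2" using Ik(3)[OF k] u_pos r_pos[of k] by simp
        qed
        also have "\<dots> \<le> 8 ^ d * ((u / \<rho> k) ^ d + 1)"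
          using Ik(3)[OF k] u_pos by (auto simp: power_mult_distrib max_def)
        finally show ?thesis .
      qed
      have "(\<Sum>z\<in>Z. \<Sum>y\<in>P z k. a z k * measure lborel (cube y (r k) \<inter> U))
         = (\<Sum>z\<in>Z. \<Sum>y\<in>Y z. a z k * measure lborel (cube y (r k) \<inter> U))"
        using P(1)[OF _ k] by (intro sum.cong refl sum.mono_neutral_right) (auto simp: Y_def)
      also have "\<dots> \<le> (\<Sum>z\<in>Z. \<Sum>y\<in>Y z. \<alpha> * M)"
        using a_le meas_le \<alpha>0 by (intro sum_mono mult_mono) auto
      also have "\<dots> = \<alpha> * M * real (\<Sum>z\<in>Z. card (Y z))" by (simp add: sum_distrib_left mult_ac)
      also have "(\<Sum>z\<in>Z. card (Y z)) = card (\<Union>z\<in>Z. Y z)"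
        using finZ finY disj by (intro card_UN_disjoint[symmetric]) auto
      also have "\<alpha> * M * real (card (\<Union>z\<in>Z. Y z)) \<le> \<alpha> * M * (8 ^ d * ((u / \<rho> k) ^ d + 1))"
        using cardY \<alpha>0 u_pos r_pos[of k] by (intro mult_left_mono) (auto simp: M_def)
      also have "\<dots> = F * C1 * (\<Psi> k / T * u ^ d * (min (r k) u ^ d / r k ^ d) + \<Psi> k * \<rho> k ^ d / r k ^ d * min (r k) u ^ d / T)"
      proof -
        have "(32::real) ^ d = 4 ^ d * 8 ^ d" by (simp flip: power_mult_distrib)
        then show ?thesis
          using Ik(3)[OF k] r_pos[of k] \<kappa> T
          by (simp add: \<alpha>_def M_def C1_def power_mult_distrib power_divide field_simps)
      qed
      also have "\<dots> \<le> F * C1 * (\<Psi> k / T * u ^ d * 1 + r k powr s / r k ^ d * min (r k) u ^ d / T)"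
      proof (intro mult_left_mono add_mono)
        have "min (r k) u ^ d \<le> r k ^ d" using u_pos r_pos[of k] by (intro power_mono) auto
        then show "min (r k) u ^ d / r k ^ d \<le> 1" using r_pos[of k] by simp
        show "\<Psi> k * \<rho> k ^ d / r k ^ d * min (r k) u ^ d / T \<le> r k powr s / r k ^ d * min (r k) u ^ d / T"
          using Ik(3)[OF k] by (simp add: \<Psi>_def)
      qed (use F C1 u_pos \<Psi>0[OF k] T in auto)
      finally show ?thesis by simp
    qed
    have "(\<Sum>z\<in>Z. \<Sum>k\<in>I. \<Sum>y\<in>P z k. a z k * measure lborel (cube y (r k) \<inter> U))
      = (\<Sum>k\<in>I. \<Sum>z\<in>Z. \<Sum>y\<in>P z k. a z k * measure lborel (cube y (r k) \<inter> U))" by (rule sum.swap)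
    also have "\<dots> \<le> (\<Sum>k\<in>I. F * C1 * (\<Psi> k / T * u ^ d + (r k powr s / r k ^ d * min (r k) u ^ d) / T))"
      by (rule sum_mono) (rule level)
    also have "\<dots> = F * C1 * ((\<Sum>k\<in>I. \<Psi> k) / T * u ^ d + (\<Sum>k\<in>I. r k powr s / r k ^ d * min (r k) u ^ d) / T)"
      by (simp add: sum_distrib_left sum_distrib_right sum_divide_distrib sum.distrib distrib_left)
    also have "\<dots> \<le> F * C1 * (1 * u ^ d + Cg * u powr s / T)"
      using geometric_radii_sum[OF s' I(1) u_pos] F C1 T
      by (intro mult_left_mono add_mono divide_right_mono) (auto simp: T_def[symmetric] d_def Cg_def)
    also have "\<dots> = F * C1 * u powr (real d - s) * u powr s + F * C1 * Cg / T * u powr s"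
      using u_pos by (simp add: distrib_left powr_diff powr_realpow)
    also have "\<dots> \<le> \<beta> / 2 * u powr s + \<beta> / 2 * u powr s"
    proof (intro add_mono mult_right_mono)
      have "u powr (real d - s) \<le> u0 powr (real d - s)" using u u_pos s' by (intro powr_mono2) (auto simp: d_def)
      then have "F * C1 * u powr (real d - s) \<le> F * C1 * u0 powr (real d - s)"
        using F C1 by (intro mult_left_mono) auto
      then show "F * C1 * u powr (real d - s) \<le> \<beta> / 2" using u0(2) by simp
      show "F * C1 * Cg / T \<le> \<beta> / 2" using T \<open>\<beta> > 0\<close> by (simp add: field_simps)
    qed auto
    finally show ?thesis by simp
  qed
  \<comment> \<open>Every cell passes its total mass on, so \<open>U\<close> receives at most the
    old mass of the cells whose cubes it meets; their union \<open>X\<close> has diameter at most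
    \<open>\<theta> * u\<close>.\<close>
  have large: "ennreal (\<Sum>z\<in>Z. \<Sum>k\<in>I. \<Sum>y\<in>P z k. a z k * measure lborel (cube y (r k) \<inter> U))
      \<le> ennreal (A * (1 + \<eta>) * gauge_fun F0 \<beta> u)"
    if U: "U \<in> sets borel" "bounded U" and u: "u = diameter U" "u0 \<le> u" for U u
  proof -
    define Z' where "Z' = {z\<in>Z. \<exists>k\<in>I. \<exists>y\<in>P z k. cube y (r k) \<inter> U \<noteq> {}}"
    define X where "X = (\<Union>z\<in>Z'. cell \<epsilon> z)"
    have X_sets: "X \<in> sets borel" unfolding X_def using finZ cell_borel by (intro sets.finite_UN) (auto simp: Z'_def)
    have near_U: "\<exists>p\<in>U. dist x p \<le> real d * \<epsilon>" if x: "x \<in> X" for x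
    proof -
      obtain z k y p where z: "z \<in> Z" "x \<in> cell \<epsilon> z" "k \<in> I" "y \<in> P z k" "p \<in> cube y (r k)" "p \<in> U"
        using x by (auto simp: X_def Z'_def)
      have "?c z \<in> cube p (\<epsilon> / 2)" using P_near(2)[OF z(1,3,4,5)] by (auto simp: cube_def abs_minus_commute)
      then have "x \<in> cube p \<epsilon>"
        using cell_subset_cube z(2) by (intro cube_trans[of x "?c z" "\<epsilon> / 2" p "\<epsilon> / 2"]) auto
      then show ?thesis using dist_le_cube[of x p \<epsilon>] z(6) by (auto simp: d_def)
    qed
    have dX: "dist x x' \<le> u + 2 * real d * \<epsilon>" if x: "x \<in> X" "x' \<in> X" for x x'
    proof -
      obtain p p' where p: "p \<in> U" "dist x p \<le> real d * \<epsilon>" "p' \<in> U" "dist x' p' \<le> real d * \<epsilon>"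
        using near_U[OF x(1)] near_U[OF x(2)] by blast
      have "dist p p' \<le> u" using diameter_bounded_bound[OF U(2) p(1,3)] u by simp
      moreover have "dist x x' \<le> dist x p + dist p p' + dist x' p'"
        using dist_triangle[of x x' p] dist_triangle[of p x' p'] by (simp add: dist_commute)
      ultimately show ?thesis using p by linarith
    qed
    have X_bounded: "bounded X"
    proof (cases "X = {}")
      case False
      then show ?thesis using dX unfolding bounded_def by blast
    qed simp
    have "diameter X \<le> u + 2 * real d * \<epsilon>"
      using dX u u0 d \<epsilon> by (intro diameter_le) (auto simp: dist_norm)
    also have "\<dots> \<le> \<theta> * u"
    proof -
      have "2 * real d * \<epsilon> \<le> (\<theta> - 1) * u" using \<epsilon>u u(2) \<theta>(1) by (smt (verit) mult_left_mono)
      then show ?thesis by (simp add: algebra_simps)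
    qed
    finally have diamX: "diameter X \<le> \<theta> * u" .
    have "(\<Sum>z\<in>Z. \<Sum>k\<in>I. \<Sum>y\<in>P z k. a z k * measure lborel (cube y (r k) \<inter> U)) \<le> (\<Sum>z\<in>Z. if z \<in> Z' then m z else 0)"
    proof (rule sum_mono)
      fix z assume z: "z \<in> Z"
      show "(\<Sum>k\<in>I. \<Sum>y\<in>P z k. a z k * measure lborel (cube y (r k) \<inter> U)) \<le> (if z \<in> Z' then m z else 0)"
      proof (cases "z \<in> Z'")
        case True
        have "(\<Sum>k\<in>I. \<Sum>y\<in>P z k. a z k * measure lborel (cube y (r k) \<inter> U)) \<le> (\<Sum>k\<in>I. \<Sum>y\<in>P z k. a z k * (2 * r k) ^ d)"
        proof (intro sum_mono mult_left_mono a0)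
          fix k y assume "k \<in> I" "y \<in> P z k"
          have "measure lborel (cube y (r k) \<inter> U) \<le> measure lborel (cube y (r k))"
            using U by (intro measure_mono_fmeasurable) auto
          then show "measure lborel (cube y (r k) \<inter> U) \<le> (2 * r k) ^ d"
            using r_pos[of k] by (simp add: measure_cube d_def)
        qed
        also have "\<dots> = (\<Sum>k\<in>I. m z * (\<Psi> k / T))"
          using cardP[OF z] r_pos by (intro sum.cong refl) (simp add: a_def less_imp_neq[symmetric])
        also have "\<dots> = m z" by (rule level_sum)
        finally show ?thesis using True by simp
      next
        case False
        then have "cube y (r k) \<inter> U = {}" if "k \<in> I" "y \<in> P z k" for k y using z that by (auto simp: Z'_def)
        then show ?thesis using False by simp
      qed
    qed
    also have "\<dots> = (\<Sum>z\<in>Z'. m z)"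
      using finZ by (intro sum.mono_neutral_cong_right) (auto simp: Z'_def)
    finally have "ennreal (\<Sum>z\<in>Z. \<Sum>k\<in>I. \<Sum>y\<in>P z k. a z k * measure lborel (cube y (r k) \<inter> U)) \<le> ennreal (\<Sum>z\<in>Z'. m z)"
      by (rule ennreal_leI)
    also have "\<dots> = emeasure \<mu> X" unfolding X_def by (rule sum_m) (auto simp: Z'_def)
    also have "\<dots> \<le> ennreal (A * gauge_fun F0 \<beta> (diameter X))" by (rule \<mu>_gauge[OF X_sets X_bounded])
    also have "\<dots> \<le> ennreal (A * (1 + \<eta>) * gauge_fun F0 \<beta> u)"
    proof (rule ennreal_leI)
      have "gauge_fun F0 \<beta> (diameter X) \<le> gauge_fun F0 \<beta> (\<theta> * u)"
        using \<open>F0 \<ge> 0\<close> \<open>\<beta> > 0\<close> diamX diameter_ge_0[OF X_bounded] by (intro gauge_fun_mono) auto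
      also have "\<dots> \<le> \<theta> ^ d * gauge_fun F0 \<beta> u"
        unfolding d_def using \<open>F0 \<ge> 0\<close> \<open>\<beta> > 0\<close> \<theta> u u0 by (intro gauge_fun_scale) auto
      finally have "A * gauge_fun F0 \<beta> (diameter X) \<le> A * ((1 + \<eta>) * gauge_fun F0 \<beta> u)"
        using \<open>A \<ge> 1\<close> by (intro mult_left_mono) (auto simp: \<theta>(2))
      then show "A * gauge_fun F0 \<beta> (diameter X) \<le> A * (1 + \<eta>) * gauge_fun F0 \<beta> u" by (simp add: mult_ac)
    qed
    finally show ?thesis .
  qed
  have "frostman F0 \<beta> (A * (1 + \<eta>)) f' C'"
    unfolding frostman_def
  proof (intro conjI allI impI)
    show "f' \<in> borel_measurable borel"
      unfolding f'_def by (intro borel_measurable_sum borel_measurable_times_ennreal borel_measurable_const borel_measurable_indicator) auto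
    show "\<exists>F. \<forall>x. f' x \<le> ennreal F"
    proof (intro exI allI)
      fix x
      have "f' x \<le> (\<Sum>j\<in>J. ennreal (a (fst j) (fst (snd j))))"
        unfolding f'_def by (intro sum_mono) (auto simp: indicator_def)
      also have "\<dots> = ennreal (\<Sum>j\<in>J. a (fst j) (fst (snd j)))"
        using a0 by (intro sum_ennreal) (auto simp: J_def)
      finally show "f' x \<le> ennreal (\<Sum>j\<in>J. a (fst j) (fst (snd j)))" .
    qed
    show "compact C'" unfolding C'_def cube_eq_cbox using finJ by (intro compact_UN) auto
    show "f' x = 0" if "x \<notin> C'" for x
      using that unfolding f'_def C'_def by (intro sum.neutral) (auto simp: indicator_def)
    have "(\<integral>\<^sup>+x. f' x \<partial>lborel) = (\<integral>\<^sup>+x\<in>UNIV. f' x \<partial>lborel)" by simp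
    also have "\<dots> = 1"
      using full r_pos by (subst int_f') (auto simp: measure_cube d_def less_imp_le)
    finally show "(\<integral>\<^sup>+x. f' x \<partial>lborel) = 1" .
    fix U :: "(real ^ 'd) set" assume U: "U \<in> sets borel" "bounded U"
    show "(\<integral>\<^sup>+x\<in>U. f' x \<partial>lborel) \<le> ennreal (A * (1 + \<eta>) * gauge_fun F0 \<beta> (diameter U))"
      unfolding int_f'[OF U(1)]
    proof (cases "u0 \<le> diameter U")
      case True
      then show "ennreal (\<Sum>z\<in>Z. \<Sum>k\<in>I. \<Sum>y\<in>P z k. a z k * measure lborel (cube y (r k) \<inter> U))
      \<le> ennreal (A * (1 + \<eta>) * gauge_fun F0 \<beta> (diameter U))" by (rule large[OF U refl])
    next
      case False
      have "(\<Sum>z\<in>Z. \<Sum>k\<in>I. \<Sum>y\<in>P z k. a z k * measure lborel (cube y (r k) \<inter> U)) \<le> \<beta> * diameter U powr s"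
        using False by (intro small[OF U refl]) auto
      also have "\<dots> \<le> 1 * gauge_fun F0 \<beta> (diameter U)"
        using \<open>F0 \<ge> 0\<close> diameter_ge_0[OF U(2)] by (simp add: gauge_fun_def)
      also have "\<dots> \<le> A * (1 + \<eta>) * gauge_fun F0 \<beta> (diameter U)"
      proof (rule mult_right_mono)
        have "1 * 1 \<le> A * (1 + \<eta>)" using \<open>A \<ge> 1\<close> \<open>\<eta> > 0\<close> by (intro mult_mono) auto
        then show "1 \<le> A * (1 + \<eta>)" by simp
        show "0 \<le> gauge_fun F0 \<beta> (diameter U)"
          using \<open>F0 \<ge> 0\<close> \<open>\<beta> > 0\<close> diameter_ge_0[OF U(2)] by (intro gauge_fun_nonneg) auto
      qed
      finally show "ennreal (\<Sum>z\<in>Z. \<Sum>k\<in>I. \<Sum>y\<in>P z k. a z k * measure lborel (cube y (r k) \<inter> U))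
      \<le> ennreal (A * (1 + \<eta>) * gauge_fun F0 \<beta> (diameter U))" by (rule ennreal_leI)
    qed
  qed
  moreover have "C' \<subseteq> V \<inter> E k0"
  proof
    fix p assume "p \<in> C'"
    then obtain z k y where z: "z \<in> Z" "k \<in> I" "y \<in> P z k" "p \<in> cube y (r k)" by (auto simp: C'_def J_def)
    have "p \<in> V" using P_near(1)[OF z] near_C by blast
    moreover have "p \<in> E k0"
    proof -
      have "\<bar>p $ i - y $ i\<bar> < 2 * r k" for i
      proof -
        have "\<bar>p $ i - y $ i\<bar> \<le> r k" using z(4) by (simp add: cube_def)
        then show ?thesis using r_pos[of k] by linarith
      qed
      moreover have "y \<in> pts k" "k \<in> K \<inter> {k0..}" using P(3)[OF z(1,2)] z(3) Ik[OF z(2)] by auto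
      ultimately show ?thesis unfolding E_def by blast
    qed
    ultimately show "p \<in> V \<inter> E k0" by simp
  qed
  ultimately show ?thesis by blast
qed

end

section \<open>Lower bounds for covers of the limsup set\<close>

context ubiquitous_system
begin

lemma frostman_initial:
  assumes "\<beta> \<ge> 0"
  shows "frostman (2 ^ CARD('d)) \<beta> 1 (indicator (cube 0 (1 / 2))) (cube 0 (1 / 2))"
  unfolding frostman_def
proof (intro conjI allI impI)
  show "indicator (cube 0 (1 / 2)) \<in> borel_measurable (borel :: (real ^ 'd) measure)"
    by (intro borel_measurable_indicator) auto
  show "\<exists>F. \<forall>x. indicator (cube 0 (1 / 2)) (x :: real ^ 'd) \<le> ennreal F"
    by (intro exI[of _ 1]) (auto simp: indicator_def)
  show "compact (cube (0 :: real ^ 'd) (1 / 2))" by (simp add: cube_eq_cbox)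
  show "indicator (cube 0 (1 / 2)) x = 0" if "x \<notin> cube 0 (1 / 2)" for x :: "real ^ 'd" using that by simp
  show "integral\<^sup>N lborel (indicator (cube (0 :: real ^ 'd) (1 / 2))) = 1"
    by (simp add: emeasure_eq_measure2 measure_cube)
  fix U :: "(real ^ 'd) set" assume U: "U \<in> sets borel" "bounded U"
  have "(\<integral>\<^sup>+x\<in>U. indicator (cube 0 (1 / 2)) x \<partial>lborel) = emeasure lborel (cube 0 (1 / 2) \<inter> U)"
    using U(1) by (subst nn_integral_indicator[symmetric]) (auto intro!: nn_integral_cong simp: indicator_def)
  also have "\<dots> \<le> ennreal (1 * gauge_fun (2 ^ CARD('d)) \<beta> (diameter U))"
  proof (cases "U = {}")
    case False
    then obtain x where x: "x \<in> U" by blast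
    have "emeasure lborel (cube 0 (1 / 2) \<inter> U) \<le> emeasure lborel (cube x (diameter U))"
      using subset_cube_diameter[OF U(2) x] by (intro emeasure_mono) auto
    also have "\<dots> = ennreal ((2 * diameter U) ^ CARD('d))"
      using diameter_ge_0[OF U(2)] by (simp add: emeasure_eq_measure2 measure_cube)
    also have "\<dots> \<le> ennreal (1 * gauge_fun (2 ^ CARD('d)) \<beta> (diameter U))"
      using assms by (intro ennreal_leI) (simp add: gauge_fun_def power_mult_distrib)
    finally show ?thesis .
  qed simp
  finally show "(\<integral>\<^sup>+x\<in>U. indicator (cube 0 (1 / 2)) x \<partial>lborel) \<le> ennreal (1 * gauge_fun (2 ^ CARD('d)) \<beta> (diameter U))" .
qed

text \<open>Right continuity of the gauge, including \<open>u = 0\<close> by \<open>s > 0\<close>.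
  It allows an arbitrary cover to be replaced by an open one at a prescribed cost.\<close>

lemma gauge_fun_enlarge:
  assumes "u \<ge> 0" "z > 0"
  shows "\<exists>e>0. gauge_fun F0 \<beta> (u + e) \<le> gauge_fun F0 \<beta> u + z"
proof -
  have "((\<lambda>e. gauge_fun F0 \<beta> (u + e)) \<longlongrightarrow> gauge_fun F0 \<beta> (u + 0)) (at_right 0)"
    unfolding gauge_fun_def
    by (intro tendsto_intros tendsto_powr')
       (use s assms in \<open>auto simp: eventually_at_right_field intro!: exI[of _ 1]\<close>)
  then have "\<forall>\<^sub>F e in at_right 0. gauge_fun F0 \<beta> (u + e) < gauge_fun F0 \<beta> u + z"
    using assms by (intro order_tendstoD) auto
  moreover have "\<forall>\<^sub>F e :: real in at_right 0. e > 0" by (rule eventually_at_right_less)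
  ultimately have "\<forall>\<^sub>F e in at_right 0. e > 0 \<and> gauge_fun F0 \<beta> (u + e) \<le> gauge_fun F0 \<beta> u + z"
    by eventually_elim auto
  then show ?thesis by (rule eventually_happens'[OF trivial_limit_at_right_real])
qed

text \<open>No limit measure is formed. The closures of the neighbourhoods \<open>V n\<close> shrink
  to a subset of \<open>W\<close>, so by compactness an open cover of \<open>W\<close> already
  covers some \<open>closure (V n)\<close>, and the measure of stage \<open>n\<close> has its whole
  mass 1 there.\<close>

lemma cover_lower_bound:
  assumes s': "s < real CARD('d)" and "\<beta> > 0" and R: "R \<ge> 1"
    and U: "W \<subseteq> (\<Union>i. U i)" "\<And>i. bounded (U i)"
  shows "ennreal (1 / 2) \<le> (\<Sum>i. ennreal (2 * gauge_fun (2 ^ CARD('d)) \<beta> (diameter (U (i :: nat)))))"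
proof -
  let ?G = "gauge_fun (2 ^ CARD('d)) \<beta>"
  \<comment> \<open>Passing to open covering sets then costs the sum of \<open>2 * z i\<close>,
    which is \<open>1 / 2\<close>.\<close>
  define z where "z = (\<lambda>i::nat. (1 / 2) ^ (i + 3) :: real)"
  have "\<exists>e>0. ?G (diameter (U i) + e) \<le> ?G (diameter (U i)) + z i" for i
    using diameter_ge_0[OF U(2)] by (intro gauge_fun_enlarge) (auto simp: z_def)
  then obtain e where e: "\<And>i. e i > 0" "\<And>i. ?G (diameter (U i) + e i) \<le> ?G (diameter (U i)) + z i" by metis
  define U' where "U' = (\<lambda>i. \<Union>x\<in>U i. ball x (e i / 2))"
  have U'_open: "open (U' i)" for i by (auto simp: U'_def)
  have U_U': "U i \<subseteq> U' i" for i using e(1)[of i] by (auto simp: U'_def)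
  have dist_U': "dist x y \<le> diameter (U i) + e i" if xy: "x \<in> U' i" "y \<in> U' i" for x y i
  proof -
    obtain p q where p: "p \<in> U i" "dist p x < e i / 2" "q \<in> U i" "dist q y < e i / 2" using xy by (auto simp: U'_def)
    have "dist x y \<le> dist p x + dist p q + dist q y"
      using dist_triangle[of x y p] dist_triangle[of p y q] by (simp add: dist_commute)
    then show ?thesis using p diameter_bounded_bound[OF U(2) p(1,3)] by linarith
  qed
  have U'_bounded: "bounded (U' i)" for i
  proof (cases "U' i = {}")
    case False
    then show ?thesis using dist_U'[of _ i] unfolding bounded_def by blast
  qed simp
  have diam_U': "diameter (U' i) \<le> diameter (U i) + e i" for i
    using dist_U' e(1)[of i] diameter_ge_0[OF U(2), of i] by (intro diameter_le) (auto simp: dist_norm)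
  \<comment> \<open>The losses \<open>1 + \<eta>\<close> of the first \<open>n\<close> steps
    multiply to \<open>A n\<close>, which stays below 2.\<close>
  define A where "A = (\<lambda>n::nat. 2 - (1 / 2) ^ n :: real)"
  define inv where "inv = (\<lambda>n (f, C, V). frostman (2 ^ CARD('d)) \<beta> (A n) f C \<and> open V \<and> C \<subseteq> V \<and> V \<subseteq> cube 0 R)"
  have "\<exists>X. \<forall>n. inv n (X n) \<and> closure (snd (snd (X (Suc n)))) \<subseteq> snd (snd (X n)) \<inter> E n"
  proof (rule dependent_nat_choice)
    have "open {x :: real ^ 'd. \<forall>i. \<bar>x $ i\<bar> < 1}"
      unfolding Collect_all_eq by (intro open_INT finite ballI open_Collect_less continuous_intros)
    moreover have "cube 0 (1 / 2) \<subseteq> {x :: real ^ 'd. \<forall>i. \<bar>x $ i\<bar> < 1}"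
    proof safe
      fix x :: "real ^ 'd" and i assume "x \<in> cube 0 (1 / 2)"
      then have "\<bar>x $ i\<bar> \<le> 1 / 2" by (simp add: cube_def)
      then show "\<bar>x $ i\<bar> < 1" by linarith
    qed
    moreover have "{x :: real ^ 'd. \<forall>i. \<bar>x $ i\<bar> < 1} \<subseteq> cube 0 R"
    proof safe
      fix x :: "real ^ 'd" assume x: "\<forall>i. \<bar>x $ i\<bar> < 1"
      have "\<bar>x $ i\<bar> \<le> R" for i using x[rule_format, of i] R by linarith
      then show "x \<in> cube 0 R" by (simp add: cube_def)
    qed
    ultimately have "inv 0 (indicator (cube 0 (1 / 2)), cube 0 (1 / 2), {x :: real ^ 'd. \<forall>i. \<bar>x $ i\<bar> < 1})"
      using frostman_initial[of \<beta>] \<open>\<beta> > 0\<close> by (simp add: inv_def A_def)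
    then show "\<exists>x. inv 0 x" by blast
  next
    fix x n assume "inv n x"
    then obtain f C V where x: "x = (f, C, V)" and f: "frostman (2 ^ CARD('d)) \<beta> (A n) f C"
      and V: "open V" "C \<subseteq> V" "V \<subseteq> cube 0 R" by (cases x) (auto simp: inv_def)
    have A1: "A n \<ge> 1" "A n < A (Suc n)" by (simp_all add: A_def power_le_one)
    define \<eta> where "\<eta> = A (Suc n) / A n - 1"
    have \<eta>: "\<eta> > 0" "A n * (1 + \<eta>) = A (Suc n)" using A1 by (auto simp: \<eta>_def)
    obtain f' C' where f': "frostman (2 ^ CARD('d)) \<beta> (A (Suc n)) f' C'" "C' \<subseteq> V \<inter> E n"
      using frostman_step[OF s' f _ \<open>\<beta> > 0\<close> A1(1) \<eta>(1) V, of n] unfolding \<eta>(2) by auto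
    have "compact C'" using f'(1) by (simp add: frostman_def)
    moreover have "closed (- (V \<inter> E n))" using V(1) open_E by auto
    moreover have "C' \<inter> - (V \<inter> E n) = {}" using f'(2) by (simp add: disjoint_eq_subset_Compl)
    \<comment> \<open>The new neighbourhood has its closure inside \<open>V \<inter> E n\<close>;
      hence a point in all closures lies in every \<open>E n\<close>, that is, in
      \<open>W\<close>.\<close>
    ultimately obtain V' T where V': "open V'" "compact (closure V')" "open T" "C' \<subseteq> V'" "- (V \<inter> E n) \<subseteq> T" "V' \<inter> T = {}"
      by (rule separation_normal_compact)
    have "closure V' \<inter> T = {}" using V'(3,6) by (metis inf_commute open_Int_closure_eq_empty)
    then have cl: "closure V' \<subseteq> V \<inter> E n" using V'(5) by blast
    moreover have "V' \<subseteq> closure V'" by (rule closure_subset)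
    ultimately have "inv (Suc n) (f', C', V')" using f' V' V by (auto simp: inv_def)
    then show "\<exists>y. inv (Suc n) y \<and> closure (snd (snd y)) \<subseteq> snd (snd x) \<inter> E n"
      using cl by (intro exI[of _ "(f', C', V')"]) (simp add: x)
  qed
  then obtain X where X: "\<And>n. inv n (X n)" "\<And>n. closure (snd (snd (X (Suc n)))) \<subseteq> snd (snd (X n)) \<inter> E n" by blast
  define V where "V = (\<lambda>n. snd (snd (X n)))"
  have V_sub: "V n \<subseteq> cube 0 R" for n using X(1)[of n] by (auto simp: inv_def V_def split: prod.splits)
  have "\<exists>n. closure (V n) \<subseteq> (\<Union>i. U' i)"
  proof (rule ccontr)
    assume "\<nexists>n. closure (V n) \<subseteq> (\<Union>i. U' i)"
    then have ne: "closure (V n) - (\<Union>i. U' i) \<noteq> {}" for n by blast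
    have "\<Inter> (range (\<lambda>n. closure (V n) - (\<Union>i. U' i))) \<noteq> {}"
    proof (rule compact_nest)
      have "bounded (cube (0 :: real ^ 'd) R)" by (simp add: cube_eq_cbox)
      then have "bounded (V n)" for n using V_sub by (rule bounded_subset)
      then show "compact (closure (V n) - (\<Union>i. U' i))" for n
        using U'_open by (intro compact_diff) (auto simp: compact_closure)
      show "closure (V n) - (\<Union>i. U' i) \<noteq> {}" for n by (rule ne)
      have "closure (V (Suc n)) \<subseteq> closure (V n)" for n
        using X(2)[of n] closure_subset[of "V n"] by (auto simp: V_def)
      then have "closure (V n) \<subseteq> closure (V m)" if "m \<le> n" for m n
        using lift_Suc_antimono_le[of "\<lambda>n. closure (V n)" m n] that by blast
      then show "closure (V n) - (\<Union>i. U' i) \<subseteq> closure (V m) - (\<Union>i. U' i)" if "m \<le> n" for m n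
        using that by blast
    qed
    then obtain x where x: "\<And>n. x \<in> closure (V n)" "x \<notin> (\<Union>i. U' i)" by blast
    have "x \<in> W" unfolding W_def using x(1) X(2) by (auto simp: V_def)
    then show False using U(1) U_U' x(2) by blast
  qed
  then obtain n where n: "closure (V n) \<subseteq> (\<Union>i. U' i)" ..
  obtain f C where fC: "frostman (2 ^ CARD('d)) \<beta> (A n) f C" "C \<subseteq> V n"
    using X(1)[of n] by (auto simp: inv_def V_def split: prod.splits)
  have f_meas: "f \<in> borel_measurable lborel" and f0: "\<And>x. x \<notin> C \<Longrightarrow> f x = 0" and f1: "(\<integral>\<^sup>+x. f x \<partial>lborel) = 1"
    and f_gauge: "\<And>U. U \<in> sets borel \<Longrightarrow> bounded U \<Longrightarrow> (\<integral>\<^sup>+x\<in>U. f x \<partial>lborel) \<le> ennreal (A n * ?G (diameter U))"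
    using fC(1) by (auto simp: frostman_def)
  have CU: "C \<subseteq> (\<Union>i. U' i)" using fC(2) n closure_subset[of "V n"] by blast
  have U'_sets: "U' i \<in> sets borel" for i using U'_open by (rule borel_open)
  have "1 = (\<integral>\<^sup>+x\<in>(\<Union>i. U' i). f x \<partial>lborel)"
    unfolding f1[symmetric] using CU f0 by (intro nn_integral_cong) (auto simp: indicator_def)
  also have "\<dots> = emeasure (density lborel f) (\<Union>i. U' i)"
    using f_meas U'_sets by (intro emeasure_density[symmetric]) auto
  also have "\<dots> \<le> (\<Sum>i. emeasure (density lborel f) (U' i))"
    using U'_sets by (intro emeasure_subadditive_countably) auto
  also have "\<dots> \<le> (\<Sum>i. ennreal (2 * ?G (diameter (U i))) + ennreal (2 * z i))"
  proof (rule suminf_le)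
    fix i
    have "emeasure (density lborel f) (U' i) = (\<integral>\<^sup>+x\<in>U' i. f x \<partial>lborel)"
      using f_meas U'_sets by (intro emeasure_density) auto
    also have "\<dots> \<le> ennreal (A n * ?G (diameter (U' i)))" by (rule f_gauge[OF U'_sets U'_bounded])
    also have "\<dots> \<le> ennreal (2 * (?G (diameter (U i)) + z i))"
    proof (intro ennreal_leI mult_mono)
      have "?G (diameter (U' i)) \<le> ?G (diameter (U i) + e i)"
        using \<open>\<beta> > 0\<close> diam_U'[of i] diameter_ge_0[OF U'_bounded, of i] by (intro gauge_fun_mono) auto
      then show "?G (diameter (U' i)) \<le> ?G (diameter (U i)) + z i" using e(2)[of i] by linarith
      show "0 \<le> ?G (diameter (U' i))" using \<open>\<beta> > 0\<close> diameter_ge_0[OF U'_bounded, of i] by (intro gauge_fun_nonneg) auto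
    qed (auto simp: A_def)
    also have "\<dots> = ennreal (2 * ?G (diameter (U i))) + ennreal (2 * z i)"
      using \<open>\<beta> > 0\<close> diameter_ge_0[OF U(2), of i] gauge_fun_nonneg[of "2 ^ CARD('d)" \<beta> "diameter (U i)"]
      by (simp add: z_def distrib_left flip: ennreal_plus)
    finally show "emeasure (density lborel f) (U' i) \<le> ennreal (2 * ?G (diameter (U i))) + ennreal (2 * z i)" .
  qed auto
  also have "\<dots> = (\<Sum>i. ennreal (2 * ?G (diameter (U i)))) + (\<Sum>i. ennreal (2 * z i))"
    by (rule suminf_add[symmetric]) auto
  also have "(\<Sum>i. ennreal (2 * z i)) = ennreal (1 / 2)"
  proof (rule suminf_ennreal_eq)
    have "(\<lambda>i. (1 / 4) * (1 / 2) ^ i) sums ((1 / 4) * (1 / (1 - 1 / 2 :: real)))"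
      by (intro sums_mult geometric_sums) auto
    then show "(\<lambda>i. 2 * z i) sums (1 / 2)" by (simp add: z_def power_add power3_eq_cube)
  qed (simp add: z_def)
  finally have le: "1 \<le> (\<Sum>i. ennreal (2 * ?G (diameter (U i)))) + ennreal (1 / 2)" .
  show ?thesis
  proof (rule ccontr)
    assume "\<not> ?thesis"
    then have less: "(\<Sum>i. ennreal (2 * ?G (diameter (U i)))) < ennreal (1 / 2)" by simp
    then obtain x where x: "(\<Sum>i. ennreal (2 * ?G (diameter (U i)))) = ennreal x" "x \<ge> 0"
      by (cases "\<Sum>i. ennreal (2 * ?G (diameter (U i)))") auto
    have "x < 1 / 2" using less x by (simp only: x ennreal_less_iff)
    moreover have "ennreal 1 \<le> ennreal (x + 1 / 2)"
      using le x(2) unfolding x(1) by (subst ennreal_plus) auto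
    then have "1 \<le> x + 1 / 2" using x(2) by (subst (asm) ennreal_le_iff) auto
    ultimately show False by linarith
  qed
qed

text \<open>With \<open>\<beta> = 2 ^ d * \<delta> powr (d - s)\<close> the term in
  \<open>u ^ d\<close> is at most \<open>\<beta> * u powr s\<close> for
  \<open>u \<le> \<delta>\<close>. So every covering sum is at least
  \<open>1 / (8 * \<beta>)\<close>, which is unbounded as \<open>\<delta>\<close> tends to 0 because
  \<open>s < d\<close>. The contraction \<open>p\<close> carries covers of \<open>X\<close> to
  covers of \<open>W\<close> without increasing diameters.\<close>

lemma hausdorff_measure_infinite:
  fixes X :: "'b::metric_space set" and p :: "'b \<Rightarrow> real ^ 'd"
  assumes s': "s < real CARD('d)" and R: "R \<ge> 1"
    and p: "\<And>x y. dist (p x) (p y) \<le> dist x y" and W: "W \<subseteq> p ` X"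
  shows "hausdorff_measure s X = \<infinity>"
proof -
  define d where "d = CARD('d)"
  have bound: "ennreal (1 / (8 * 2 ^ d * \<delta> powr (real d - s))) \<le> hausdorff_delta s \<delta> X" if \<delta>: "\<delta> > 0" for \<delta>
    unfolding hausdorff_delta_def
  proof (rule INF_greatest)
    fix U :: "nat \<Rightarrow> 'b set" assume "U \<in> {U. X \<subseteq> (\<Union>i. U i) \<and> (\<forall>i. bounded (U i) \<and> diameter (U i) \<le> \<delta>)}"
    then have U: "X \<subseteq> (\<Union>i. U i)" "\<And>i. bounded (U i)" "\<And>i. diameter (U i) \<le> \<delta>" by auto
    define \<beta> where "\<beta> = 2 ^ d * \<delta> powr (real d - s)"
    have \<beta>: "\<beta> > 0" using \<delta> by (simp add: \<beta>_def)
    have dist_p: "dist x y \<le> diameter (U i)" if xy: "x \<in> p ` U i" "y \<in> p ` U i" for x y i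
    proof -
      obtain u v where u: "u \<in> U i" "v \<in> U i" "x = p u" "y = p v" using xy by blast
      then show ?thesis using p[of u v] diameter_bounded_bound[OF U(2) u(1,2)] by simp
    qed
    have bp: "bounded (p ` U i)" for i
    proof (cases "p ` U i = {}")
      case False
      then show ?thesis using dist_p[of _ i] unfolding bounded_def by blast
    qed simp
    have dp: "diameter (p ` U i) \<le> diameter (U i)" for i
    proof (rule diameter_le)
      show "norm (x - y) \<le> diameter (U i)" if "x \<in> p ` U i" "y \<in> p ` U i" for x y
        using dist_p[OF that] by (simp add: dist_norm)
    qed (use diameter_ge_0[OF U(2)] in simp)
    have WU: "W \<subseteq> (\<Union>i. p ` U i)"
      using subset_trans[OF W image_mono[OF U(1)]] by (simp only: image_UN)
    have "ennreal (1 / 2) \<le> (\<Sum>i. ennreal (2 * gauge_fun (2 ^ d) \<beta> (diameter (p ` U i))))"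
      unfolding d_def by (rule cover_lower_bound[OF s' \<beta> R WU bp])
    also have "\<dots> \<le> (\<Sum>i. ennreal (4 * \<beta>) * ennreal (diam_pow s (U i)))"
    proof (rule suminf_le)
      fix i
      show "ennreal (2 * gauge_fun (2 ^ d) \<beta> (diameter (p ` U i))) \<le> ennreal (4 * \<beta>) * ennreal (diam_pow s (U i))"
      proof (cases "U i = {}")
        case True
        then show ?thesis using s by (simp add: gauge_fun_def diam_pow_def)
      next
        case False
        define u where "u = diameter (U i)"
        have u: "0 \<le> u" "u \<le> \<delta>" using diameter_ge_0[OF U(2)] U(3) by (auto simp: u_def)
        have "gauge_fun (2 ^ d) \<beta> (diameter (p ` U i)) \<le> gauge_fun (2 ^ d) \<beta> u"
          unfolding u_def using \<beta> dp diameter_ge_0[OF bp] by (intro gauge_fun_mono) auto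
        also have "\<dots> = 2 ^ d * u ^ d + \<beta> * u powr s" by (simp add: gauge_fun_def d_def)
        also have "u ^ d \<le> \<delta> powr (real d - s) * u powr s"
        proof (cases "u = 0")
          case False
          then have "u ^ d = u powr (real d - s) * u powr s" using u by (simp flip: powr_add powr_realpow)
          also have "\<dots> \<le> \<delta> powr (real d - s) * u powr s"
            using u s' by (intro mult_right_mono powr_mono2) (auto simp: d_def)
          finally show ?thesis .
        next
          case True
          have "(0::real) ^ d = 0" by (simp add: d_def)
          then show ?thesis unfolding True by (simp only: order.refl powr_zero_eq_one powr_0 mult_zero_right simp_thms)
        qed
        finally have "2 * gauge_fun (2 ^ d) \<beta> (diameter (p ` U i)) \<le> 4 * \<beta> * u powr s"
          by (simp add: \<beta>_def)
        moreover have "diam_pow s (U i) = u powr s" using False s by (simp add: diam_pow_def u_def)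
        ultimately show ?thesis using \<beta> by (simp add: ennreal_leI flip: ennreal_mult)
      qed
    qed auto
    also have "\<dots> = ennreal (4 * \<beta>) * (\<Sum>i. ennreal (diam_pow s (U i)))" by simp
    finally have le: "ennreal (1 / 2) \<le> ennreal (4 * \<beta>) * (\<Sum>i. ennreal (diam_pow s (U i)))" .
    have "ennreal (1 / (8 * 2 ^ d * \<delta> powr (real d - s))) = ennreal (1 / (4 * \<beta>)) * ennreal (1 / 2)"
    proof -
      have "1 / (8 * 2 ^ d * \<delta> powr (real d - s)) = 1 / (4 * \<beta>) * (1 / 2)" by (simp add: \<beta>_def)
      moreover have "ennreal (1 / (4 * \<beta>) * (1 / 2)) = ennreal (1 / (4 * \<beta>)) * ennreal (1 / 2)"
        using \<beta> by (intro ennreal_mult) auto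
      ultimately show ?thesis by (rule trans[OF arg_cong])
    qed
    also have "\<dots> \<le> ennreal (1 / (4 * \<beta>)) * (ennreal (4 * \<beta>) * (\<Sum>i. ennreal (diam_pow s (U i))))"
      by (rule mult_left_mono[OF le]) simp
    also have "\<dots> = ennreal (1 / (4 * \<beta>) * (4 * \<beta>)) * (\<Sum>i. ennreal (diam_pow s (U i)))"
      using \<beta> by (subst ennreal_mult) (auto simp: mult.assoc)
    also have "\<dots> = (\<Sum>i. ennreal (diam_pow s (U i)))" using \<beta> by simp
    finally show "ennreal (1 / (8 * 2 ^ d * \<delta> powr (real d - s))) \<le> (\<Sum>i. ennreal (diam_pow s (U i)))" .
  qed
  show ?thesis
  proof (rule ccontr)
    assume "hausdorff_measure s X \<noteq> \<infinity>"
    then obtain N0 where N0: "hausdorff_measure s X = ennreal N0" "N0 \<ge> 0"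
      by (cases "hausdorff_measure s X") auto
    define N where "N = N0 + 1"
    have N: "hausdorff_measure s X \<le> ennreal N" "N > 0"
      using N0 by (auto simp: N_def intro: ennreal_leI)
    define \<delta> where "\<delta> = (1 / (16 * 2 ^ d * N)) powr (1 / (real d - s))"
    have "\<delta> > 0" using N by (simp add: \<delta>_def)
    have \<delta>_eq: "\<delta> powr (real d - s) = 1 / (16 * 2 ^ d * N)"
      using N s' by (simp add: \<delta>_def powr_powr d_def)
    have "1 / (8 * 2 ^ d * \<delta> powr (real d - s)) = 2 * N" unfolding \<delta>_eq using N by simp
    then have "ennreal (2 * N) \<le> hausdorff_delta s \<delta> X" using bound[OF \<open>\<delta> > 0\<close>] by simp
    also have "\<dots> \<le> hausdorff_measure s X"
      unfolding hausdorff_measure_def using \<open>\<delta> > 0\<close> by (intro SUP_upper) auto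
    also have "\<dots> \<le> ennreal N" by (rule N(1))
    finally show False using N(2) by simp
  qed
qed

end

section \<open>Ubiquitous systems: Lebesgue measure\<close>

text \<open>The integral of \<open>(g - t * 1_S)^2\<close> is nonnegative, where \<open>g\<close> is
  the sum of the indicators and \<open>1_S\<close> the indicator of the union. Optimising
  \<open>t\<close> gives the Chung-Erdos inequality.\<close>

lemma second_moment:
  fixes Q :: "'j \<Rightarrow> 'a set"
  assumes J: "finite J" and Q: "\<And>j. j \<in> J \<Longrightarrow> Q j \<in> fmeasurable M"
  shows "2 * t * (\<Sum>j\<in>J. measure M (Q j)) \<le> (\<Sum>i\<in>J. \<Sum>j\<in>J. measure M (Q i \<inter> Q j)) + t\<^sup>2 * measure M (\<Union>j\<in>J. Q j)"
proof -
  let ?S = "\<Union>j\<in>J. Q j"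
  let ?h = "\<lambda>x. (\<Sum>i\<in>J. \<Sum>j\<in>J. indicator (Q i \<inter> Q j) x) - 2 * t * (\<Sum>j\<in>J. indicator (Q j) x) + t\<^sup>2 * indicator ?S x :: real"
  have S: "?S \<in> fmeasurable M" using J Q by (intro fmeasurable.finite_UN) auto
  have int: "integrable M (indicator A :: 'a \<Rightarrow> real)" if "A \<in> fmeasurable M" for A
    using that by (intro integrable_real_indicator) (auto dest: fmeasurableD fmeasurableD2 simp: less_top)
  have lint: "(\<integral>x. indicator A x \<partial>M) = measure M A" if "A \<in> fmeasurable M" for A
    using that by (simp add: Int_absorb2 sets.sets_into_space fmeasurableD)
  have QQ: "Q i \<inter> Q j \<in> fmeasurable M" if "i \<in> J" "j \<in> J" for i j
    using Q that by (intro fmeasurable.Int) auto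
  have "0 \<le> (\<integral>x. ?h x \<partial>M)"
  proof (rule integral_nonneg_AE, rule AE_I2)
    fix x
    define g where "g = (\<Sum>j\<in>J. indicator (Q j) x :: real)"
    have "(\<Sum>i\<in>J. \<Sum>j\<in>J. indicator (Q i \<inter> Q j) x :: real) = g\<^sup>2"
      by (simp add: g_def power2_eq_square sum_product indicator_inter_arith)
    moreover have "g * indicator ?S x = g"
      using J by (cases "x \<in> ?S") (auto simp: g_def indicator_def intro!: sum.neutral)
    then have "g\<^sup>2 - 2 * t * g + t\<^sup>2 * indicator ?S x = (g - t * indicator ?S x)\<^sup>2"
      by (auto simp: power2_eq_square algebra_simps indicator_def split: if_splits)
    ultimately show "0 \<le> ?h x" by (simp add: g_def)
  qed
  also have "(\<integral>x. ?h x \<partial>M) = (\<integral>x. (\<Sum>i\<in>J. \<Sum>j\<in>J. indicator (Q i \<inter> Q j) x) - 2 * t * (\<Sum>j\<in>J. indicator (Q j) x) \<partial>M) + (\<integral>x. t\<^sup>2 * indicator ?S x \<partial>M)"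
    using Q QQ S by (intro Bochner_Integration.integral_add Bochner_Integration.integrable_diff
        Bochner_Integration.integrable_sum integrable_mult_right int) auto
  also have "(\<integral>x. (\<Sum>i\<in>J. \<Sum>j\<in>J. indicator (Q i \<inter> Q j) x) - 2 * t * (\<Sum>j\<in>J. indicator (Q j) x) \<partial>M)
     = (\<integral>x. (\<Sum>i\<in>J. \<Sum>j\<in>J. indicator (Q i \<inter> Q j) x) \<partial>M) - (\<integral>x. 2 * t * (\<Sum>j\<in>J. indicator (Q j) x) \<partial>M)"
    using Q QQ by (intro Bochner_Integration.integral_diff Bochner_Integration.integrable_sum integrable_mult_right int) auto
  also have "(\<integral>x. (\<Sum>i\<in>J. \<Sum>j\<in>J. indicator (Q i \<inter> Q j) x) \<partial>M) = (\<Sum>i\<in>J. \<Sum>j\<in>J. measure M (Q i \<inter> Q j))"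
    using QQ by (simp add: Bochner_Integration.integral_sum Bochner_Integration.integrable_sum int lint cong: sum.cong)
  also have "(\<integral>x. 2 * t * (\<Sum>j\<in>J. indicator (Q j) x) \<partial>M) = 2 * t * (\<Sum>j\<in>J. measure M (Q j))"
    using Q by (simp add: Bochner_Integration.integral_sum int lint cong: sum.cong)
  also have "(\<integral>x. t\<^sup>2 * indicator ?S x \<partial>M) = t\<^sup>2 * measure M ?S"
    using S by (simp add: lint)
  finally show ?thesis by simp
qed

section \<open>Quasi-independence of the levels\<close>

context ubiquitous_system
begin

text \<open>Up to constants, a cube of radius \<open>r k\<close> meets
  \<open>(r k / \<rho> k') ^ d\<close> of the finer cubes, but possibly one even if this number is
  small. The first count gives the product of the two densities, as for independent events; the
  second gives a term that is summable over \<open>k'\<close> since the radii halve.\<close>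

lemma overlap_sum:
  fixes P P' :: "(real ^ 'd) set"
  assumes k: "k \<in> K" "k' \<in> K" "k \<le> k'" and P: "finite P'" "finite P"
    and sep: "\<And>y z. y \<in> P' \<Longrightarrow> z \<in> P' \<Longrightarrow> y \<noteq> z \<Longrightarrow> \<exists>i. \<rho> k' \<le> \<bar>y $ i - z $ i\<bar>"
    and card: "real (card P) * \<rho> k ^ CARD('d) \<le> N"
  shows "(\<Sum>y\<in>P. \<Sum>y'\<in>P'. measure lborel (cube y (r k) \<inter> cube y' (r k')))
     \<le> 16 ^ CARD('d) * N * ((r k / \<rho> k) ^ CARD('d) * (r k' / \<rho> k') ^ CARD('d) + (r k / \<rho> k) ^ CARD('d) * (1 / 2) ^ (k' - k))"
proof -
  define d where "d = CARD('d)"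
  have d: "d \<ge> 1" by (simp add: d_def Suc_leI)
  have pos: "r k > 0" "r k' > 0" "\<rho> k > 0" "\<rho> k' > 0" using r_pos \<rho>_pos k by auto
  have r_le: "r k' \<le> r k * (1 / 2) ^ (k' - k)"
    using r_geometric[of k "k' - k"] k(3) by (simp add: power_one_over field_simps)
  moreover have "r k * (1 / 2) ^ (k' - k) \<le> r k * 1"
    using pos by (intro mult_left_mono) (auto simp: power_le_one)
  ultimately have rr: "r k' \<le> r k" by simp
  have single: "(\<Sum>y'\<in>P'. measure lborel (cube y (r k) \<inter> cube y' (r k'))) \<le> 16 ^ d * (r k ^ d * (r k' / \<rho> k') ^ d + r k' ^ d)" for y
  proof -
    define Y where "Y = {y'\<in>P'. cube y (r k) \<inter> cube y' (r k') \<noteq> {}}"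
    have "(\<Sum>y'\<in>P'. measure lborel (cube y (r k) \<inter> cube y' (r k'))) = (\<Sum>y'\<in>Y. measure lborel (cube y (r k) \<inter> cube y' (r k')))"
      using P by (intro sum.mono_neutral_right) (auto simp: Y_def)
    also have "\<dots> \<le> (\<Sum>y'\<in>Y. (2 * r k') ^ d)"
    proof (rule sum_mono)
      fix y'
      have "measure lborel (cube y (r k) \<inter> cube y' (r k')) \<le> measure lborel (cube y' (r k'))"
        by (intro measure_mono_fmeasurable) auto
      then show "measure lborel (cube y (r k) \<inter> cube y' (r k')) \<le> (2 * r k') ^ d"
        using pos by (simp add: measure_cube d_def)
    qed
    also have "\<dots> = real (card Y) * (2 * r k') ^ d" by simp
    also have "\<dots> \<le> (8 * max (r k / \<rho> k') 1) ^ d * (2 * r k') ^ d"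
    proof (rule mult_right_mono)
      have "real (card Y) \<le> (2 * (2 * r k) / \<rho> k' + 2) ^ d"
        unfolding d_def
      proof (rule card_separated_le)
        show "Y \<subseteq> cube y (2 * r k)"
        proof
          fix y' assume "y' \<in> Y"
          then obtain p where p: "p \<in> cube y (r k)" "p \<in> cube y' (r k')" by (auto simp: Y_def)
          then have "y' \<in> cube p (r k')" by (auto simp: cube_def abs_minus_commute)
          then show "y' \<in> cube y (2 * r k)" by (rule cube_trans[OF _ p(1)]) (use rr in simp)
        qed
      qed (use pos sep in \<open>auto simp: Y_def\<close>)
      also have "\<dots> \<le> (8 * max (r k / \<rho> k') 1) ^ d"
        using pos by (intro power_mono) auto
      finally show "real (card Y) \<le> (8 * max (r k / \<rho> k') 1) ^ d" .
    qed (use pos in auto)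
    also have "\<dots> = 16 ^ d * (max (r k / \<rho> k') 1 ^ d * r k' ^ d)"
    proof -
      have "(16::real) ^ d = 8 ^ d * 2 ^ d" by (simp flip: power_mult_distrib)
      then show ?thesis by (simp add: power_mult_distrib)
    qed
    also have "\<dots> \<le> 16 ^ d * (((r k / \<rho> k') ^ d + 1) * r k' ^ d)"
      using pos by (intro mult_left_mono mult_right_mono) (auto simp: max_def)
    also have "\<dots> = 16 ^ d * (r k ^ d * (r k' / \<rho> k') ^ d + r k' ^ d)"
      by (simp add: power_divide distrib_right)
    finally show ?thesis .
  qed
  have "(\<Sum>y\<in>P. \<Sum>y'\<in>P'. measure lborel (cube y (r k) \<inter> cube y' (r k')))
     \<le> (\<Sum>y\<in>P. 16 ^ d * (r k ^ d * (r k' / \<rho> k') ^ d + r k' ^ d))"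
    by (rule sum_mono) (rule single)
  also have "\<dots> = 16 ^ d * (real (card P) * (r k ^ d * (r k' / \<rho> k') ^ d + r k' ^ d))" by simp
  also have "\<dots> \<le> 16 ^ d * (N / \<rho> k ^ d * (r k ^ d * (r k' / \<rho> k') ^ d + r k ^ d * (1 / 2) ^ (k' - k)))"
  proof (intro mult_left_mono mult_mono add_mono order.refl)
    show "real (card P) \<le> N / \<rho> k ^ d" using card pos by (simp add: d_def field_simps)
    have "r k' ^ d \<le> (r k * (1 / 2) ^ (k' - k)) ^ d" using r_le pos by (intro power_mono) auto
    also have "\<dots> = r k ^ d * ((1 / 2) ^ (k' - k)) ^ d" by (rule power_mult_distrib)
    also have "\<dots> \<le> r k ^ d * ((1 / 2) ^ (k' - k)) ^ 1"
      using d pos by (intro mult_left_mono power_decreasing) (auto simp: power_le_one)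
    finally show "r k' ^ d \<le> r k ^ d * (1 / 2) ^ (k' - k)" by simp
    have "0 \<le> real (card P) * \<rho> k ^ CARD('d)" using pos by simp
    then have "0 \<le> N" using card by linarith
    then show "0 \<le> N / \<rho> k ^ d" using pos by simp
  qed (use pos in auto)
  also have "\<dots> = 16 ^ d * N * ((r k / \<rho> k) ^ d * (r k' / \<rho> k') ^ d + (r k / \<rho> k) ^ d * (1 / 2) ^ (k' - k))"
    by (simp add: power_divide distrib_left mult_ac)
  finally show ?thesis by (simp add: d_def)
qed

lemma half_power_sum: "finite I \<Longrightarrow> (\<Sum>j\<in>{j\<in>I. k \<le> j}. (1 / 2 :: real) ^ (j - k)) \<le> 2"
proof -
  assume I: "finite I"
  have "inj_on (\<lambda>j. j - k) {j\<in>I. k \<le> j}" by (auto simp: inj_on_def)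
  then have "(\<Sum>j\<in>{j\<in>I. k \<le> j}. (1 / 2 :: real) ^ (j - k)) = (\<Sum>j\<in>(\<lambda>j. j - k) ` {j\<in>I. k \<le> j}. (1 / 2) ^ j)"
    by (simp add: sum.reindex)
  also have "\<dots> \<le> 1 / (1 - 1 / 2)" using I by (intro sum_power_le) auto
  finally show ?thesis by simp
qed

text \<open>Total weight \<open>T \<ge> 1\<close> beyond \<open>k0\<close> is enough: the first
  moment is at least \<open>\<kappa> * l ^ d * T\<close>, and the second is of order
  \<open>l ^ d * T\<^sup>2\<close>, the near-diagonal part of order \<open>T\<close> being absorbed.
  The resulting bound does not depend on \<open>k0\<close>.\<close>

lemma positive_proportion_E:
  assumes s': "s = real CARD('d)" and l: "0 < l" "l \<le> 1" and a: "\<And>i. \<bar>a $ i\<bar> \<le> R"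
  shows "\<kappa>\<^sup>2 / (10 * 64 ^ CARD('d)) * l ^ CARD('d) \<le> measure lborel (E k0 \<inter> cube a l)"
proof -
  define d where "d = CARD('d)"
  obtain k1 where k1: "\<And>k. k \<ge> k1 \<Longrightarrow> k \<in> K \<Longrightarrow> (\<exists>P. finite P \<and> P \<subseteq> cube a (l / 2) \<inter> pts k \<and>
          (\<forall>x\<in>P. \<forall>y\<in>P. x \<noteq> y \<longrightarrow> (\<exists>i. \<rho> k \<le> \<bar>x $ i - y $ i\<bar>)) \<and>
          \<kappa> * (l / 2) ^ d \<le> real (card P) * \<rho> k ^ d)"
    using ubiq[of "l / 2" a] l a unfolding d_def by auto
  obtain k2 where k2: "\<And>k. k \<ge> k2 \<Longrightarrow> k \<in> K \<Longrightarrow> \<rho> k < l / 2" using \<rho>_lim[of "l / 2"] l by auto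
  define \<Psi> where "\<Psi> = (\<lambda>k. (r k / \<rho> k) ^ d)"
  have \<Psi>_eq: "r k powr s / \<rho> k ^ CARD('d) = \<Psi> k" for k
    using r_pos[of k] by (simp add: \<Psi>_def s' d_def powr_realpow power_divide)
  obtain I where I: "finite I" "I \<subseteq> K \<inter> {max k0 (max k1 k2)..}" "1 \<le> (\<Sum>k\<in>I. \<Psi> k)"
    using diverge[of "max k0 (max k1 k2)" 1] unfolding \<Psi>_eq by blast
  define T where "T = (\<Sum>k\<in>I. \<Psi> k)"
  have T: "T \<ge> 1" using I by (simp add: T_def)
  have Ik: "k \<in> K" "k0 \<le> k" "k1 \<le> k" "\<rho> k > 0" "r k \<le> \<rho> k" "\<rho> k < l / 2" "r k > 0" if "k \<in> I" for k
  proof -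
    have k: "k \<in> K" "k0 \<le> k" "k1 \<le> k" "k2 \<le> k" using I(2) that by auto
    then show "k \<in> K" "k0 \<le> k" "k1 \<le> k" "\<rho> k > 0" "r k \<le> \<rho> k" "\<rho> k < l / 2" "r k > 0"
      using k2[of k] \<rho>_pos r_le_\<rho> r_pos by simp_all
  qed
  have \<Psi>0: "\<Psi> k \<ge> 0" if "k \<in> I" for k using Ik[OF that] by (simp add: \<Psi>_def)
  define GP where "GP = (\<lambda>k P. finite P \<and> P \<subseteq> cube a (l / 2) \<inter> pts k \<and>
          (\<forall>x\<in>P. \<forall>y\<in>P. x \<noteq> y \<longrightarrow> (\<exists>i. \<rho> k \<le> \<bar>x $ i - y $ i\<bar>)) \<and>
          \<kappa> * (l / 2) ^ d \<le> real (card P) * \<rho> k ^ d)"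
  have "\<exists>P. GP k P" if "k \<in> I" for k
    unfolding GP_def using Ik(3,1)[OF that] by (rule k1)
  then obtain P where GP: "\<And>k. k \<in> I \<Longrightarrow> GP k (P k)" by metis
  have P: "finite (P k)" "P k \<subseteq> cube a (l / 2)" "P k \<subseteq> pts k"
      "\<And>x y. x \<in> P k \<Longrightarrow> y \<in> P k \<Longrightarrow> x \<noteq> y \<Longrightarrow> \<exists>i. \<rho> k \<le> \<bar>x $ i - y $ i\<bar>"
      "\<kappa> * (l / 2) ^ d \<le> real (card (P k)) * \<rho> k ^ d" if "k \<in> I" for k
    using GP[OF that] unfolding GP_def by auto
  define N where "N = (2 * l) ^ d"
  have N: "N > 0" using l by (simp add: N_def)
  have card_le: "real (card (P k)) * \<rho> k ^ CARD('d) \<le> N" if k: "k \<in> I" for k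
  proof -
    have "real (card (P k)) \<le> (2 * (l / 2) / \<rho> k + 2) ^ d"
      unfolding d_def using P(2)[OF k] Ik(4)[OF k] _ P(4)[OF k] by (rule card_separated_le) (use l in auto)
    also have "\<dots> \<le> (2 * l / \<rho> k) ^ d"
      using Ik(4,6)[OF k] l by (intro power_mono) (auto simp: field_simps)
    finally show ?thesis using Ik(4)[OF k] by (simp add: N_def d_def power_divide field_simps)
  qed
  define J where "J = (SIGMA k:I. P k)"
  have finJ: "finite J" unfolding J_def using I P(1) by (intro finite_SigmaI) auto
  define Q where "Q = (\<lambda>j :: nat \<times> (real ^ 'd). cube (snd j) (r (fst j)))"
  have S_sub: "(\<Union>j\<in>J. Q j) \<subseteq> E k0 \<inter> cube a l"
  proof
    fix x assume "x \<in> (\<Union>j\<in>J. Q j)"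
    then obtain k y where k: "k \<in> I" "y \<in> P k" "x \<in> cube y (r k)" by (auto simp: J_def Q_def)
    have "y \<in> cube a (l / 2)" using P(2)[OF k(1)] k(2) by blast
    then have "x \<in> cube a l" by (rule cube_trans[OF k(3)]) (use Ik[OF k(1)] in linarith)
    moreover have "x \<in> E k0"
    proof -
      have "\<bar>x $ i - y $ i\<bar> < 2 * r k" for i
      proof -
        have "\<bar>x $ i - y $ i\<bar> \<le> r k" using k(3) by (simp add: cube_def)
        then show ?thesis using r_pos[of k] by linarith
      qed
      moreover have "y \<in> pts k" "k \<in> K \<inter> {k0..}" using P(3)[OF k(1)] k(2) Ik[OF k(1)] by auto
      ultimately show ?thesis unfolding E_def by blast
    qed
    ultimately show "x \<in> E k0 \<inter> cube a l" by simp
  qed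
  have M1: "\<kappa> * l ^ d * T \<le> (\<Sum>j\<in>J. measure lborel (Q j))"
  proof -
    have "\<kappa> * l ^ d * T = (\<Sum>k\<in>I. \<kappa> * l ^ d * \<Psi> k)" by (simp add: T_def sum_distrib_left)
    also have "\<dots> \<le> (\<Sum>k\<in>I. \<Sum>y\<in>P k. measure lborel (cube y (r k)))"
    proof (rule sum_mono)
      fix k assume k: "k \<in> I"
      have "\<kappa> * (l / 2) ^ d * (2 ^ d * \<Psi> k) \<le> real (card (P k)) * \<rho> k ^ d * (2 ^ d * \<Psi> k)"
        using P(5)[OF k] \<Psi>0[OF k] by (intro mult_right_mono) auto
      also have "\<dots> = (\<Sum>y\<in>P k. measure lborel (cube y (r k)))"
        using Ik[OF k] by (simp add: measure_cube d_def[symmetric] \<Psi>_def power_divide power_mult_distrib)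
      finally show "\<kappa> * l ^ d * \<Psi> k \<le> (\<Sum>y\<in>P k. measure lborel (cube y (r k)))"
        by (simp add: power_divide)
    qed
    also have "\<dots> = (\<Sum>j\<in>J. measure lborel (Q j))"
      unfolding J_def using I P(1) by (subst sum.Sigma) (auto simp: Q_def case_prod_beta)
    finally show ?thesis .
  qed
  define D where "D = 16 ^ d * N * (5 * T\<^sup>2)"
  have D: "D > 0" using N T by (simp add: D_def)
  have M2: "(\<Sum>i\<in>J. \<Sum>j\<in>J. measure lborel (Q i \<inter> Q j)) \<le> D"
  proof -
    define B where "B = (\<lambda>k k'. \<Sum>y\<in>P k. \<Sum>y'\<in>P k'. measure lborel (cube y (r k) \<inter> cube y' (r k')))"
    have B1: "B k k' \<le> 16 ^ d * N * (\<Psi> k * \<Psi> k' + \<Psi> k * (1 / 2) ^ (k' - k))" if "k \<in> I" "k' \<in> I" "k \<le> k'" for k k'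
      unfolding B_def \<Psi>_def d_def
      by (rule overlap_sum) (use that Ik P card_le in auto)
    have B2: "B k k' = B k' k" for k k'
      unfolding B_def by (subst sum.swap) (simp add: Int_commute)
    define c where "c = (\<lambda>k k' :: nat. if k \<le> k' then \<Psi> k * (1 / 2) ^ (k' - k) else 0)"
    have c0: "c k k' \<ge> 0" if "k \<in> I" "k' \<in> I" for k k' using \<Psi>0 that by (simp add: c_def)
    have B: "B k k' \<le> 16 ^ d * N * (\<Psi> k * \<Psi> k' + c k k' + c k' k)" if k: "k \<in> I" "k' \<in> I" for k k'
    proof (cases "k \<le> k'")
      case True
      have "B k k' \<le> 16 ^ d * N * (\<Psi> k * \<Psi> k' + \<Psi> k * (1 / 2) ^ (k' - k))" by (rule B1[OF k True])
      also have "\<dots> \<le> 16 ^ d * N * (\<Psi> k * \<Psi> k' + c k k' + c k' k)"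
        using N c0[OF k(2,1)] True by (intro mult_left_mono) (auto simp: c_def)
      finally show ?thesis .
    next
      case False
      have "B k k' \<le> 16 ^ d * N * (\<Psi> k' * \<Psi> k + \<Psi> k' * (1 / 2) ^ (k - k'))"
        unfolding B2[of k k'] using B1[OF k(2,1)] False by simp
      also have "\<dots> \<le> 16 ^ d * N * (\<Psi> k * \<Psi> k' + c k k' + c k' k)"
        using N c0[OF k] False by (intro mult_left_mono) (auto simp: c_def mult.commute)
      finally show ?thesis .
    qed
    have sum_c: "(\<Sum>k\<in>I. \<Sum>k'\<in>I. c k k') \<le> 2 * T"
    proof -
      have "(\<Sum>k'\<in>I. c k k') \<le> \<Psi> k * 2" if "k \<in> I" for k
      proof -
        have "(\<Sum>k'\<in>I. c k k') = (\<Sum>k'\<in>{j\<in>I. k \<le> j}. \<Psi> k * (1 / 2) ^ (k' - k))"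
          using I(1) by (intro sum.mono_neutral_cong_right) (auto simp: c_def)
        also have "\<dots> \<le> \<Psi> k * 2"
          unfolding sum_distrib_left[symmetric] using \<Psi>0[OF that] half_power_sum[OF I(1)] by (intro mult_left_mono)
        finally show ?thesis .
      qed
      then have "(\<Sum>k\<in>I. \<Sum>k'\<in>I. c k k') \<le> (\<Sum>k\<in>I. \<Psi> k * 2)" by (rule sum_mono)
      then show ?thesis by (simp add: T_def mult.commute flip: sum_distrib_right)
    qed
    have "(\<Sum>i\<in>J. \<Sum>j\<in>J. measure lborel (Q i \<inter> Q j)) = (\<Sum>k\<in>I. \<Sum>y\<in>P k. \<Sum>k'\<in>I. \<Sum>y'\<in>P k'. measure lborel (cube y (r k) \<inter> cube y' (r k')))"
    proof -
      have SS: "(\<Sum>j\<in>J. g (fst j) (snd j)) = (\<Sum>k\<in>I. \<Sum>y\<in>P k. g k y)" for g :: "nat \<Rightarrow> (real ^ 'd) \<Rightarrow> real"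
        unfolding J_def using I P(1) by (subst sum.Sigma) (auto simp: case_prod_beta)
      show ?thesis unfolding Q_def
        by (subst SS[of "\<lambda>k y. \<Sum>j\<in>J. measure lborel (cube y (r k) \<inter> cube (snd j) (r (fst j)))"])
           (intro sum.cong refl SS)
    qed
    also have "\<dots> = (\<Sum>k\<in>I. \<Sum>k'\<in>I. B k k')"
      unfolding B_def by (intro sum.cong refl) (rule sum.swap)
    also have "\<dots> \<le> (\<Sum>k\<in>I. \<Sum>k'\<in>I. 16 ^ d * N * (\<Psi> k * \<Psi> k' + c k k' + c k' k))"
      by (intro sum_mono B)
    also have "\<dots> = 16 ^ d * N * (T * T + (\<Sum>k\<in>I. \<Sum>k'\<in>I. c k k') + (\<Sum>k\<in>I. \<Sum>k'\<in>I. c k' k))"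
    proof -
      have "T * T = (\<Sum>k\<in>I. \<Sum>k'\<in>I. \<Psi> k * \<Psi> k')" by (simp only: T_def sum_product)
      then show ?thesis by (simp only: sum_distrib_left distrib_left sum.distrib)
    qed
    also have "(\<Sum>k\<in>I. \<Sum>k'\<in>I. c k' k) = (\<Sum>k\<in>I. \<Sum>k'\<in>I. c k k')" by (rule sum.swap)
    also have "16 ^ d * N * (T * T + (\<Sum>k\<in>I. \<Sum>k'\<in>I. c k k') + (\<Sum>k\<in>I. \<Sum>k'\<in>I. c k k')) \<le> D"
      unfolding D_def
    proof (intro mult_left_mono)
      have "1 * T \<le> T * T" using T by (intro mult_right_mono) auto
      then show "T * T + (\<Sum>k\<in>I. \<Sum>k'\<in>I. c k k') + (\<Sum>k\<in>I. \<Sum>k'\<in>I. c k k') \<le> 5 * T\<^sup>2"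
        using sum_c by (simp add: power2_eq_square)
    qed (use N in auto)
    finally show ?thesis .
  qed
  define M where "M = \<kappa> * l ^ d * T"
  have M: "M > 0" using \<kappa> l T by (simp add: M_def)
  \<comment> \<open>The optimal parameter in the second moment inequality; it yields the lower bound
    \<open>M\<^sup>2 / D\<close>.\<close>
  define t where "t = D / M"
  have t: "t > 0" using D M by (simp add: t_def)
  have "2 * t * M \<le> 2 * t * (\<Sum>j\<in>J. measure lborel (Q j))"
    using M1 t by (simp add: M_def)
  also have "\<dots> \<le> (\<Sum>i\<in>J. \<Sum>j\<in>J. measure lborel (Q i \<inter> Q j)) + t\<^sup>2 * measure lborel (\<Union>j\<in>J. Q j)"
    by (rule second_moment[OF finJ]) (simp add: Q_def)
  also have "\<dots> \<le> D + t\<^sup>2 * measure lborel (E k0 \<inter> cube a l)"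
  proof (intro add_mono M2 mult_left_mono measure_mono_fmeasurable S_sub)
    show "(\<Union>j\<in>J. Q j) \<in> sets lborel" using finJ by (intro sets.finite_UN) (auto simp: Q_def)
    have "cube a l \<inter> E k0 \<in> fmeasurable lborel" using open_E by (intro fmeasurable_Int_fmeasurable) auto
    then show "E k0 \<inter> cube a l \<in> fmeasurable lborel" by (simp add: Int_commute)
  qed auto
  finally have "D \<le> t\<^sup>2 * measure lborel (E k0 \<inter> cube a l)"
    using M by (simp add: t_def)
  then have "M\<^sup>2 / D \<le> measure lborel (E k0 \<inter> cube a l)"
    using D M by (simp add: t_def field_simps power2_eq_square)
  moreover have "\<kappa>\<^sup>2 / (10 * 64 ^ d) * l ^ d \<le> M\<^sup>2 / D"
  proof -
    have "(32::real) ^ d = 16 ^ d * 2 ^ d" by (simp flip: power_mult_distrib)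
    then have "M\<^sup>2 / D = \<kappa>\<^sup>2 / (5 * 32 ^ d) * l ^ d"
      using T l by (simp add: M_def D_def N_def power_mult_distrib power2_eq_square field_simps)
    moreover have "(32::real) ^ d \<le> 64 ^ d" "(0::real) < 64 ^ d" by (auto intro: power_mono)
    then have "5 * (32::real) ^ d \<le> 10 * 64 ^ d" by linarith
    then have "\<kappa>\<^sup>2 / (10 * 64 ^ d) \<le> \<kappa>\<^sup>2 / (5 * 32 ^ d)"
      by (intro divide_left_mono) auto
    then have "\<kappa>\<^sup>2 / (10 * 64 ^ d) * l ^ d \<le> \<kappa>\<^sup>2 / (5 * 32 ^ d) * l ^ d"
      using l by (intro mult_right_mono) auto
    ultimately show ?thesis by linarith
  qed
  ultimately show ?thesis unfolding d_def by linarith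
qed

lemma W_sets: "W \<in> sets borel"
  unfolding W_def using open_E by (intro sets.countable_INT'' borel_open) auto

lemma positive_proportion_W:
  assumes "s = real CARD('d)" "0 < l" "l \<le> 1" "\<And>i. \<bar>a $ i\<bar> \<le> R"
  shows "\<kappa>\<^sup>2 / (10 * 64 ^ CARD('d)) * l ^ CARD('d) \<le> measure lborel (W \<inter> cube a l)"
proof -
  have "(\<lambda>k. measure lborel (E k \<inter> cube a l)) \<longlonglongrightarrow> measure lborel (\<Inter>k. E k \<inter> cube a l)"
  proof (rule Lim_measure_decseq)
    show "range (\<lambda>k. E k \<inter> cube a l) \<subseteq> sets lborel" using open_E by auto
    show "decseq (\<lambda>k. E k \<inter> cube a l)" by (intro decseq_SucI) (auto simp: E_def)
    show "emeasure lborel (E k \<inter> cube a l) \<noteq> \<infinity>" for k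
    proof -
      have "cube a l \<inter> E k \<in> fmeasurable lborel" using open_E by (intro fmeasurable_Int_fmeasurable) auto
      then show ?thesis by (metis Int_commute fmeasurableD2 infinity_ennreal_def)
    qed
  qed
  moreover have "(\<Inter>k. E k \<inter> cube a l) = W \<inter> cube a l" by (auto simp: W_def)
  ultimately have "(\<lambda>k. measure lborel (E k \<inter> cube a l)) \<longlonglongrightarrow> measure lborel (W \<inter> cube a l)" by simp
  then show ?thesis
    by (rule LIMSEQ_le_const) (intro exI[of _ 0] allI impI positive_proportion_E assms)
qed

end

section \<open>Covers by small cubes with disjoint interiors\<close>

lemma covering_cubes:
  fixes Z G :: "(real ^ 'd::finite) set"
  assumes Z: "Z \<subseteq> cube 0 R" and R: "R > 0" and G: "open G" "Z \<subseteq> G" and \<delta>: "\<delta> > 0"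
  shows "\<exists>K :: nat \<Rightarrow> (real ^ 'd) set. Z \<subseteq> (\<Union>i. K i) \<and> (\<Union>i. K i) \<subseteq> G \<and>
    (\<forall>i. K i = {} \<or> (\<exists>a l. 0 < l \<and> l \<le> \<delta> \<and> K i = cube a l \<and> (\<forall>j. \<bar>a $ j\<bar> \<le> R))) \<and>
    disjoint_family (\<lambda>i. interior (K i))"
proof -
  define a b where "a = (0 - (\<chi> i. R) :: real ^ 'd)" and "b = (0 + (\<chi> i. R) :: real ^ 'd)"
  have ab: "cube 0 R = cbox a b" unfolding a_def b_def by (rule cube_eq_cbox)
  have box: "box a b \<noteq> {}" using R by (simp add: interval_ne_empty_cart a_def b_def)
  \<comment> \<open>Each interval of the cover lies in \<open>g x\<close> for some \<open>x\<close>
    in \<open>Z\<close>, hence in \<open>G\<close> and in a ball of radius \<open>\<delta>\<close>.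
    Outside \<open>G\<close> the value only has to keep \<open>g\<close> a gauge.\<close>
  define g where "g = (\<lambda>x. if x \<in> G then G \<inter> ball x \<delta> else ball x \<delta>)"
  have g: "gauge g" unfolding gauge_def g_def using G(1) \<delta> by auto
  obtain \<D> where \<D>: "countable \<D>" "\<Union>\<D> \<subseteq> cbox a b"
    "\<And>K. K \<in> \<D> \<Longrightarrow> interior K \<noteq> {} \<and> (\<exists>c d. K = cbox c d)"
    "pairwise (\<lambda>A B. interior A \<inter> interior B = {}) \<D>"
    "\<And>K. K \<in> \<D> \<Longrightarrow> \<exists>x \<in> Z \<inter> K. K \<subseteq> g x"
    "\<And>u v. cbox u v \<in> \<D> \<Longrightarrow> \<exists>n. \<forall>i \<in> Basis. v \<bullet> i - u \<bullet> i = (b \<bullet> i - a \<bullet> i) / 2^n"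
    "Z \<subseteq> \<Union>\<D>"
  proof (rule covering_lemma[OF Z[unfolded ab] box g])
    fix \<D> assume \<D>: "countable \<D>" "\<Union>\<D> \<subseteq> cbox a b"
      "\<And>K. K \<in> \<D> \<Longrightarrow> interior K \<noteq> {} \<and> (\<exists>c d. K = cbox c d)"
      "pairwise (\<lambda>A B. interior A \<inter> interior B = {}) \<D>"
      "\<And>K. K \<in> \<D> \<Longrightarrow> \<exists>x \<in> Z \<inter> K. K \<subseteq> g x"
      "\<And>u v. cbox u v \<in> \<D> \<Longrightarrow> \<exists>n. \<forall>i \<in> Basis. v \<bullet> i - u \<bullet> i = (b \<bullet> i - a \<bullet> i) / 2^n"
      "Z \<subseteq> \<Union>\<D>"
    show thesis by (rule that[OF \<D>])
  qed
  have cubes: "\<exists>c l. 0 < l \<and> l \<le> \<delta> \<and> K = cube c l \<and> (\<forall>j. \<bar>c $ j\<bar> \<le> R)" if K: "K \<in> \<D>" for K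
  proof -
    obtain u v where uv: "K = cbox u v" using \<D>(3)[OF K] by blast
    obtain n where n: "\<And>i. i \<in> Basis \<Longrightarrow> v \<bullet> i - u \<bullet> i = (b \<bullet> i - a \<bullet> i) / 2^n"
      using \<D>(6) K uv by blast
    define l where "l = R / 2 ^ n"
    have l: "l > 0" using R by (simp add: l_def)
    have vu: "v $ i - u $ i = 2 * l" for i
      using n[of "axis i 1"] by (simp add: axis_in_Basis_iff inner_axis a_def b_def l_def)
    define c where "c = (\<chi> i. u $ i + l)"
    have "u = c - (\<chi> i. l)" "v = c + (\<chi> i. l)"
      using vu by (auto simp: c_def vec_eq_iff algebra_simps)
    then have Kc: "K = cube c l" by (simp add: uv cube_eq_cbox)
    obtain x where x: "K \<subseteq> g x" using \<D>(5)[OF K] by blast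
    then have K_ball: "K \<subseteq> ball x \<delta>" by (auto simp: g_def split: if_splits)
    have uK: "u \<in> K" "v \<in> K" using vu l by (auto simp: uv mem_box_cart le_diff_eq) (smt (verit) l vu)+
    have "l \<le> \<delta>"
    proof -
      have "dist u v \<le> dist x u + dist x v" using dist_triangle[of u v x] by (simp add: dist_commute)
      moreover have "dist x u < \<delta>" "dist x v < \<delta>" using uK K_ball by auto
      moreover have "2 * l \<le> dist u v"
        using component_le_norm_cart[of "v - u" undefined] vu[of undefined] l by (simp add: dist_norm norm_minus_commute)
      ultimately show ?thesis by linarith
    qed
    moreover have "\<bar>c $ j\<bar> \<le> R" for j
    proof -
      have "c \<in> K" using l by (simp add: Kc cube_def)
      then have "c \<in> cube 0 R" using \<D>(2) K ab by blast
      then show ?thesis by (simp add: cube_def)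
    qed
    ultimately show ?thesis using l Kc by blast
  qed
  define N where "N = to_nat_on \<D> ` \<D>"
  define K where "K = (\<lambda>i. if i \<in> N then from_nat_into \<D> i else {})"
  have K_in: "K i \<in> \<D>" if "i \<in> N" for i
    using that \<D>(1) by (auto simp: K_def N_def)
  have K_to_nat: "K (to_nat_on \<D> A) = A" if "A \<in> \<D>" for A
    using that \<D>(1) by (simp add: K_def N_def)
  have K_empty: "K i = {}" if "i \<notin> N" for i using that by (simp add: K_def)
  have UK: "(\<Union>i. K i) = \<Union>\<D>"
  proof
    show "(\<Union>i. K i) \<subseteq> \<Union>\<D>" using K_in K_empty by blast
    show "\<Union>\<D> \<subseteq> (\<Union>i. K i)" using K_to_nat by blast
  qed
  show ?thesis
  proof (intro exI[of _ K] conjI allI)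
    show "Z \<subseteq> (\<Union>i. K i)" using UK \<D>(7) by simp
    have "A \<subseteq> G" if A: "A \<in> \<D>" for A
    proof -
      obtain x where x: "x \<in> Z" "A \<subseteq> g x" using \<D>(5)[OF A] by blast
      then have "g x = G \<inter> ball x \<delta>" using G(2) by (auto simp: g_def)
      then show ?thesis using x(2) by blast
    qed
    then show "(\<Union>i. K i) \<subseteq> G" unfolding UK by blast
    show "K i = {} \<or> (\<exists>a l. 0 < l \<and> l \<le> \<delta> \<and> K i = cube a l \<and> (\<forall>j. \<bar>a $ j\<bar> \<le> R))" for i
      using cubes[OF K_in, of i] K_empty[of i] by blast
    show "disjoint_family (\<lambda>i. interior (K i))"
      unfolding disjoint_family_on_def
    proof (intro ballI impI)
      fix i j :: nat assume "i \<noteq> j"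
      show "interior (K i) \<inter> interior (K j) = {}"
      proof (cases "i \<in> N \<and> j \<in> N")
        case True
        then obtain A B where AB: "A \<in> \<D>" "i = to_nat_on \<D> A" "B \<in> \<D>" "j = to_nat_on \<D> B" by (auto simp: N_def)
        then have "A \<noteq> B" using \<open>i \<noteq> j\<close> by blast
        then show ?thesis using AB K_to_nat \<D>(4) by (simp add: pairwise_def)
      next
        case False
        then show ?thesis using K_empty by fastforce
      qed
    qed
  qed
qed

lemma emeasure_cube_boundary: "emeasure lborel (cube a l - interior (cube a l)) = 0"
  for a :: "real ^ 'd::finite"
proof -
  have "emeasure lborel (cube a l - interior (cube a l)) = emeasure lborel (cube a l) - emeasure lborel (interior (cube a l))"
    using interior_subset[of "cube a l"]
    by (intro emeasure_Diff) (auto simp: cube_eq_cbox interior_cbox emeasure_lborel_box_eq)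
  also have "\<dots> = 0"
    by (simp add: cube_eq_cbox interior_cbox emeasure_lborel_box_eq emeasure_lborel_cbox_eq)
  finally show ?thesis .
qed

lemma emeasure_cube_interior:
  fixes a :: "real ^ 'd::finite"
  assumes "V \<in> sets borel"
  shows "emeasure lborel (V \<inter> cube a l) = emeasure lborel (interior (cube a l) \<inter> V)"
proof (rule antisym)
  have "emeasure lborel (V \<inter> cube a l) \<le> emeasure lborel ((interior (cube a l) \<inter> V) \<union> (cube a l - interior (cube a l)))"
    using assms by (intro emeasure_mono) (auto intro!: sets.Un sets.Diff sets.Int)
  also have "\<dots> \<le> emeasure lborel (interior (cube a l) \<inter> V) + emeasure lborel (cube a l - interior (cube a l))"
    using assms by (intro emeasure_subadditive) auto
  finally show "emeasure lborel (V \<inter> cube a l) \<le> emeasure lborel (interior (cube a l) \<inter> V)"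
    by (simp add: emeasure_cube_boundary)
  show "emeasure lborel (interior (cube a l) \<inter> V) \<le> emeasure lborel (V \<inter> cube a l)"
    using assms interior_subset[of "cube a l"] by (intro emeasure_mono) auto
qed

lemma borel_outer_open:
  fixes Z :: "'a::euclidean_space set"
  assumes "Z \<in> sets borel" "e > 0"
  shows "\<exists>G. open G \<and> Z \<subseteq> G \<and> emeasure lborel (G - Z) < ennreal e"
proof -
  have "Z \<in> sets lebesgue" using assms(1) by simp
  then show ?thesis
  proof (rule sets_lebesgue_outer_open[OF _ assms(2)])
    fix G assume G: "open G" "Z \<subseteq> G" "emeasure lebesgue (G - Z) < ennreal e"
    have "G - Z \<in> sets lborel" using G(1) assms(1) by auto
    then have "emeasure lborel (G - Z) < ennreal e" using G(3) by simp
    then show ?thesis using G by blast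
  qed
qed

text \<open>A substitute for Lebesgue's density theorem.\<close>

lemma null_complement_if_positive_proportion:
  fixes V :: "(real ^ 'd::finite) set"
  assumes V: "V \<in> sets borel" and c: "c > 0" and R: "R > 0"
    and dense: "\<And>a l. 0 < l \<Longrightarrow> l \<le> 1 \<Longrightarrow> (\<And>i. \<bar>a $ i\<bar> \<le> R) \<Longrightarrow> c * l ^ CARD('d) \<le> measure lborel (V \<inter> cube a l)"
  shows "emeasure lborel (cube 0 R - V) = 0"
proof (rule ccontr)
  define d where "d = CARD('d)"
  let ?Z = "cube 0 R - V"
  assume ne: "emeasure lborel ?Z \<noteq> 0"
  have Z_sets: "?Z \<in> sets borel" using V by auto
  define c' where "c' = c / 2 ^ d"
  have c': "c' > 0" using c by (simp add: c'_def)
  have fin: "?Z \<in> fmeasurable lborel" using V by (intro fmeasurable_Diff) auto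
  define z where "z = measure lborel ?Z"
  have z: "emeasure lborel ?Z = ennreal z" using fin by (simp add: z_def emeasure_eq_measure2)
  have "z > 0" using ne z by (metis ennreal_0 less_eq_real_def measure_nonneg z_def)
  \<comment> \<open>Cubes with disjoint interiors cover \<open>?Z\<close> inside \<open>G\<close>,
    and \<open>V\<close> has share at least \<open>c'\<close> in each. So \<open>V\<close> has
    measure at least \<open>c' * z\<close> in \<open>G\<close>, more than the measure of
    \<open>G - ?Z\<close>, which contains that part of \<open>V\<close>. The factor
    \<open>2 ^ d\<close> in \<open>c'\<close> is there because \<open>cube a l\<close> has side
    \<open>2 * l\<close>.\<close>
  then have "c' * z > 0" using c' by simp
  then obtain G where G: "open G" "?Z \<subseteq> G" and GZ: "emeasure lborel (G - ?Z) < ennreal (c' * z)"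
    using borel_outer_open[OF Z_sets] by blast
  obtain K :: "nat \<Rightarrow> (real ^ 'd) set" where K': "?Z \<subseteq> (\<Union>i. K i) \<and> (\<Union>i. K i) \<subseteq> G \<and>
    (\<forall>i. K i = {} \<or> (\<exists>a l. 0 < l \<and> l \<le> 1 \<and> K i = cube a l \<and> (\<forall>j. \<bar>a $ j\<bar> \<le> R))) \<and>
    disjoint_family (\<lambda>i. interior (K i))"
    using covering_cubes[OF Diff_subset R G(1,2) zero_less_one] by (elim exE) rule
  note K = K'[THEN conjunct1] K'[THEN conjunct2, THEN conjunct1]
    K'[THEN conjunct2, THEN conjunct2, THEN conjunct1, rule_format] K'[THEN conjunct2, THEN conjunct2, THEN conjunct2]
  have K_sets: "K i \<in> sets borel" for i using K(3)[of i] by auto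
  have piece: "ennreal c' * emeasure lborel (K i) \<le> emeasure lborel (interior (K i) \<inter> V)" for i
  proof (cases "K i = {}")
    case False
    then obtain a l where al: "0 < l" "l \<le> 1" "K i = cube a l" "\<And>j. \<bar>a $ j\<bar> \<le> R" using K(3)[of i] by blast
    have "cube a l \<inter> V \<in> fmeasurable lborel" using V by (intro fmeasurable_Int_fmeasurable) auto
    then have Vf: "V \<inter> cube a l \<in> fmeasurable lborel" by (simp add: Int_commute)
    have "ennreal c' * emeasure lborel (K i) = ennreal (c * l ^ d)"
      using al c' by (simp add: emeasure_eq_measure2 measure_cube c'_def d_def power_mult_distrib flip: ennreal_mult)
    also have "\<dots> \<le> ennreal (measure lborel (V \<inter> cube a l))"
      unfolding d_def by (intro ennreal_leI dense al)
    also have "\<dots> = emeasure lborel (V \<inter> cube a l)" using Vf by (simp add: emeasure_eq_measure2)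
    also have "\<dots> = emeasure lborel (interior (K i) \<inter> V)" unfolding al(3) by (rule emeasure_cube_interior[OF V])
    finally show ?thesis .
  qed simp
  have "ennreal (c' * z) = ennreal c' * emeasure lborel ?Z" using c' \<open>z > 0\<close> by (simp add: z ennreal_mult)
  also have "\<dots> \<le> ennreal c' * emeasure lborel (\<Union>i. K i)"
    using K(1) K_sets by (intro mult_left_mono emeasure_mono) auto
  also have "\<dots> \<le> ennreal c' * (\<Sum>i. emeasure lborel (K i))"
    using K_sets by (intro mult_left_mono emeasure_subadditive_countably) auto
  also have "\<dots> = (\<Sum>i. ennreal c' * emeasure lborel (K i))" by simp
  also have "\<dots> \<le> (\<Sum>i. emeasure lborel (interior (K i) \<inter> V))" by (intro suminf_le piece) auto
  also have "\<dots> = emeasure lborel (\<Union>i. interior (K i) \<inter> V)"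
  proof (rule suminf_emeasure)
    show "disjoint_family (\<lambda>i. interior (K i) \<inter> V)" using K(4) by (auto simp: disjoint_family_on_def)
  qed (use V in auto)
  also have "\<dots> \<le> emeasure lborel (G - ?Z)"
  proof (intro emeasure_mono)
    show "(\<Union>i. interior (K i) \<inter> V) \<subseteq> G - ?Z" using K(2) interior_subset by blast
  qed (use G(1) Z_sets in auto)
  also have "\<dots> < ennreal (c' * z)" by (rule GZ)
  finally show False by simp
qed

section \<open>Lipschitz images of null sets\<close>

lemma hausdorff_delta_countable_null:
  assumes "\<And>n::nat. hausdorff_delta s \<delta> (X n) = 0"
  shows "hausdorff_delta s \<delta> (\<Union>n. X n) = 0"
proof -
  have le: "hausdorff_delta s \<delta> (\<Union>n. X n) \<le> 0 + ennreal e" if e: "e > 0" for e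
  proof -
    have "\<exists>U. X n \<subseteq> (\<Union>i. U i) \<and> (\<forall>i::nat. bounded (U i) \<and> diameter (U i) \<le> \<delta>) \<and> (\<Sum>i. ennreal (diam_pow s (U i))) < ennreal (e * (1 / 2) ^ Suc n)" for n
    proof -
      have "hausdorff_delta s \<delta> (X n) < ennreal (e * (1 / 2) ^ Suc n)" unfolding assms using e by simp
      then show ?thesis unfolding hausdorff_delta_def INF_less_iff by blast
    qed
    then obtain U where U: "\<And>n. X n \<subseteq> (\<Union>i. U n i)" "\<And>n i. bounded (U n i)" "\<And>n i. diameter (U n i) \<le> \<delta>"
      "\<And>n::nat. (\<Sum>i::nat. ennreal (diam_pow s (U n i))) < ennreal (e * (1 / 2) ^ Suc n)" by metis
    define V where "V = (\<lambda>k. U (fst (prod_decode k)) (snd (prod_decode k)))"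
    have "(\<Union>n. X n) \<subseteq> (\<Union>k. V k)"
    proof
      fix x assume "x \<in> (\<Union>n. X n)"
      then obtain n i where "x \<in> U n i" using U(1) by blast
      then have "x \<in> V (prod_encode (n, i))" by (simp add: V_def)
      then show "x \<in> (\<Union>k. V k)" by blast
    qed
    then have "hausdorff_delta s \<delta> (\<Union>n. X n) \<le> (\<Sum>k. ennreal (diam_pow s (V k)))"
      unfolding hausdorff_delta_def by (intro INF_lower) (auto simp: V_def U)
    also have "\<dots> = (\<Sum>n. \<Sum>i. ennreal (diam_pow s (U n i)))"
      unfolding V_def by (rule suminf_ennreal_2dimen[of _ "\<lambda>p. ennreal (diam_pow s (U (fst p) (snd p)))"]) simp
    also have "\<dots> \<le> (\<Sum>n. ennreal (e * (1 / 2) ^ Suc n))"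
      using U(4) by (intro suminf_le) (auto intro: less_imp_le)
    also have "\<dots> = ennreal e"
    proof (rule suminf_ennreal_eq)
      show "(\<lambda>n. e * (1 / 2) ^ Suc n) sums e" using sums_mult[OF power_half_series, of e] by simp
    qed (use e in simp)
    finally show ?thesis by simp
  qed
  have "hausdorff_delta s \<delta> (\<Union>n. X n) \<le> 0" by (rule ennreal_le_epsilon) (rule le)
  then show ?thesis by simp
qed

text \<open>A bounded null set is covered by small cubes with disjoint interiors and small total
  volume. The image of a cube has diameter at most a constant times its side, so the
  \<open>d\<close>-th power of this diameter is at most \<open>C\<close> times the volume. Countably
  many bounded pieces give the general case.\<close>

lemma hausdorff_measure_lipschitz_null:
  fixes Z :: "(real ^ 'd::finite) set" and \<phi> :: "real ^ 'd \<Rightarrow> 'b::metric_space"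
  assumes Z: "Z \<in> null_sets lborel" and lip: "\<And>x y. dist (\<phi> x) (\<phi> y) \<le> B * dist x y" and B: "B > 0"
  shows "hausdorff_measure (real CARD('d)) (\<phi> ` Z) = 0"
proof -
  define d where "d = CARD('d)"
  have d: "d \<ge> 1" by (simp add: d_def Suc_leI)
  have bounded_case: "hausdorff_delta (real d) \<delta> (\<phi> ` Z') = 0"
    if \<delta>: "\<delta> > 0" and R: "R > 0" and Z': "Z' \<in> null_sets lborel" "Z' \<subseteq> cube 0 R" for \<delta> R Z'
  proof -
    define C where "C = (B * real d) ^ d"
    have C: "C > 0" using B d by (simp add: C_def)
    have le: "hausdorff_delta (real d) \<delta> (\<phi> ` Z') \<le> 0 + ennreal e" if e: "e > 0" for e
    proof -
      have Z'_sets: "Z' \<in> sets borel" using null_setsD2[OF Z'(1)] by simp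
      have "e / C > 0" using e C by simp
      then obtain G where G: "open G" "Z' \<subseteq> G" "emeasure lborel (G - Z') < ennreal (e / C)"
        using borel_outer_open[OF Z'_sets] by blast
      have "emeasure lborel G \<le> ennreal (e / C)"
        using G emeasure_Diff_null_set[OF Z'(1), of G] by simp
      define \<delta>' where "\<delta>' = \<delta> / (2 * B * real d)"
      have \<delta>': "\<delta>' > 0" using \<delta> B d by (simp add: \<delta>'_def)
      obtain K :: "nat \<Rightarrow> (real ^ 'd) set" where K': "Z' \<subseteq> (\<Union>i. K i) \<and> (\<Union>i. K i) \<subseteq> G \<and>
        (\<forall>i. K i = {} \<or> (\<exists>a l. 0 < l \<and> l \<le> \<delta>' \<and> K i = cube a l \<and> (\<forall>j. \<bar>a $ j\<bar> \<le> R))) \<and>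
        disjoint_family (\<lambda>i. interior (K i))"
        using covering_cubes[OF Z'(2) R G(1,2) \<delta>'] by (elim exE) rule
      note K = K'[THEN conjunct1] K'[THEN conjunct2, THEN conjunct1]
        K'[THEN conjunct2, THEN conjunct2, THEN conjunct1, rule_format] K'[THEN conjunct2, THEN conjunct2, THEN conjunct2]
      have piece: "bounded (\<phi> ` K i) \<and> diameter (\<phi> ` K i) \<le> \<delta> \<and> ennreal (diam_pow (real d) (\<phi> ` K i)) \<le> ennreal C * emeasure lborel (interior (K i))" for i
      proof (cases "K i = {}")
        case True
        then show ?thesis using \<delta> by (simp add: diam_pow_def)
      next
        case False
        then obtain a l where al: "0 < l" "l \<le> \<delta>'" "K i = cube a l" using K(3)[of i] by blast
        have dist_le: "dist p q \<le> B * (2 * real d * l)" if pq: "p \<in> \<phi> ` K i" "q \<in> \<phi> ` K i" for p q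
        proof -
          obtain x y where xy: "x \<in> cube a l" "y \<in> cube a l" "p = \<phi> x" "q = \<phi> y" using pq al by blast
          have "dist x y \<le> dist x a + dist y a" using dist_triangle[of x y a] by (simp add: dist_commute)
          also have "\<dots> \<le> 2 * real d * l" using dist_le_cube[OF xy(1)] dist_le_cube[OF xy(2)] by (simp add: d_def)
          finally have "B * dist x y \<le> B * (2 * real d * l)" using B by (intro mult_left_mono) auto
          then show ?thesis using lip[of x y] xy by simp
        qed
        have bd: "bounded (\<phi> ` K i)" using dist_le False unfolding bounded_def by blast
        have dm: "diameter (\<phi> ` K i) \<le> B * (2 * real d * l)"
        proof (rule order.trans[OF _ order.refl])
          show "diameter (\<phi> ` K i) \<le> B * (2 * real d * l)"
            unfolding diameter_def using False dist_le by (auto intro!: cSUP_least)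
        qed
        also have "\<dots> \<le> B * (2 * real d * \<delta>')" using al B by (intro mult_left_mono) auto
        also have "\<dots> = \<delta>" using B d by (simp add: \<delta>'_def)
        finally have dm\<delta>: "diameter (\<phi> ` K i) \<le> \<delta>" .
        have "diam_pow (real d) (\<phi> ` K i) = diameter (\<phi> ` K i) powr real d"
          using False d by (simp add: diam_pow_def)
        also have "\<dots> \<le> (B * (2 * real d * l)) powr real d"
          using dm diameter_ge_0[OF bd] by (intro powr_mono2) auto
        also have "\<dots> = C * (2 * l) ^ d" using B d al by (simp add: powr_realpow C_def power_mult_distrib mult_ac)
        finally have "ennreal (diam_pow (real d) (\<phi> ` K i)) \<le> ennreal (C * (2 * l) ^ d)" by (rule ennreal_leI)
        also have "\<dots> = ennreal C * emeasure lborel (cube a l)"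
          using al C by (simp add: emeasure_eq_measure2 measure_cube d_def ennreal_mult)
        also have "emeasure lborel (cube a l) = emeasure lborel (interior (K i))"
          using emeasure_cube_interior[of UNIV a l] al(3) by simp
        finally show ?thesis using bd dm\<delta> by simp
      qed
      have "hausdorff_delta (real d) \<delta> (\<phi> ` Z') \<le> (\<Sum>i. ennreal (diam_pow (real d) (\<phi> ` K i)))"
        unfolding hausdorff_delta_def
      proof (rule INF_lower)
        have "\<phi> ` Z' \<subseteq> (\<Union>i. \<phi> ` K i)" using image_mono[OF K(1), of \<phi>] by (simp add: image_UN)
        then show "(\<lambda>i. \<phi> ` K i) \<in> {U. \<phi> ` Z' \<subseteq> \<Union> (range U) \<and> (\<forall>i. bounded (U i) \<and> diameter (U i) \<le> \<delta>)}"
          using piece by simp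
      qed
      also have "\<dots> \<le> (\<Sum>i. ennreal C * emeasure lborel (interior (K i)))" using piece by (intro suminf_le) auto
      also have "\<dots> = ennreal C * emeasure lborel (\<Union>i. interior (K i))"
      proof -
        have "(\<Sum>i. emeasure lborel (interior (K i))) = emeasure lborel (\<Union>i. interior (K i))"
          using K(4) by (intro suminf_emeasure) auto
        then show ?thesis by (simp only: ennreal_suminf_cmult)
      qed
      also have "\<dots> \<le> ennreal C * ennreal (e / C)"
      proof (rule mult_left_mono)
        have "emeasure lborel (\<Union>i. interior (K i)) \<le> emeasure lborel G"
          using K(2) interior_subset G(1) by (intro emeasure_mono) (blast, auto)
        then show "emeasure lborel (\<Union>i. interior (K i)) \<le> ennreal (e / C)"
          using \<open>emeasure lborel G \<le> ennreal (e / C)\<close> by simp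
      qed simp
      also have "\<dots> = ennreal e" using C e by (simp flip: ennreal_mult)
      finally show ?thesis by simp
    qed
    have "hausdorff_delta (real d) \<delta> (\<phi> ` Z') \<le> 0" by (rule ennreal_le_epsilon) (rule le)
    then show ?thesis by simp
  qed
  have "hausdorff_delta (real d) \<delta> (\<phi> ` Z) = 0" if \<delta>: "\<delta> > 0" for \<delta>
  proof -
    have "hausdorff_delta (real d) \<delta> (\<phi> ` (Z \<inter> cube 0 (real (Suc n)))) = 0" for n
    proof (rule bounded_case[OF \<delta>])
      show "Z \<inter> cube 0 (real (Suc n)) \<in> null_sets lborel" using Z by (intro null_set_Int2) auto
    qed auto
    then have "hausdorff_delta (real d) \<delta> (\<Union>n. \<phi> ` (Z \<inter> cube 0 (real (Suc n)))) = 0"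
      by (rule hausdorff_delta_countable_null)
    moreover have "(\<Union>n. Z \<inter> cube 0 (real (Suc n))) = Z"
    proof -
      have "\<exists>n. x \<in> cube 0 (real (Suc n))" for x :: "real ^ 'd"
      proof -
        obtain n where n: "norm x \<le> real n" using real_arch_simple by blast
        have "\<bar>x $ i\<bar> \<le> real (Suc n)" for i using component_le_norm_cart[of x i] n by simp
        then show ?thesis by (auto simp: cube_def)
      qed
      then show ?thesis by blast
    qed
    ultimately show ?thesis by (metis image_UN)
  qed
  then show ?thesis unfolding hausdorff_measure_def d_def[symmetric] by (simp add: SUP_eq_const bot_ennreal)
qed

section \<open>Approximation on affine subspaces\<close>

lemma dist_nearest_int_less_iff:
  "dist_nearest_int y < e \<longleftrightarrow> (\<exists>z\<in>integer_vectors. infnorm (y - z) < e)" for y :: "real ^ 'n::finite"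
  unfolding dist_nearest_int_def
proof (rule cINF_less_iff)
  have "(0 :: real ^ 'n) \<in> integer_vectors" by (simp add: integer_vectors_def)
  then show "integer_vectors \<noteq> ({} :: (real ^ 'n) set)" by blast
  show "bdd_below ((\<lambda>z. infnorm (y - z)) ` integer_vectors)"
    by (rule bdd_belowI2[of _ 0]) (rule infnorm_pos_le)
qed

lemma infnorm_less_cart: "(\<And>i. \<bar>x $ i\<bar> < e) \<Longrightarrow> infnorm x < e" for x :: "real ^ 'n::finite"
  unfolding infnorm_Max by (subst Max_less_iff) (auto simp: Basis_vec_def inner_axis)

lemma dist_nearest_int_lessI:
  fixes y :: "real ^ 'n::finite"
  assumes "\<And>i. \<exists>z::int. \<bar>y $ i - of_int z\<bar> < e"
  shows "dist_nearest_int y < e"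
proof -
  obtain z :: "'n \<Rightarrow> int" where z: "\<And>i. \<bar>y $ i - of_int (z i)\<bar> < e" using assms by metis
  have "(\<chi> i. of_int (z i)) \<in> integer_vectors" by (simp add: integer_vectors_def)
  moreover have "infnorm (y - (\<chi> i. of_int (z i))) < e"
    using z by (intro infnorm_less_cart) simp
  ultimately show ?thesis unfolding dist_nearest_int_less_iff by blast
qed

lemma dist_nearest_int_scale:
  fixes y :: "real ^ 'n::finite"
  assumes "dist_nearest_int y < e" "t \<ge> 1"
  shows "dist_nearest_int (real t *\<^sub>R y) < real t * e"
proof -
  obtain z where z: "z \<in> integer_vectors" "infnorm (y - z) < e" using assms(1) by (auto simp: dist_nearest_int_less_iff)
  have "real t *\<^sub>R z \<in> integer_vectors" using z(1) by (auto simp: integer_vectors_def)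
  moreover have "infnorm (real t *\<^sub>R y - real t *\<^sub>R z) < real t * e"
    using z(2) assms(2) by (simp flip: scaleR_diff_right add: infnorm_mul)
  ultimately show ?thesis unfolding dist_nearest_int_less_iff by blast
qed

text \<open>Only finitely many vectors beat the exponent \<open>\<sigma>\<close>. No nonzero integer
  vector has distance 0, since then all its multiples would beat it; so the minimum of the distances
  over the nonzero exceptions, and 1, is a valid constant.\<close>

lemma diophantine_exponent_bound:
  fixes A :: "real ^ 'm::finite ^ 'k::finite"
  assumes \<omega>: "diophantine_exponent A = ereal \<omega>" and \<sigma>: "\<omega> < \<sigma>" "0 < \<sigma>"
  shows "\<exists>c>0. \<forall>q\<in>integer_vectors. q \<noteq> 0 \<longrightarrow> (\<forall>M\<ge>1. infnorm q \<le> M \<longrightarrow> c * M powr (-\<sigma>) \<le> dist_nearest_int (A *v q))"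
proof -
  define B where "B = {q \<in> integer_vectors. dist_nearest_int (A *v q) < infnorm q powr (- \<sigma>)}"
  have fin: "finite B"
  proof (rule ccontr)
    assume "infinite B"
    then have "ereal \<sigma> \<le> diophantine_exponent A"
      unfolding diophantine_exponent_def B_def by (intro Sup_upper) auto
    then show False using \<omega> \<sigma> by simp
  qed
  have pos: "dist_nearest_int (A *v q) > 0" if q: "q \<in> integer_vectors" "q \<noteq> 0" for q
  proof (rule ccontr)
    assume "\<not> dist_nearest_int (A *v q) > 0"
    have "real t *\<^sub>R q \<in> B" if t: "t \<ge> 1" for t
    proof -
      define e where "e = infnorm (real t *\<^sub>R q) powr (-\<sigma>)"
      have "infnorm (real t *\<^sub>R q) \<noteq> 0" using q t by (simp add: infnorm_eq_0)
      then have "e > 0" by (simp add: e_def)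
      then have "dist_nearest_int (A *v q) < e / real t" using \<open>\<not> dist_nearest_int (A *v q) > 0\<close> t
        by (smt (verit) divide_pos_pos of_nat_0_less_iff less_le_trans zero_less_one)
      from dist_nearest_int_scale[OF this t] have "dist_nearest_int (A *v (real t *\<^sub>R q)) < e"
        using t by (simp add: matrix_vector_mult_scaleR)
      moreover have "real t *\<^sub>R q \<in> integer_vectors" using q(1) by (auto simp: integer_vectors_def)
      ultimately show ?thesis by (simp add: B_def e_def)
    qed
    then have "(\<lambda>t. real t *\<^sub>R q) ` {1..} \<subseteq> B" by auto
    moreover have "inj_on (\<lambda>t::nat. real t *\<^sub>R q) {1..}" using q(2) by (auto simp: inj_on_def)
    ultimately have "finite {1::nat..}" using fin by (meson finite_imageD finite_subset)
    then show False using infinite_Ici by blast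
  qed
  define c where "c = Min (insert 1 ((\<lambda>q. dist_nearest_int (A *v q)) ` (B - {0})))"
  have c_le: "c \<le> 1" "\<And>q. q \<in> B - {0} \<Longrightarrow> c \<le> dist_nearest_int (A *v q)"
    unfolding c_def using fin by (auto intro!: Min_le)
  have "c \<in> insert 1 ((\<lambda>q. dist_nearest_int (A *v q)) ` (B - {0}))"
    unfolding c_def using fin by (intro Min_in) auto
  then have c_pos: "c > 0" using pos by (auto simp: B_def)
  have "c * M powr (-\<sigma>) \<le> dist_nearest_int (A *v q)"
    if q: "q \<in> integer_vectors" "q \<noteq> 0" and M: "M \<ge> 1" "infnorm q \<le> M" for q M
  proof (cases "q \<in> B")
    case True
    have "M powr (-\<sigma>) \<le> 1" using M(1) \<sigma>(2) powr_mono[of "-\<sigma>" 0 M] by simp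
    then have "c * M powr (-\<sigma>) \<le> c" using c_pos by (simp add: mult_left_le)
    also have "\<dots> \<le> dist_nearest_int (A *v q)" using c_le(2) True q(2) by blast
    finally show ?thesis .
  next
    case False
    have "infnorm q > 0" using q(2) by (simp add: infnorm_pos_lt)
    have "c * M powr (-\<sigma>) \<le> 1 * M powr (-\<sigma>)" using c_le by (intro mult_right_mono) auto
    also have "\<dots> \<le> infnorm q powr (-\<sigma>)"
      using M \<open>infnorm q > 0\<close> \<sigma>(2) by (simp add: powr_mono2')
    also have "\<dots> \<le> dist_nearest_int (A *v q)" using False q by (simp add: B_def)
    finally show ?thesis .
  qed
  then show ?thesis using c_pos by blast
qed

text \<open>The exponent bounds from below the distance of \<open>A j\<close> to the integer vectors
  for every nonzero \<open>j\<close> in a box, which is the spacing hypothesis of the counting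
  lemma.\<close>

lemma lattice_count_exponent:
  fixes A :: "real ^ 'm::finite ^ ('d::finite) option"
  assumes \<omega>: "diophantine_exponent A = ereal \<omega>" and \<sigma>: "\<omega> < \<sigma>" "real CARD('m) < \<sigma>"
  shows "\<exists>C. lattice_count (\<lambda>i l. A $ i $ l) \<sigma> C"
proof -
  have \<sigma>0: "\<sigma> > 0" using \<sigma>(2) by (rule le_less_trans[rotated]) simp
  obtain c where c: "c > 0" "\<And>q M. q \<in> integer_vectors \<Longrightarrow> q \<noteq> 0 \<Longrightarrow> M \<ge> 1 \<Longrightarrow> infnorm q \<le> M \<Longrightarrow> c * M powr (-\<sigma>) \<le> dist_nearest_int (A *v q)"
    using diophantine_exponent_bound[OF \<omega> \<sigma>(1) \<sigma>0] by blast
  have sep: "\<exists>i. \<forall>z::int. c * real M powr (-\<sigma>) \<le> \<bar>(\<Sum>l\<in>UNIV. A $ i $ l * of_int (j l)) - of_int z\<bar>"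
    if j: "j \<noteq> (\<lambda>_. 0)" "\<And>l. \<bar>j l\<bar> \<le> int M" for j :: "'m \<Rightarrow> int" and M
  proof (rule ccontr)
    assume no: "\<not> ?thesis"
    define q where "q = ((\<chi> l. of_int (j l)) :: real ^ 'm)"
    have q: "q \<in> integer_vectors" "q \<noteq> 0" using j(1) by (auto simp: q_def integer_vectors_def vec_eq_iff fun_eq_iff)
    obtain l where "j l \<noteq> 0" using j(1) by (auto simp: fun_eq_iff)
    then have M: "M \<ge> 1" using j(2)[of l] by linarith
    have "\<bar>real_of_int (j l)\<bar> \<le> real M" for l using j(2)[of l] by linarith
    then have "infnorm q \<le> real M"
      unfolding infnorm_Max by (subst Max_le_iff) (auto simp: Basis_vec_def inner_axis q_def)
    then have "c * real M powr (-\<sigma>) \<le> dist_nearest_int (A *v q)" using M q by (intro c(2)) auto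
    moreover have "dist_nearest_int (A *v q) < c * real M powr (-\<sigma>)"
      using no by (intro dist_nearest_int_lessI) (auto simp: q_def matrix_vector_mult_def not_le)
    ultimately show False by simp
  qed
  have "\<exists>C>0. \<forall>h\<ge>1. \<forall>\<delta>>0. \<forall>S. finite S \<longrightarrow>
     (\<forall>a\<in>S. \<forall>b\<in>S. \<forall>i. \<bar>real_of_int (a i - b i)\<bar> \<le> h) \<longrightarrow>
     (\<forall>a\<in>S. \<forall>l. \<exists>z::int. \<bar>(\<Sum>i\<in>UNIV. of_int (a i) * (A $ i $ l)) - of_int z\<bar> < \<delta>) \<longrightarrow>
     real (card S) \<le> C * (h ^ CARD('d option) * \<delta> ^ CARD('m) + h powr (real CARD('d option) - real CARD('m) / \<sigma>))"
    by (rule count_near_integral[OF \<sigma>0 c(1)], rule sep)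
  then obtain C where C: "C > 0" "\<forall>h\<ge>1. \<forall>\<delta>>0. \<forall>S. finite S \<longrightarrow>
     (\<forall>a\<in>S. \<forall>b\<in>S. \<forall>i. \<bar>real_of_int (a i - b i)\<bar> \<le> h) \<longrightarrow>
     (\<forall>a\<in>S. \<forall>l. \<exists>z::int. \<bar>(\<Sum>i\<in>UNIV. of_int (a i) * (A $ i $ l)) - of_int z\<bar> < \<delta>) \<longrightarrow>
     real (card S) \<le> C * (h ^ CARD('d option) * \<delta> ^ CARD('m) + h powr (real CARD('d option) - real CARD('m) / \<sigma>))"
    by (elim exE conjE) (rule that, assumption+)
  show ?thesis
  proof (intro exI[of _ C] lattice_count.intro \<sigma>(2) C(1))
    fix h \<delta> :: real and S :: "('d option \<Rightarrow> int) set"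
    assume S: "1 \<le> h" "0 < \<delta>" "finite S" "\<And>a b i. a \<in> S \<Longrightarrow> b \<in> S \<Longrightarrow> \<bar>real_of_int (a i - b i)\<bar> \<le> h"
      "\<And>a l. a \<in> S \<Longrightarrow> \<exists>z::int. \<bar>(\<Sum>i\<in>UNIV. of_int (a i) * A $ i $ l) - of_int z\<bar> < \<delta>"
    have "\<forall>a\<in>S. \<forall>b\<in>S. \<forall>i. \<bar>real_of_int (a i - b i)\<bar> \<le> h" by (intro ballI allI S(4))
    moreover have "\<forall>a\<in>S. \<forall>l. \<exists>z::int. \<bar>(\<Sum>i\<in>UNIV. of_int (a i) * A $ i $ l) - of_int z\<bar> < \<delta>"
      by (intro ballI allI S(5))
    ultimately show "real (card S) \<le> C * (h ^ CARD('d option) * \<delta> ^ CARD('m)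
        + h powr (real CARD('d option) - real CARD('m) / \<sigma>))"
      using C(2)[THEN spec, THEN mp, OF S(1), THEN spec, THEN mp, OF S(2), THEN spec, THEN mp, OF S(3)] by (elim impE)
  qed
qed

text \<open>One half of Cauchy's condensation argument. On the block from \<open>2 ^ N\<close> to
  \<open>2 ^ (N + 1)\<close> the function \<open>\<psi>\<close> is at most its first value and, as
  \<open>e \<ge> 0\<close>, \<open>q powr e\<close> is at most \<open>(2 * 2 ^ N) powr e\<close>;
  the length of the block supplies the additional 1 in the exponent.\<close>

lemma dyadic_divergence:
  fixes \<psi> :: "nat \<Rightarrow> real"
  assumes pos: "\<And>q. q \<ge> 1 \<Longrightarrow> \<psi> q > 0" and anti: "antimono_on {1..} \<psi>" and e: "e \<ge> 0" "p > 0"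
    and div: "(\<Sum>q. ennreal (\<psi> (Suc q) powr p * real (Suc q) powr e)) = \<infinity>"
  shows "\<not> summable (\<lambda>k. real (2 ^ k) powr (e + 1) * \<psi> (2 ^ k) powr p)"
proof
  let ?B = "\<lambda>k. real (2 ^ k) powr (e + 1) * \<psi> (2 ^ k) powr p"
  let ?f = "\<lambda>q. \<psi> q powr p * real q powr e"
  assume sum: "summable ?B"
  have partial: "(\<Sum>q\<in>{1..<2 ^ N}. ?f q) \<le> (\<Sum>k<N. 2 powr e * ?B k)" for N :: nat
  proof (induction N)
    case (Suc N)
    have "{1..<2 ^ Suc N} = {1..<2 ^ N} \<union> {2 ^ N..<2 ^ Suc N :: nat}" by (auto simp: not_less)
    then have "(\<Sum>q\<in>{1..<2 ^ Suc N}. ?f q) = (\<Sum>q\<in>{1..<2 ^ N}. ?f q) + (\<Sum>q\<in>{2 ^ N..<2 ^ Suc N}. ?f q)"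
      by (simp add: sum.union_disjoint ivl_disj_int)
    also have "(\<Sum>q\<in>{2 ^ N..<2 ^ Suc N}. ?f q) \<le> (\<Sum>q\<in>{2 ^ N..<2 ^ Suc N :: nat}. \<psi> (2 ^ N) powr p * (2 * real (2 ^ N)) powr e)"
    proof (intro sum_mono mult_mono powr_mono2)
      fix q :: nat assume q: "q \<in> {2 ^ N..<2 ^ Suc N}"
      have "1 \<le> (2::nat) ^ N" by simp
      then show "\<psi> q \<le> \<psi> (2 ^ N)" "0 \<le> \<psi> q"
        using q monotone_onD[OF anti, of "2 ^ N" q] pos[of q] by auto
      have "q \<le> 2 * 2 ^ N" using q by simp
      then show "real q \<le> 2 * real (2 ^ N)" by (metis of_nat_le_iff of_nat_mult of_nat_numeral)
    qed (use e in auto)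
    also have "\<dots> = 2 powr e * ?B N"
      by (simp add: powr_mult powr_add)
    finally show ?case using Suc by simp
  qed simp
  have "summable (\<lambda>q. ?f (Suc q))"
  proof (rule bounded_imp_summable[where B = "\<Sum>k. 2 powr e * ?B k"])
    fix n
    have "(\<Sum>k\<le>n. ?f (Suc k)) = (\<Sum>q\<in>{1..Suc n}. ?f q)"
      by (rule sum.reindex_bij_witness[of _ "\<lambda>q. q - 1" Suc]) auto
    also have "\<dots> \<le> (\<Sum>q\<in>{1..<2 ^ Suc n}. ?f q)"
    proof (intro sum_mono2)
      have "Suc n < 2 ^ Suc n" by (rule less_exp)
      then show "{1..Suc n} \<subseteq> {1..<2 ^ Suc n}" by auto
    qed auto
    also have "\<dots> \<le> (\<Sum>k<Suc n. 2 powr e * ?B k)" by (rule partial)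
    also have "\<dots> \<le> (\<Sum>k. 2 powr e * ?B k)"
      using sum by (intro sum_le_suminf summable_mult) auto
    finally show "(\<Sum>k\<le>n. ?f (Suc k)) \<le> (\<Sum>k. 2 powr e * ?B k)" .
  qed auto
  then have "(\<Sum>q. ennreal (?f (Suc q))) = ennreal (\<Sum>q. ?f (Suc q))"
    by (intro suminf_ennreal2) auto
  then show False using div by simp
qed

section \<open>The parametrisation of the subspace and the choice of the parameters\<close>

definition graph_map :: "real ^ 'm::finite ^ ('d::finite) option \<Rightarrow> real ^ 'd \<Rightarrow> real ^ ('d + 'm)" where
  "graph_map A x = vec_append x (tilde x v* A)"

lemma graph_map_Inl: "graph_map A x $ Inl j = x $ j"
  by (simp add: graph_map_def vec_append_def)

lemma graph_map_Inr: "graph_map A x $ Inr l = A $ None $ l + (\<Sum>i\<in>UNIV. x $ i * A $ Some i $ l)"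
  by (simp add: graph_map_def vec_append_def vector_matrix_mult_def sum_option_UNIV tilde_def mult.commute)

lemma affine_graph_eq: "affine_graph A = range (graph_map A)"
  by (simp add: affine_graph_def graph_map_def)

text \<open>The error \<open>q x - p\<close> passes to the last \<open>m\<close> coordinates through
  the linear part of the map, which magnifies it by at most \<open>CA\<close>.\<close>

lemma dist_nearest_int_graph_map:
  fixes A :: "real ^ 'm::finite ^ ('d::finite) option" and x :: "real ^ 'd"
  assumes q: "q \<ge> 1" and x: "\<And>i. \<bar>real q * x $ i - of_int (p i)\<bar> \<le> b"
    and near: "nearly_integral (\<lambda>i l. A $ i $ l) e q p"
    and CA: "\<And>l. (\<Sum>i\<in>UNIV. \<bar>A $ Some i $ l\<bar>) \<le> CA" and b: "b < t" "CA * b + e \<le> t"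
  shows "dist_nearest_int (real q *\<^sub>R graph_map A x) < t"
proof (rule dist_nearest_int_lessI)
  fix i :: "'d + 'm"
  show "\<exists>z::int. \<bar>(real q *\<^sub>R graph_map A x) $ i - of_int z\<bar> < t"
  proof (cases i)
    case (Inl j)
    have "\<bar>(real q *\<^sub>R graph_map A x) $ i - of_int (p j)\<bar> < t"
      using x[of j] b(1) by (simp add: Inl graph_map_Inl)
    then show ?thesis ..
  next
    case (Inr l)
    obtain z :: int where z: "\<bar>real q * A $ None $ l + (\<Sum>i\<in>UNIV. of_int (p i) * A $ Some i $ l) - of_int z\<bar> < e"
      using near by (auto simp: nearly_integral_def)
    define w where "w = (\<Sum>i\<in>UNIV. (real q * x $ i - of_int (p i)) * A $ Some i $ l)"
    have "\<bar>w\<bar> \<le> (\<Sum>i\<in>UNIV. b * \<bar>A $ Some i $ l\<bar>)"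
      unfolding w_def using x by (intro order.trans[OF sum_abs] sum_mono) (simp add: abs_mult mult_right_mono)
    also have "\<dots> = (\<Sum>i\<in>UNIV. \<bar>A $ Some i $ l\<bar>) * b" by (simp add: sum_distrib_left mult.commute)
    also have "\<dots> \<le> CA * b"
      using CA[of l] order.trans[OF abs_ge_zero x] by (intro mult_right_mono) auto
    finally have "\<bar>w\<bar> \<le> CA * b" .
    moreover have "(real q *\<^sub>R graph_map A x) $ i - of_int z
        = (real q * A $ None $ l + (\<Sum>i\<in>UNIV. of_int (p i) * A $ Some i $ l) - of_int z) + w"
      by (simp add: Inr graph_map_Inr w_def distrib_left sum_distrib_left left_diff_distrib sum_subtractf mult.assoc)
    ultimately have "\<bar>(real q *\<^sub>R graph_map A x) $ i - of_int z\<bar> < t" using z b(2) by linarith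
    then show ?thesis ..
  qed
qed

text \<open>The truncation in \<open>\<delta>\<close> gives \<open>r \<le> \<rho>\<close>, and the
  restriction to \<open>K\<close> gives local ubiquity and small \<open>\<rho>\<close>. The point is
  that the divergence survives both.\<close>

lemma exists_ubiquitous_system:
  fixes A :: "real ^ 'm::finite ^ ('d::finite) option" and \<psi> :: "nat \<Rightarrow> real"
  assumes \<omega>: "diophantine_exponent A = ereal \<omega>"
    and \<tau>\<^sub>0: "\<tau>\<^sub>0 = 1 / max (real CARD('m)) \<omega>"
    and s: "(real CARD('d) + 1 - real CARD('m) * \<tau>\<^sub>0) / (\<tau>\<^sub>0 + 1) < s" "s \<le> real CARD('d)"
    and \<psi>: "\<And>q. q \<ge> 1 \<Longrightarrow> \<psi> q > 0" "antimono_on {1..} \<psi>"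
    and div: "(\<Sum>q. ennreal (\<psi> (Suc q) powr (real CARD('m) + s) * real (Suc q) powr (real CARD('d) - s))) = \<infinity>"
    and R: "R \<ge> 1"
  shows "\<exists>pts r \<rho> K \<kappa>. ubiquitous_system pts r \<rho> K \<kappa> R s \<and>
           (\<forall>x\<in>ubiquitous_system.W pts r K. graph_map A x \<in> psi_approximable \<psi>)"
proof -
  define d m where "d = CARD('d)" and "m = CARD('m)"
  have dm: "d \<ge> 1" "m \<ge> 1" by (simp_all add: d_def m_def Suc_leI)
  have \<tau>\<^sub>0_pos: "\<tau>\<^sub>0 > 0" and m\<tau>\<^sub>0: "real m * \<tau>\<^sub>0 \<le> 1"
    using dm by (auto simp: \<tau>\<^sub>0 m_def[symmetric] divide_le_eq max_def)
  have s_gt: "real d + 1 - real m * \<tau>\<^sub>0 < s * (\<tau>\<^sub>0 + 1)"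
    using s(1) \<tau>\<^sub>0_pos by (simp add: d_def m_def pos_divide_less_eq)
  have s0: "s > 0"
  proof (rule ccontr)
    assume "\<not> s > 0"
    then have "s * (\<tau>\<^sub>0 + 1) \<le> 0" using \<tau>\<^sub>0_pos by (intro mult_nonpos_nonneg) auto
    then show False using s_gt m\<tau>\<^sub>0 dm by linarith
  qed
  have sd: "s \<le> real d" using s(2) by (simp add: d_def)
  define p where "p = real m + s"
  have p: "p > 0" using s0 by (simp add: p_def add_nonneg_pos)
  define v where "v = real d + 1 - s"
  have v: "v \<ge> 1" using sd by (simp add: v_def)
  \<comment> \<open>The exponent for which \<open>\<delta> = X powr (-\<theta>)\<close> makes
    \<open>\<delta> powr p * X powr v\<close> equal to 1. Clearing denominators in the hypothesis on
    \<open>s\<close> gives \<open>\<theta> < \<tau>\<^sub>0\<close>.\<close>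
  define \<theta> where "\<theta> = v / p"
  have \<theta>: "\<theta> > 0" "\<theta> * p = v" using p v by (auto simp: \<theta>_def)
  have \<theta>\<tau>\<^sub>0: "\<theta> < \<tau>\<^sub>0" using s_gt p by (simp add: \<theta>_def v_def p_def pos_divide_less_eq algebra_simps)
  define \<tau> where "\<tau> = (\<theta> + \<tau>\<^sub>0) / 2"
  have \<tau>: "\<theta> < \<tau>" "\<tau> < \<tau>\<^sub>0" "\<tau> > 0" using \<theta> \<theta>\<tau>\<^sub>0 by (auto simp: \<tau>_def)
  have m\<tau>: "real m * \<tau> < 1"
  proof -
    have "real m * \<tau> < real m * \<tau>\<^sub>0" using \<tau>(2) dm by simp
    then show ?thesis using m\<tau>\<^sub>0 by linarith
  qed
  \<comment> \<open>\<open>1 / \<sigma>\<close> is the mean of \<open>\<tau>\<close> and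
    \<open>\<tau>\<^sub>0\<close>: this puts \<open>\<tau>\<close> below
    \<open>1 / \<sigma>\<close>, and \<open>\<sigma>\<close> above
    \<open>max m \<omega> = 1 / \<tau>\<^sub>0\<close>.\<close>
  define \<sigma> where "\<sigma> = 2 / (\<tau> + \<tau>\<^sub>0)"
  have "\<tau> < 1 / \<sigma>" using \<tau> by (simp add: \<sigma>_def)
  have "1 / \<tau>\<^sub>0 < \<sigma>" using \<tau> \<tau>\<^sub>0_pos by (simp add: \<sigma>_def field_simps)
  then have max_\<sigma>: "max (real m) \<omega> < \<sigma>" by (simp add: \<tau>\<^sub>0 m_def)
  obtain C where lc: "lattice_count (\<lambda>i l. A $ i $ l) \<sigma> C"
    using lattice_count_exponent[OF \<omega>, of \<sigma>] max_\<sigma> by (auto simp: m_def)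
  define \<alpha> where "\<alpha> = (\<lambda>i l. A $ i $ l)"
  have "\<exists>\<kappa>>0. \<exists>\<kappa>'>0. \<forall>(a :: real ^ 'd) l. 0 < l \<longrightarrow> l \<le> 1 \<longrightarrow> (\<forall>i. \<bar>a $ i\<bar> \<le> R) \<longrightarrow>
    (\<exists>Q0. \<forall>Q\<ge>Q0. \<forall>\<delta> \<rho>. real Q powr (-\<tau>) \<le> \<delta> \<longrightarrow> \<delta> \<le> 1 \<longrightarrow> 0 < \<rho> \<longrightarrow>
       \<rho> ^ d * (real Q ^ (d + 1) * \<delta> ^ m) = 1 \<longrightarrow>
       (\<exists>P. finite P \<and> P \<subseteq> cube a l \<inter> rational_points \<alpha> \<kappa> \<delta> Q \<and>
          (\<forall>x\<in>P. \<forall>y\<in>P. x \<noteq> y \<longrightarrow> (\<exists>i. \<rho> \<le> \<bar>x $ i - y $ i\<bar>)) \<and>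
          \<kappa>' * l ^ d \<le> real (card P) * \<rho> ^ d))"
    using lattice_count.ubiquity[OF lc R \<tau>(3) \<open>\<tau> < 1 / \<sigma>\<close>] unfolding \<alpha>_def d_def m_def .
  then obtain \<kappa> \<kappa>' where \<kappa>: "\<kappa> > 0" "\<kappa>' > 0" and ub: "\<forall>(a :: real ^ 'd) l. 0 < l \<longrightarrow> l \<le> 1 \<longrightarrow> (\<forall>i. \<bar>a $ i\<bar> \<le> R) \<longrightarrow>
    (\<exists>Q0. \<forall>Q\<ge>Q0. \<forall>\<delta> \<rho>. real Q powr (-\<tau>) \<le> \<delta> \<longrightarrow> \<delta> \<le> 1 \<longrightarrow> 0 < \<rho> \<longrightarrow>
       \<rho> ^ d * (real Q ^ (d + 1) * \<delta> ^ m) = 1 \<longrightarrow>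
       (\<exists>P. finite P \<and> P \<subseteq> cube a l \<inter> rational_points \<alpha> \<kappa> \<delta> Q \<and>
          (\<forall>x\<in>P. \<forall>y\<in>P. x \<noteq> y \<longrightarrow> (\<exists>i. \<rho> \<le> \<bar>x $ i - y $ i\<bar>)) \<and>
          \<kappa>' * l ^ d \<le> real (card P) * \<rho> ^ d))"
    by (elim exE conjE) (rule that, assumption+)
  define X where "X = (\<lambda>k. real (2 ^ k))"
  have X: "X k \<ge> 1" "X k > 0" for k by (simp_all add: X_def)
  \<comment> \<open>Truncated at \<open>X k powr (-\<theta>)\<close> to keep the weights
    \<open>\<Psi> k\<close> at most 1; together with \<open>r k \<le> 1\<close> and
    \<open>s \<le> d\<close> this yields \<open>r k \<le> \<rho> k\<close>.\<close>
  define \<delta> where "\<delta> = (\<lambda>k. min (\<psi> (2 ^ k)) (X k powr (-\<theta>)) / 2)"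
  have \<psi>_pos: "\<psi> (2 ^ k) > 0" for k by (rule \<psi>(1)) simp
  have \<delta>_pos: "\<delta> k > 0" for k using \<psi>_pos[of k] X(2)[of k] by (simp add: \<delta>_def)
  have \<delta>_le: "\<delta> k \<le> \<psi> (2 ^ k) / 2" "\<delta> k \<le> X k powr (-\<theta>) / 2" "\<delta> k \<le> 1" for k
  proof -
    show "\<delta> k \<le> \<psi> (2 ^ k) / 2" "\<delta> k \<le> X k powr (-\<theta>) / 2" by (simp_all add: \<delta>_def)
    moreover have "X k powr (-\<theta>) \<le> 1" using X(1)[of k] \<theta>(1) powr_mono[of "-\<theta>" 0 "X k"] by simp
    ultimately show "\<delta> k \<le> 1" by linarith
  qed
  have \<delta>_anti: "\<delta> (Suc k) \<le> \<delta> k" for k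
  proof -
    have "\<psi> (2 ^ Suc k) \<le> \<psi> (2 ^ k)" by (rule monotone_onD[OF \<psi>(2)]) auto
    moreover have "X (Suc k) powr (-\<theta>) \<le> X k powr (-\<theta>)" using \<theta> by (intro powr_mono2') (auto simp: X_def)
    ultimately show ?thesis by (auto simp: \<delta>_def intro: min.mono)
  qed
  define CA where "CA = (\<Sum>l\<in>UNIV. \<Sum>i\<in>UNIV. \<bar>A $ Some i $ l\<bar>)"
  have CA: "(\<Sum>i\<in>UNIV. \<bar>A $ Some i $ l\<bar>) \<le> CA" for l
    unfolding CA_def by (rule member_le_sum) (auto intro: sum_nonneg)
  have CA0: "CA \<ge> 0" unfolding CA_def by (intro sum_nonneg) auto
  \<comment> \<open>Small enough for an error of \<open>2 * c * \<delta>\<close> in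
    \<open>q x - p\<close> to add at most \<open>\<delta>\<close> to the distance in the last
    \<open>m\<close> coordinates.\<close>
  define c where "c = 1 / (4 * (CA + 1))"
  have c: "c > 0" "c \<le> 1 / 4" "CA * (4 * c) \<le> 1" using CA0 by (auto simp: c_def field_simps)
  define r where "r = (\<lambda>k. c * \<delta> k / X k)"
  define \<rho> where "\<rho> = (\<lambda>k. root d (1 / (X k ^ (d + 1) * \<delta> k ^ m)))"
  define K where "K = {k. X k powr (-\<tau>) \<le> \<delta> k}"
  define pts where "pts = (\<lambda>k. rational_points \<alpha> \<kappa> (\<delta> k) (2 ^ k))"
  have r_pos: "r k > 0" for k using c \<delta>_pos[of k] X(2)[of k] by (simp add: r_def)
  have r_half: "r (Suc k) \<le> r k / 2" for k
  proof -
    have "r (Suc k) = c * \<delta> (Suc k) / X k / 2" by (simp add: r_def X_def)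
    also have "\<dots> \<le> c * \<delta> k / X k / 2" using c X(2)[of k] \<delta>_anti[of k] by (intro divide_right_mono mult_left_mono) auto
    finally show ?thesis by (simp add: r_def)
  qed
  have \<rho>_pos: "\<rho> k > 0" and \<rho>_d: "\<rho> k ^ d = 1 / (X k ^ (d + 1) * \<delta> k ^ m)" for k
    using dm X(2)[of k] \<delta>_pos[of k] by (auto simp: \<rho>_def)
  define \<Psi> where "\<Psi> = (\<lambda>k. r k powr s / \<rho> k ^ d)"
  have \<Psi>_eq: "\<Psi> k = c powr s * (\<delta> k powr p * X k powr v)" for k
  proof -
    have "\<Psi> k = c powr s * \<delta> k powr s / X k powr s * (X k ^ (d + 1) * \<delta> k ^ m)"
      using c X(2)[of k] \<delta>_pos[of k] by (simp add: \<Psi>_def \<rho>_d r_def powr_mult powr_divide)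
    also have "X k ^ (d + 1) = X k powr (real d + 1)" using X(2)[of k] by (simp add: powr_add powr_realpow)
    also have "\<delta> k ^ m = \<delta> k powr (real m)" using \<delta>_pos[of k] by (simp add: powr_realpow)
    also have "c powr s * \<delta> k powr s / X k powr s * (X k powr (real d + 1) * \<delta> k powr real m)
        = c powr s * ((\<delta> k powr real m * \<delta> k powr s) * (X k powr (real d + 1) / X k powr s))" by simp
    also have "\<dots> = c powr s * (\<delta> k powr p * X k powr v)"
      by (simp add: p_def v_def powr_add powr_diff)
    finally show ?thesis .
  qed
  have \<Psi>_pos: "\<Psi> k > 0" for k unfolding \<Psi>_eq using c \<delta>_pos[of k] X(2)[of k] by simp
  have X_cancel: "(X k powr (-\<theta>)) powr p * X k powr v = 1" for k
    using X(2)[of k] \<theta>(2) by (simp add: powr_powr flip: powr_add)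
  have \<Psi>_le: "\<Psi> k \<le> 1" for k
  proof -
    have "\<delta> k powr p \<le> (X k powr (-\<theta>)) powr p"
      using \<delta>_le(2)[of k] \<delta>_pos[of k] p by (intro powr_mono2) auto
    then have "\<delta> k powr p * X k powr v \<le> 1"
      using X_cancel[of k] mult_right_mono[of "\<delta> k powr p" "(X k powr (-\<theta>)) powr p" "X k powr v"] by simp
    moreover have "c powr s \<le> 1" using c s0 powr_mono2[of s c 1] by simp
    ultimately show ?thesis unfolding \<Psi>_eq using c by (simp add: mult_le_one)
  qed
  have r_le_\<rho>: "r k \<le> \<rho> k" for k
  proof -
    have "r k \<le> 1"
    proof -
      have "c * \<delta> k \<le> 1 * 1" using c \<delta>_le(3)[of k] \<delta>_pos[of k] by (intro mult_mono) auto
      then show ?thesis using X[of k] by (simp add: r_def pos_divide_le_eq)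
    qed
    then have "r k powr real d \<le> r k powr s" using sd r_pos[of k] by (intro powr_mono') auto
    then have "r k ^ d \<le> r k powr s" using r_pos[of k] by (simp add: powr_realpow)
    also have "\<dots> = \<Psi> k * \<rho> k ^ d" using \<rho>_pos[of k] by (simp add: \<Psi>_def)
    also have "\<dots> \<le> 1 * \<rho> k ^ d" using \<Psi>_le[of k] \<rho>_pos[of k] by (intro mult_right_mono) auto
    finally show ?thesis using dm r_pos[of k] \<rho>_pos[of k] by (simp add: power_mono_iff)
  qed
  \<comment> \<open>On \<open>K\<close> the bound \<open>\<delta> k \<ge> X k powr (-\<tau>)\<close>
    with \<open>m * \<tau> < 1\<close> makes \<open>X k * \<delta> k ^ m\<close> at least 1.\<close>
  have \<rho>_le: "\<rho> k \<le> 1 / X k" if k: "k \<in> K" for k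
  proof -
    have "1 \<le> X k powr (1 - real m * \<tau>)" using X(1)[of k] m\<tau> by (intro ge_one_powr_ge_zero) auto
    also have "\<dots> = X k * (X k powr (-\<tau>)) ^ m" using X(2)[of k] by (simp add: powr_diff powr_power powr_minus mult.commute field_simps)
    also have "\<dots> \<le> X k * \<delta> k ^ m" using k X(2)[of k] by (intro mult_left_mono power_mono) (auto simp: K_def)
    finally have "X k ^ d * 1 \<le> X k ^ d * (X k * \<delta> k ^ m)" using X(2)[of k] by (intro mult_left_mono) auto
    then have "1 / (X k ^ (d + 1) * \<delta> k ^ m) \<le> 1 / X k ^ d"
      using X(2)[of k] \<delta>_pos[of k] by (intro divide_left_mono) (auto simp: mult_ac)
    then have "\<rho> k ^ d \<le> (1 / X k) ^ d" by (simp add: \<rho>_d power_one_over)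
    then show ?thesis using dm \<rho>_pos[of k] X(2)[of k] by (simp add: power_mono_iff)
  qed
  have X_large: "X k \<ge> real k" for k unfolding X_def using less_exp[of k] by simp
  have "ubiquitous_system pts r \<rho> K \<kappa>' R s"
  proof
    show "0 < s" "s \<le> real CARD('d)" "\<kappa>' > 0" by (fact s0) (fact s(2), fact \<kappa>(2))
    show "0 < r k" "r (Suc k) \<le> r k / 2" for k by (fact r_pos) (fact r_half)
    show "r k \<le> \<rho> k" if "k \<in> K" for k by (fact r_le_\<rho>)
    show "\<exists>k0. \<forall>k\<ge>k0. k \<in> K \<longrightarrow> \<rho> k < e" if e: "e > 0" for e
    proof -
      obtain k0 where k0: "1 / e < real k0" using reals_Archimedean2 by blast
      have "\<rho> k < e" if k: "k \<ge> k0" "k \<in> K" for k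
      proof -
        have "1 / e < X k" using k0 k(1) X_large[of k] by linarith
        then have "1 / X k < e" using e X(2)[of k] by (simp add: field_simps)
        then show ?thesis using \<rho>_le[OF k(2)] by linarith
      qed
      then show ?thesis by blast
    qed
    show "\<exists>k0. \<forall>k\<ge>k0. k \<in> K \<longrightarrow>
       (\<exists>P. finite P \<and> P \<subseteq> cube a l \<inter> pts k \<and>
          (\<forall>x\<in>P. \<forall>y\<in>P. x \<noteq> y \<longrightarrow> (\<exists>i. \<rho> k \<le> \<bar>x $ i - y $ i\<bar>)) \<and>
          \<kappa>' * l ^ CARD('d) \<le> real (card P) * \<rho> k ^ CARD('d))"
      if l: "0 < l" "l \<le> 1" and a: "\<And>i. \<bar>a $ i\<bar> \<le> R" for a :: "real ^ 'd" and l
    proof -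
      obtain Q0 where Q0: "\<forall>Q\<ge>Q0. \<forall>\<delta> \<rho>. real Q powr (-\<tau>) \<le> \<delta> \<longrightarrow> \<delta> \<le> 1 \<longrightarrow> 0 < \<rho> \<longrightarrow>
       \<rho> ^ d * (real Q ^ (d + 1) * \<delta> ^ m) = 1 \<longrightarrow>
       (\<exists>P. finite P \<and> P \<subseteq> cube a l \<inter> rational_points \<alpha> \<kappa> \<delta> Q \<and>
          (\<forall>x\<in>P. \<forall>y\<in>P. x \<noteq> y \<longrightarrow> (\<exists>i. \<rho> \<le> \<bar>x $ i - y $ i\<bar>)) \<and>
          \<kappa>' * l ^ d \<le> real (card P) * \<rho> ^ d)"
        using ub[THEN spec, of a, THEN spec, of l, THEN mp, OF l(1), THEN mp, OF l(2), THEN mp, OF allI[OF a]] by (elim exE) rule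
      show ?thesis
      proof (intro exI[of _ Q0] allI impI)
        fix k assume k: "k \<ge> Q0" "k \<in> K"
        have "2 ^ k \<ge> Q0" using k(1) less_exp[of k] by linarith
        moreover have "real (2 ^ k) powr (-\<tau>) \<le> \<delta> k" using k(2) by (simp add: K_def X_def)
        moreover have "\<rho> k ^ d * (real (2 ^ k) ^ (d + 1) * \<delta> k ^ m) = 1"
          using \<delta>_pos[of k] X(2)[of k] by (simp add: \<rho>_d X_def)
        ultimately show "\<exists>P. finite P \<and> P \<subseteq> cube a l \<inter> pts k \<and>
          (\<forall>x\<in>P. \<forall>y\<in>P. x \<noteq> y \<longrightarrow> (\<exists>i. \<rho> k \<le> \<bar>x $ i - y $ i\<bar>)) \<and>
          \<kappa>' * l ^ CARD('d) \<le> real (card P) * \<rho> k ^ CARD('d)"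
          unfolding pts_def d_def[symmetric]
          using Q0[THEN spec, of "2 ^ k", THEN mp, THEN spec, of "\<delta> k", THEN spec, of "\<rho> k"] \<delta>_le(3)[of k] \<rho>_pos[of k]
          by (simp only: simp_thms)
      qed
    qed
    show "\<exists>I. finite I \<and> I \<subseteq> K \<inter> {k0..} \<and> T \<le> (\<Sum>k\<in>I. r k powr s / \<rho> k ^ CARD('d))" for T k0
    proof (rule ccontr)
      \<comment> \<open>Bounded sums over \<open>K\<close> and geometrically small weights off
        \<open>K\<close> would make \<open>\<Psi>\<close> summable. Then \<open>\<Psi> k\<close>
        tends to 0, the truncation is inactive from some level on, and the condensed series of
        \<open>\<psi>\<close> converges, against the hypothesis.\<close>
      assume no: "\<not> ?thesis"
      define g where "g = (\<lambda>k. if k \<in> K \<and> k0 \<le> k then \<Psi> k else 0)"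
      have "summable g"
      proof (rule bounded_imp_summable)
        show "g k \<ge> 0" for k using \<Psi>_pos[of k] by (simp add: g_def)
        fix n
        have "(\<Sum>k\<le>n. g k) = (\<Sum>k\<in>{..n} \<inter> (K \<inter> {k0..}). \<Psi> k)"
          by (rule sum.mono_neutral_cong_right) (auto simp: g_def)
        moreover have "\<not> T \<le> (\<Sum>k\<in>{..n} \<inter> (K \<inter> {k0..}). \<Psi> k)"
        proof
          assume "T \<le> (\<Sum>k\<in>{..n} \<inter> (K \<inter> {k0..}). \<Psi> k)"
          then have "\<exists>I. finite I \<and> I \<subseteq> K \<inter> {k0..} \<and> T \<le> (\<Sum>k\<in>I. r k powr s / \<rho> k ^ CARD('d))"
            unfolding \<Psi>_def d_def by (intro exI[of _ "{..n} \<inter> (K \<inter> {k0..})"] conjI) auto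
          with no show False by contradiction
        qed
        ultimately show "(\<Sum>k\<le>n. g k) \<le> T" by simp
      qed
      define \<epsilon> where "\<epsilon> = (\<tau> - \<theta>) * p"
      have \<epsilon>: "\<epsilon> > 0" using \<tau> p by (simp add: \<epsilon>_def)
      define h where "h = (\<lambda>k. (2 powr (-\<epsilon>)) ^ k)"
      have "summable h" unfolding h_def using \<epsilon> by (intro summable_geometric) (auto simp: powr_minus_divide)
      have \<Psi>_h: "\<Psi> k \<le> h k" if "k \<notin> K" for k
      proof -
        have "\<delta> k \<le> X k powr (-\<tau>)" using that by (simp add: K_def)
        then have "\<delta> k powr p \<le> (X k powr (-\<tau>)) powr p" using \<delta>_pos[of k] p by (intro powr_mono2) auto
        then have "\<delta> k powr p * X k powr v \<le> (X k powr (-\<tau>)) powr p * X k powr v" by (intro mult_right_mono) auto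
        also have "\<dots> = X k powr (-\<epsilon>)"
          using \<theta>(2) by (simp add: powr_powr \<epsilon>_def algebra_simps flip: powr_add)
        also have "\<dots> = h k" by (simp add: X_def h_def powr_powr powr_realpow[symmetric] powr_power mult.commute)
        finally have "\<delta> k powr p * X k powr v \<le> h k" .
        moreover have "c powr s \<le> 1" using c s0 powr_mono2[of s c 1] by simp
        moreover have "0 \<le> \<delta> k powr p * X k powr v" by simp
        ultimately show ?thesis unfolding \<Psi>_eq by (smt (verit) mult_left_le_one_le powr_ge_zero)
      qed
      have "summable \<Psi>"
      proof (rule summable_comparison_test'[of "\<lambda>k. g k + h k" k0])
        show "summable (\<lambda>k. g k + h k)" using \<open>summable g\<close> \<open>summable h\<close> by (rule summable_add)
        show "norm (\<Psi> k) \<le> g k + h k" if "k \<ge> k0" for k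
          using that \<Psi>_h[of k] \<Psi>_pos[of k] by (auto simp: g_def h_def)
      qed
      \<comment> \<open>The exact value of \<open>\<Psi> k\<close> wherever the truncation is
        active; a smaller weight therefore shows
        \<open>\<delta> k = \<psi> (2 ^ k) / 2\<close>.\<close>
      define E0 where "E0 = c powr s * (1 / 2) powr p"
      have E0: "E0 > 0" using c by (simp add: E0_def)
      let ?B = "\<lambda>k. real (2 ^ k) powr (real d - s + 1) * \<psi> (2 ^ k) powr p"
      have B_le: "?B k \<le> \<Psi> k / E0" if "\<Psi> k < E0" for k
      proof -
        have min_eq: "\<delta> k powr p = (1 / 2) powr p * min (\<psi> (2 ^ k)) (X k powr (-\<theta>)) powr p"
          using \<psi>_pos[of k] by (simp add: \<delta>_def powr_divide)
        show ?thesis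
        proof (cases "\<psi> (2 ^ k) \<le> X k powr (-\<theta>)")
          case True
          then have "\<Psi> k = E0 * ?B k"
            unfolding \<Psi>_eq min_eq by (simp add: min_def E0_def X_def v_def algebra_simps)
          then show ?thesis using E0 by simp
        next
          case False
          then have "\<Psi> k = E0 * ((X k powr (-\<theta>)) powr p * X k powr v)"
            unfolding \<Psi>_eq min_eq by (simp add: min_def E0_def mult.assoc)
          then show ?thesis using that X_cancel[of k] by simp
        qed
      qed
      have "\<forall>\<^sub>F k in sequentially. \<Psi> k < E0"
        using summable_LIMSEQ_zero[OF \<open>summable \<Psi>\<close>] E0 by (rule order_tendstoD)
      then obtain k1 where k1: "\<And>k. k \<ge> k1 \<Longrightarrow> \<Psi> k < E0" by (auto simp: eventually_sequentially)
      have "summable ?B"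
      proof (rule summable_comparison_test'[of "\<lambda>k. \<Psi> k / E0" k1])
        show "summable (\<lambda>k. \<Psi> k / E0)" using \<open>summable \<Psi>\<close> by (rule summable_divide)
        show "norm (?B k) \<le> \<Psi> k / E0" if "k \<ge> k1" for k using B_le[OF k1[OF that]] by simp
      qed
      moreover have "\<not> summable ?B"
        by (rule dyadic_divergence[OF \<psi>]) (use sd p div in \<open>auto simp: p_def d_def m_def\<close>)
      ultimately show False by blast
    qed
  qed
  moreover have "graph_map A x \<in> psi_approximable \<psi>" if x: "x \<in> ubiquitous_system.W pts r K" for x
    unfolding psi_approximable_def mem_Collect_eq infinite_nat_iff_unbounded_le
  proof
    fix N :: nat
    \<comment> \<open>Denominators of level \<open>k\<close> are at least
      \<open>\<kappa> * 2 ^ k\<close>, so levels from \<open>k0\<close> on give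
      \<open>q \<ge> N\<close>, and hence infinitely many different \<open>q\<close>.\<close>
    obtain k0 where k0: "real N / \<kappa> \<le> real k0" using real_arch_simple by blast
    have "x \<in> ubiquitous_system.E pts r K k0"
      using x ubiquitous_system.W_def[OF \<open>ubiquitous_system pts r \<rho> K \<kappa>' R s\<close>] by auto
    then obtain k y where k: "k \<in> K" "k0 \<le> k" "y \<in> pts k" "\<And>i. \<bar>x $ i - y $ i\<bar> < 2 * r k"
      using ubiquitous_system.E_def[OF \<open>ubiquitous_system pts r \<rho> K \<kappa>' R s\<close>] by auto
    obtain q p where q: "1 \<le> q" "\<kappa> * X k \<le> real q" "q \<le> 2 ^ k" "y = (\<chi> i. of_int (p i) / real q)" "nearly_integral \<alpha> (\<delta> k) q p"
      using k(3) by (auto simp: pts_def rational_points_def X_def)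
    have "real N / \<kappa> \<le> X k" using k0 k(2) X_large[of k] by linarith
    then have "real N \<le> \<kappa> * X k" using \<kappa>(1) by (simp add: field_simps)
    then have "N \<le> q" using q(2) by linarith
    have qX: "real q \<le> X k" using q(3) unfolding X_def by (metis of_nat_le_iff)
    have "dist_nearest_int (real q *\<^sub>R graph_map A x) < 2 * \<delta> k"
    proof (rule dist_nearest_int_graph_map[where b = "2 * c * \<delta> k" and e = "\<delta> k", OF q(1) _ _ CA])
      show "nearly_integral (\<lambda>i l. A $ i $ l) (\<delta> k) q p" using q(5) by (simp add: \<alpha>_def)
      show "\<bar>real q * x $ i - of_int (p i)\<bar> \<le> 2 * c * \<delta> k" for i
      proof -
        have "real q * x $ i - of_int (p i) = real q * (x $ i - y $ i)" using q(1) by (simp add: q(4) right_diff_distrib)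
        also have "\<bar>\<dots>\<bar> \<le> X k * (2 * r k)"
          unfolding abs_mult using qX k(4)[of i] X(2)[of k] by (intro mult_mono) auto
        also have "\<dots> = 2 * c * \<delta> k" using X(2)[of k] by (simp add: r_def)
        finally show ?thesis .
      qed
      have "2 * c * \<delta> k \<le> (1 / 2) * \<delta> k" using c \<delta>_pos[of k] by (intro mult_right_mono) auto
      then show "2 * c * \<delta> k < 2 * \<delta> k" using \<delta>_pos[of k] by linarith
      have "CA * (4 * c) * \<delta> k \<le> 1 * \<delta> k" using c \<delta>_pos[of k] by (intro mult_right_mono) auto
      moreover have "0 \<le> CA * (c * \<delta> k)" using CA0 c \<delta>_pos[of k] by simp
      ultimately show "CA * (2 * c * \<delta> k) + \<delta> k \<le> 2 * \<delta> k" by (simp add: algebra_simps)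
    qed
    also have "\<dots> \<le> \<psi> (2 ^ k)" using \<delta>_le(1)[of k] by simp
    also have "\<dots> \<le> \<psi> q" by (rule monotone_onD[OF \<psi>(2)]) (use q in auto)
    finally show "\<exists>n\<ge>N. 1 \<le> n \<and> dist_nearest_int (real n *\<^sub>R graph_map A x) < \<psi> n"
      using q(1) \<open>N \<le> q\<close> by blast
  qed
  ultimately show ?thesis by blast
qed

section \<open>Transfer between the subspace and its parameter space\<close>

lemma component_le_dist: "\<bar>x $ i - y $ i\<bar> \<le> dist x y" for x y :: "real ^ 'n::finite"
  using component_le_norm_cart[of "x - y" i] by (simp add: dist_norm)

lemma graph_map_lipschitz:
  fixes A :: "real ^ 'm::finite ^ ('d::finite) option"
  shows "\<exists>B>0. \<forall>x y. dist (graph_map A x) (graph_map A y) \<le> B * dist x y"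
proof -
  define B where "B = real CARD('d) + (\<Sum>l\<in>UNIV. \<Sum>i\<in>UNIV. \<bar>A $ Some i $ l\<bar>)"
  have "dist (graph_map A x) (graph_map A y) \<le> B * dist x y" for x y
  proof -
    have "dist (graph_map A x) (graph_map A y) \<le> (\<Sum>i\<in>UNIV. \<bar>(graph_map A x - graph_map A y) $ i\<bar>)"
      unfolding dist_norm by (rule norm_le_l1_cart)
    also have "\<dots> = (\<Sum>j\<in>UNIV. \<bar>x $ j - y $ j\<bar>) + (\<Sum>l\<in>UNIV. \<bar>graph_map A x $ Inr l - graph_map A y $ Inr l\<bar>)"
      by (simp add: UNIV_Plus_UNIV[symmetric] sum.Plus graph_map_Inl del: UNIV_Plus_UNIV)
    also have "\<dots> \<le> (\<Sum>j\<in>(UNIV :: 'd set). dist x y) + (\<Sum>l\<in>UNIV. \<Sum>i\<in>UNIV. \<bar>A $ Some i $ l\<bar> * dist x y)"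
    proof (intro add_mono sum_mono component_le_dist)
      fix l
      have "graph_map A x $ Inr l - graph_map A y $ Inr l = (\<Sum>i\<in>UNIV. A $ Some i $ l * (x $ i - y $ i))"
        by (simp add: graph_map_Inr algebra_simps sum_subtractf)
      also have "\<bar>\<dots>\<bar> \<le> (\<Sum>i\<in>UNIV. \<bar>A $ Some i $ l\<bar> * dist x y)"
        by (intro order.trans[OF sum_abs] sum_mono) (simp add: abs_mult component_le_dist mult_left_mono)
      finally show "\<bar>graph_map A x $ Inr l - graph_map A y $ Inr l\<bar> \<le> (\<Sum>i\<in>UNIV. \<bar>A $ Some i $ l\<bar> * dist x y)" .
    qed
    also have "\<dots> = B * dist x y" by (simp add: B_def distrib_right sum_distrib_right)
    finally show ?thesis .
  qed
  moreover have "B > 0" unfolding B_def by (intro add_pos_nonneg sum_nonneg) auto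
  ultimately show ?thesis by blast
qed

text \<open>A left inverse of the graph map that does not increase distances, so that covers of
  subsets of the subspace can be pushed down to the parameter space.\<close>

definition base_point :: "real ^ ('d::finite + 'm::finite) \<Rightarrow> real ^ 'd" where
  "base_point y = (\<chi> j. y $ Inl j)"

lemma base_point_graph_map: "base_point (graph_map A x) = x"
  by (simp add: base_point_def graph_map_Inl vec_eq_iff)

lemma base_point_dist: "dist (base_point y) (base_point z) \<le> dist y z"
proof -
  have "(\<Sum>j\<in>UNIV. (dist (y $ Inl j) (z $ Inl j))\<^sup>2) \<le> (\<Sum>i\<in>UNIV. (dist (y $ i) (z $ i))\<^sup>2)"
    by (simp add: UNIV_Plus_UNIV[symmetric] sum.Plus sum_nonneg del: UNIV_Plus_UNIV)
  then show ?thesis by (simp add: dist_vec_def L2_set_def base_point_def)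
qed

lemma hausdorff_measure_mono: "X \<subseteq> Y \<Longrightarrow> hausdorff_measure s X \<le> hausdorff_measure s Y"
  unfolding hausdorff_measure_def hausdorff_delta_def
  by (intro SUP_mono' INF_superset_mono) auto

text \<open>A cover of \<open>X\<close> with finite sum would project to a cover of the whole space,
  up to a null set, by sets of finite total Lebesgue measure.\<close>

lemma hausdorff_measure_full_projection:
  fixes X :: "'b::metric_space set" and p :: "'b \<Rightarrow> real ^ 'd::finite"
  assumes Z: "Z \<in> null_sets lborel" and X: "- Z \<subseteq> p ` X" and p: "\<And>x y. dist (p x) (p y) \<le> dist x y"
  shows "hausdorff_measure (real CARD('d)) X = \<infinity>"
proof -
  define d where "d = CARD('d)"
  have "top \<le> hausdorff_delta (real d) 1 X"
    unfolding hausdorff_delta_def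
  proof (rule INF_greatest)
    fix U :: "nat \<Rightarrow> 'b set"
    assume "U \<in> {U. X \<subseteq> (\<Union>i. U i) \<and> (\<forall>i. bounded (U i) \<and> diameter (U i) \<le> 1)}"
    then have U: "X \<subseteq> (\<Union>i. U i)" "\<And>i. bounded (U i)" by auto
    have "\<exists>C\<in>sets borel. p ` U i \<subseteq> C \<and> emeasure lborel C \<le> ennreal (2 ^ d) * ennreal (diam_pow (real d) (U i))" for i
    proof (cases "U i = {}")
      case True
      then show ?thesis by (intro bexI[of _ "{}"]) auto
    next
      case False
      then obtain u where u: "u \<in> U i" by blast
      define D where "D = diameter (U i)"
      have D: "D \<ge> 0" unfolding D_def by (rule diameter_ge_0[OF U(2)])
      have "p ` U i \<subseteq> cube (p u) D"
      proof safe
        fix w assume "w \<in> U i"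
        then have "dist (p w) (p u) \<le> D"
          using diameter_bounded_bound[OF U(2) _ u] p[of w u] unfolding D_def by (meson order.trans)
        then show "p w \<in> cube (p u) D"
          unfolding cube_def using component_le_dist[of "p w" _ "p u"] by (auto intro: order.trans)
      qed
      moreover have "emeasure lborel (cube (p u) D) \<le> ennreal (2 ^ d) * ennreal (diam_pow (real d) (U i))"
      proof -
        have "emeasure lborel (cube (p u) D) = ennreal (2 ^ d * D ^ d)"
          using D by (simp add: emeasure_eq_measure2 measure_cube d_def power_mult_distrib)
        moreover have "D ^ d \<le> diam_pow (real d) (U i)"
        proof -
          have "diam_pow (real d) (U i) = D powr real d"
            using False by (simp add: diam_pow_def D_def d_def)
          moreover have "D ^ d \<le> D powr real d"
            using D by (cases "D = 0") (auto simp: powr_realpow d_def power_0_left)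
          ultimately show ?thesis by simp
        qed
        ultimately show ?thesis by (simp add: ennreal_leI flip: ennreal_mult')
      qed
      ultimately show ?thesis by blast
    qed
    then obtain C where C: "\<And>i. C i \<in> sets borel" "\<And>i. p ` U i \<subseteq> C i"
      "\<And>i. emeasure lborel (C i) \<le> ennreal (2 ^ d) * ennreal (diam_pow (real d) (U i))" by metis
    have "UNIV \<subseteq> Z \<union> (\<Union>i. C i)"
    proof
      fix x show "x \<in> Z \<union> (\<Union>i. C i)"
      proof (cases "x \<in> Z")
        case False
        then obtain w where "w \<in> X" "x = p w" using X by blast
        then obtain i where "w \<in> U i" using U(1) by blast
        then have "x \<in> C i" using C(2)[of i] \<open>x = p w\<close> by blast
        then show ?thesis by blast
      qed simp
    qed
    moreover have Z_sets: "Z \<in> sets lborel" using Z by (rule null_setsD2)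
    moreover have C_sets: "(\<Union>i. C i) \<in> sets lborel" using C(1) by (intro sets.countable_UN) auto
    ultimately have "emeasure lborel (UNIV :: (real ^ 'd) set) \<le> emeasure lborel (Z \<union> (\<Union>i. C i))"
      by (intro emeasure_mono sets.Un)
    also have "\<dots> \<le> emeasure lborel Z + emeasure lborel (\<Union>i. C i)"
      using Z_sets C_sets by (rule emeasure_subadditive)
    also have "\<dots> = emeasure lborel (\<Union>i. C i)" using null_setsD1[OF Z] by simp
    also have "\<dots> \<le> (\<Sum>i. emeasure lborel (C i))"
      by (rule emeasure_subadditive_countably) (use C(1) in auto)
    also have "\<dots> \<le> (\<Sum>i. ennreal (2 ^ d) * ennreal (diam_pow (real d) (U i)))"
      by (intro suminf_le C(3)) auto
    also have "\<dots> = ennreal (2 ^ d) * (\<Sum>i. ennreal (diam_pow (real d) (U i)))" by simp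
    finally have "ennreal (2 ^ d) * (\<Sum>i. ennreal (diam_pow (real d) (U i))) = top"
      by (simp add: top_unique)
    then show "top \<le> (\<Sum>i. ennreal (diam_pow (real d) (U i)))"
      by (auto simp: ennreal_mult_eq_top_iff)
  qed
  moreover have "hausdorff_delta (real d) 1 X \<le> hausdorff_measure (real d) X"
    unfolding hausdorff_measure_def by (intro SUP_upper) auto
  ultimately show ?thesis by (simp add: d_def top_unique)
qed

theorem theorem2p6:
  fixes d m n :: nat
    and A :: "real ^ 'm::finite ^ ('d::finite) option"
    and L :: "(real ^ ('d + 'm)) set"
    and \<omega> \<tau>\<^sub>0 s :: real
    and \<psi> :: "nat \<Rightarrow> real"
  assumes "d = CARD('d)" and "m = CARD('m)" and "n = d + m"
    and "L = affine_graph A"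
    and "diophantine_exponent A = ereal \<omega>" and "\<omega> < real n"
    and "\<tau>\<^sub>0 = 1 / max (real m) \<omega>"
    and "(real d + 1 - real m * \<tau>\<^sub>0) / (\<tau>\<^sub>0 + 1) < s" and "s \<le> real d"
    and "\<And>q. q \<ge> 1 \<Longrightarrow> \<psi> q > 0" and "antimono_on {1..} \<psi>"
    and "(\<Sum>q. ennreal (\<psi> (Suc q) powr (real m + s) * real (Suc q) powr (real d - s))) = \<infinity>"
  shows "hausdorff_measure s (psi_approximable \<psi> \<inter> L) = \<infinity> \<and>
         (s = real d \<longrightarrow> hausdorff_measure (real d) (L - psi_approximable \<psi>) = 0)"
proof -
  have sys: "\<exists>pts r \<rho> K \<kappa>. ubiquitous_system pts r \<rho> K \<kappa> R s \<and>
      (\<forall>x\<in>ubiquitous_system.W pts r K. graph_map A x \<in> psi_approximable \<psi>)" if "R \<ge> 1" for R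
    by (rule exists_ubiquitous_system[OF assms(5) assms(7)[unfolded assms(2)]])
       (use assms(8-12) that in \<open>simp_all only: assms(1,2)\<close>)
  have L: "L = range (graph_map A)" by (simp add: assms(4) affine_graph_eq)
  show ?thesis
  proof (cases "s < real d")
    case True
    \<comment> \<open>For \<open>s < d\<close> the limsup set over one fixed bounded region already
      forces infinite measure.\<close>
    obtain pts r \<rho> K \<kappa> where u: "ubiquitous_system pts r \<rho> K \<kappa> 1 s"
      and W: "\<And>x. x \<in> ubiquitous_system.W pts r K \<Longrightarrow> graph_map A x \<in> psi_approximable \<psi>"
      using sys[of 1] by auto
    have "ubiquitous_system.W pts r K \<subseteq> base_point ` (psi_approximable \<psi> \<inter> L)"
    proof
      fix x assume "x \<in> ubiquitous_system.W pts r K"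
      then have "graph_map A x \<in> psi_approximable \<psi> \<inter> L" using W by (simp add: L)
      then show "x \<in> base_point ` (psi_approximable \<psi> \<inter> L)"
        by (metis base_point_graph_map imageI)
    qed
    then have "hausdorff_measure s (psi_approximable \<psi> \<inter> L) = \<infinity>"
      using True assms(1) by (intro ubiquitous_system.hausdorff_measure_infinite[OF u _ _ base_point_dist]) auto
    then show ?thesis using True by simp
  next
    case False
    then have sd: "s = real CARD('d)" using assms(1,9) by simp
    define Z where "Z = {x. graph_map A x \<notin> psi_approximable \<psi>}"
    \<comment> \<open>A ubiquitous system is uniform only on \<open>cube 0 R\<close>, so the radii
      are exhausted one by one. As no measurability of \<open>Z\<close> has been established, a null
      set containing its part in the cube is produced instead.\<close>
    have "\<exists>V. V \<in> null_sets lborel \<and> cube 0 R \<inter> Z \<subseteq> V" if R: "R \<ge> 1" for R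
    proof -
      obtain pts r \<rho> K \<kappa> where u: "ubiquitous_system pts r \<rho> K \<kappa> R s"
        and W: "\<And>x. x \<in> ubiquitous_system.W pts r K \<Longrightarrow> graph_map A x \<in> psi_approximable \<psi>"
        using sys[OF R] by blast
      interpret ubiquitous_system pts r \<rho> K \<kappa> R s by (rule u)
      have "emeasure lborel (cube 0 R - W) = 0"
      proof (rule null_complement_if_positive_proportion[OF W_sets])
        show "\<kappa>\<^sup>2 / (10 * 64 ^ CARD('d)) * l ^ CARD('d) \<le> measure lborel (W \<inter> cube a l)"
          if "0 < l" "l \<le> 1" "\<And>i. \<bar>a $ i\<bar> \<le> R" for a l
          by (rule positive_proportion_W[OF sd that])
      qed (use \<kappa> R in auto)
      then have "cube 0 R - W \<in> null_sets lborel" using W_sets by (intro null_setsI) auto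
      moreover have "cube 0 R \<inter> Z \<subseteq> cube 0 R - W" using W by (auto simp: Z_def)
      ultimately show ?thesis by blast
    qed
    then have "\<exists>V. V \<in> null_sets lborel \<and> cube 0 (real (Suc k)) \<inter> Z \<subseteq> V" for k by simp
    then obtain V where V: "\<And>k. V k \<in> null_sets lborel" "\<And>k. cube 0 (real (Suc k)) \<inter> Z \<subseteq> V k" by metis
    define N where "N = (\<Union>k. V k)"
    have N: "N \<in> null_sets lborel" unfolding N_def using V(1) by auto
    have ZN: "Z \<subseteq> N"
    proof
      fix x assume x: "x \<in> Z"
      obtain k where k: "norm x \<le> real k" using real_arch_simple by blast
      have "\<bar>x $ i\<bar> \<le> real (Suc k)" for i using component_le_norm_cart[of x i] k by simp
      then have "x \<in> cube 0 (real (Suc k)) \<inter> Z" using x by (simp add: cube_def)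
      then show "x \<in> N" using V(2)[of k] by (auto simp: N_def)
    qed
    obtain B where B: "B > 0" "\<And>x y. dist (graph_map A x) (graph_map A y) \<le> B * dist x y"
      using graph_map_lipschitz[of A] by blast
    have "L - psi_approximable \<psi> \<subseteq> graph_map A ` N" using ZN by (auto simp: L Z_def)
    then have "hausdorff_measure (real CARD('d)) (L - psi_approximable \<psi>) \<le> hausdorff_measure (real CARD('d)) (graph_map A ` N)"
      by (rule hausdorff_measure_mono)
    also have "\<dots> = 0" by (rule hausdorff_measure_lipschitz_null[OF N B(2,1)])
    finally have "hausdorff_measure (real d) (L - psi_approximable \<psi>) = 0" by (simp add: assms(1))
    moreover have "hausdorff_measure s (psi_approximable \<psi> \<inter> L) = \<infinity>"
      unfolding sd
    proof (rule hausdorff_measure_full_projection[OF N _ base_point_dist])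
      show "- N \<subseteq> base_point ` (psi_approximable \<psi> \<inter> L)"
      proof
        fix x assume "x \<in> - N"
        then have "graph_map A x \<in> psi_approximable \<psi> \<inter> L" using ZN by (auto simp: Z_def L)
        then show "x \<in> base_point ` (psi_approximable \<psi> \<inter> L)" by (metis base_point_graph_map imageI)
      qed
    qed
    ultimately show ?thesis by blast
  qed
qed

end
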